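(* Let $n\in\mathbb N$ and $g\in\mathbb N_{\ge1}$. 1) $L^{h,h'}(n,g)$ is a representation of $U_{h,h'}(\mathfrak{sl}_2,g)$ of finite rank equal to $n+1$. 2) $L^{h,h'}(n,g)$ is a formal deformation of the irreducible representation $L(n)$ of $U(\mathfrak{sl}_2)$ along $h$ and $h'$. 3) $L^{h,h'}(n,g)$ is a formal deformation of the representation $L^h(n)$ of $U_h(\mathfrak{sl}_2)$ along $h'$. 4) $L^{h,h'}(n,g)$ is a weight representation. 5) The action of $U_{h,h'}(\mathfrak{sl}_2,g)$ on $L^{h,h'}(n,g)$ is given in the topological basis $(m_j)_{0\le j\le n}$ by $$H.m_j=(n-2j)\,m_j,\qquad C.m_j=(n+1)^2\,m_j,\qquad X^-.m_j=m_{j+1},$$ $$X^+.m_j=[j]_{QT^{\{j\}}}\,[n-j+1]_{QT^{\{n-j+1\}}}\,m_{j-1}$$ (with $m_{-1}=m_{n+1}:=0$).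
   Context: $\mathbb N=\{0,1,2,\dots\}$. For a vector space $V$, $V[[\bar h]]$ is the space of formal power series in the parameters $\bar h$ with coefficients in $V$. The $\mathbb C[[\bar h]]$-algebra topologically generated by a set $X$ with relations $\mathcal R$ is $\mathbb C\langle X\rangle[[\bar h]]$ modulo the $\bar h$-adic closure of the two-sided ideal generated by $\mathcal R$. Definition of $U_{h,h'}(\mathfrak{sl}_2,g)$. Let $\varepsilon=\exp(i\pi/g)$, $Q=\exp(h)$, $T=\exp(h')$, $$P(u)=\tfrac12\left(u^{g-1}+u^{1-g}\right)\prod_{k=1}^{g-1}\frac{\varepsilon^k u-\varepsilon^{-k}u^{-1}}{\varepsilon^k-\varepsilon^{-k}}.$$ $U_{h,h'}(\mathfrak{sl}_2,g)$ is the $\mathbb C[[h,h']]$-algebra topologically generated by $X^+,X^-,H,C$ with relations $[C,X^\pm]=[C,H]=0$, $[H,X^\pm]=\pm2X^\pm$, $$X^\pm X^\mp=\prod_{e=1,-1}\frac{\left(Q\,T^{\{H_e^\pm\}_Q}\right)^{H_e^\pm}-\left(Q\,T^{\{H_e^\pm\}_Q}\right)^{-H_e^\pm}}{Q\,T^{\{H_e^\pm\}_Q}-Q^{-1}T^{-\{H_e^\pm\}_Q}},$$ where $H_e^\pm=\frac12(\sqrt C+eH\mp e)$, $\{H_e^\pm\}_Q=P(Q^{H_e^\pm})$. Numerator and denominator are series in $\mathbb C[H,\sqrt C][[h,h']]$, each divided by $h+h'\{H_e^\pm\}_Q$ before the quotient is taken; the product over $e$ is invariant under $\sqrt C\mapsto-\sqrt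 C$, and $(\sqrt C)^2$ is replaced by $C$. $U=U(\mathfrak{sl}_2)$ has generators $\bar X^\pm,\bar H$ with $[\bar H,\bar X^\pm]=\pm2\bar X^\pm$, $[\bar X^+,\bar X^-]=\bar H$. $U^h=U_h(\mathfrak{sl}_2)$ is the $\mathbb C[[h]]$-algebra topologically generated by $\tilde X^\pm,\tilde H$ with $[\tilde H,\tilde X^\pm]=\pm2\tilde X^\pm$, $[\tilde X^+,\tilde X^-]=\sinh(h\tilde H)/\sinh(h)$. Matching the (topological) bases $(\bar X^-)^a\bar H^b(\bar X^+)^c$, $(\tilde X^-)^a\tilde H^b(\tilde X^+)^c$, $(X^-)^aH^b(X^+)^c$, one identifies $U^h=U[[h]]$ and $U^{h,h'}:=U_{h,h'}(\mathfrak{sl}_2,g)=U[[h,h']]=U^h[[h']]$ as modules; these are formal deformations of $U$ and $U^h$. Verma modules: $M(n)=U/\big(U\bar X^++U(\bar H-n1)\big)$, $M^h(n)=U^h/\big(U^h\tilde X^++U^h(\tilde H-n1)\big)$, $M^{h,h'}(n,g)=U^{h,h'}/\big(U^{h,h'}X^++U^{h,h'}(H-n1)\big)$; $m_0$ is the class of $1$ and $m_j=(X^-)^jm_0$ (resp. with $\bar X^-,\tilde X^-$), and $M^h(n)=M(n)[[h]]$, $M^{h,h'}(n,g)=M(n)[[h,h']]$ as modules. For $n\in\mathbb N$, $L(n)$, $L^h(n)$ and $L^{h,h'}(n,g)$ are the quotients of $M(n)$, $M^h(n)$, $M^{h,h'}(n,g)$ by the subrepresentations $\bigoplus_{j\ge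 n+1}\mathbb C m_j$, $\big(\bigoplus_{j\ge n+1}\mathbb C m_j\big)[[h]]$, $\big(\bigoplus_{j\ge n+1}\mathbb C m_j\big)[[h,h']]$ respectively. A representation of $U_{h,h'}(\mathfrak{sl}_2,g)$ is an action by $\mathbb C[[h,h']]$-linear operators on $V[[h,h']]$ for a $\mathbb C$-vector space $V$; its rank is $\dim V$. It is a formal deformation along $h,h'$ (resp. along $h'$) of the representation of $U(\mathfrak{sl}_2)$ on $V$ (resp. of $U_h(\mathfrak{sl}_2)$ on $V[[h]]$) which it induces modulo $(h,h')$ (resp. modulo $h'$). It is a weight representation if it is the direct sum of its weight spaces $\{f:Hf=mf\}$, $m\in\mathbb Z$. For $a\in\mathbb Z$: $\{a\}=P(Q^a)$ and $[a]_{QT^{\{a\}}}=\frac{(QT^{\{a\}})^a-(QT^{\{a\}})^{-a}}{QT^{\{a\}}-Q^{-1}T^{-\{a\}}}\in\mathbb C[[h,h']]$. *)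

theory Defs
  imports
    Complex_Main
    "HOL-Library.Poly_Mapping"
    "HOL-Computational_Algebra.Polynomial"
    "HOL-Computational_Algebra.Formal_Power_Series"
    "HOL-Algebra.QuotRing"
    "Jordan_Normal_Form.Missing_VectorSpace"
begin

section \<open>Conventions\<close>

text \<open>
  \<open>'a fps\<close> is $A[[h]]$ and \<open>'a fps fps\<close> is $A[[h]][[h']] = A[[h,h']]$: the inner variable is $h$, the
  outer variable is $h'$, so \<open>fps_nth (fps_nth f j) i\<close> is the coefficient of $h^i h'^j$ and
  \<open>fps_nth f 0\<close> is the reduction modulo $h'$.
\<close>

abbreviation type_ring :: "'a::{times,plus,one,zero} ring" where
  "type_ring \<equiv> \<lparr>carrier = UNIV, mult = (*), one = 1, zero = 0, add = (+)\<rparr>"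

definition fps_map :: "('a \<Rightarrow> 'b) \<Rightarrow> 'a fps \<Rightarrow> 'b fps" where
  "fps_map \<phi> f = Abs_fps (\<lambda>i. \<phi> (fps_nth f i))"

abbreviation fps_map2 :: "('a \<Rightarrow> 'b) \<Rightarrow> 'a fps fps \<Rightarrow> 'b fps fps" where
  "fps_map2 \<phi> \<equiv> fps_map (fps_map \<phi>)"

abbreviation const2 :: "'a::zero \<Rightarrow> 'a fps fps" where
  "const2 a \<equiv> fps_const (fps_const a)"

text \<open>Closures for the $h$-adic and the $(h,h')$-adic topology.\<close>

definition adic_closure :: "'a fps set \<Rightarrow> 'a fps set" where
  "adic_closure S = {f. \<forall>N. \<exists>s\<in>S. \<forall>i<N. fps_nth f i = fps_nth s i}"

definition adic_closure2 :: "'a fps fps set \<Rightarrow> 'a fps fps set" where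
  "adic_closure2 S = {f. \<forall>N. \<exists>s\<in>S. \<forall>i j. i + j < N \<longrightarrow>
     fps_nth (fps_nth f j) i = fps_nth (fps_nth s j) i}"

section \<open>Free algebras\<close>

text \<open>Words under concatenation; \<open>'x fword \<Rightarrow>\<^sub>0 complex\<close> is the free unital algebra
  $\mathbb{C}\langle X\rangle$.\<close>

datatype 'x fword = FWord "'x list"

instantiation fword :: (type) monoid_add
begin

definition zero_fword :: "'a fword" where "zero_fword = FWord []"

fun plus_fword :: "'a fword \<Rightarrow> 'a fword \<Rightarrow> 'a fword" where
  "plus_fword (FWord u) (FWord v) = FWord (u @ v)"

instance
proof
  fix a b c :: "'a fword"
  show "a + b + c = a + (b + c)" by (cases a; cases b; cases c) simp
  show "0 + a = a" by (cases a) (simp add: zero_fword_def)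
  show "a + 0 = a" by (cases a) (simp add: zero_fword_def)
qed

end

type_synonym 'x free_alg = "'x fword \<Rightarrow>\<^sub>0 complex"

definition gen :: "'x \<Rightarrow> 'x free_alg" where
  "gen x = Poly_Mapping.single (FWord [x]) 1"

definition scal :: "complex \<Rightarrow> 'x free_alg" where
  "scal c = Poly_Mapping.single 0 c"

definition commutator :: "'a::ring \<Rightarrow> 'a \<Rightarrow> 'a" where
  "commutator a b = a * b - b * a"

text \<open>Linear map on the complex vector space with basis \<open>'k\<close> extending \<open>b\<close>.\<close>

definition lin_ext :: "('k \<Rightarrow> 'x free_alg) \<Rightarrow> ('k \<Rightarrow>\<^sub>0 complex) \<Rightarrow> 'x free_alg" where
  "lin_ext b p = (\<Sum>k\<in>Poly_Mapping.keys p. scal (Poly_Mapping.lookup p k) * b k)"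

section \<open>Exponentials and quantum numbers\<close>

text \<open>
  The exact quotient in an integral domain. The series ring $R[[h,h']]$ occurs below for $R$ a
  polynomial ring, where the division of \<open>fps\<close> is not available.
\<close>

definition exact_div :: "'a::idom \<Rightarrow> 'a \<Rightarrow> 'a" where
  "exact_div a b = (THE q. a = q * b)"

text \<open>
  Exponentials of series without constant term, over a coefficient ring \<open>'r\<close> that contains the
  complex numbers through \<open>\<kappa>\<close>. The sums are finite since $f^k$ has order at least $k$.
\<close>

definition fexp :: "(complex \<Rightarrow> 'r::idom) \<Rightarrow> 'r fps \<Rightarrow> 'r fps" where
  "fexp \<kappa> f = Abs_fps (\<lambda>i. \<Sum>k\<le>i. \<kappa> (1 / fact k) * fps_nth (f ^ k) i)"

definition fexp2 :: "(complex \<Rightarrow> 'r::idom) \<Rightarrow> 'r fps fps \<Rightarrow> 'r fps fps" where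
  "fexp2 \<kappa> f = Abs_fps (\<lambda>j. Abs_fps (\<lambda>i.
     \<Sum>k\<le>i + j. \<kappa> (1 / fact k) * fps_nth (fps_nth (f ^ k) j) i))"

definition fsinh :: "(complex \<Rightarrow> 'r::idom) \<Rightarrow> 'r fps \<Rightarrow> 'r fps" where
  "fsinh \<kappa> f = fps_const (\<kappa> (1/2)) * (fexp \<kappa> f - fexp \<kappa> (- f))"

definition hvar :: "'r::idom fps fps" where "hvar = fps_const fps_X"
definition hvar' :: "'r::idom fps fps" where "hvar' = fps_X"

definition eps :: "nat \<Rightarrow> complex" where
  "eps g = exp (\<i> * of_real pi / of_nat g)"

definition Pfun :: "(complex \<Rightarrow> 'r::idom) \<Rightarrow> nat \<Rightarrow> 'r fps fps \<Rightarrow> 'r fps fps" where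
  "Pfun \<kappa> g u = (let v = exact_div 1 u in
     const2 (\<kappa> (1/2)) * (u ^ (g - 1) + v ^ (g - 1)) *
     (\<Prod>k = 1..g - 1. const2 (\<kappa> (1 / (eps g ^ k - inverse (eps g ^ k)))) *
        (const2 (\<kappa> (eps g ^ k)) * u - const2 (\<kappa> (inverse (eps g ^ k))) * v)))"

text \<open>$Q^y = \exp(hy)$, $\{y\}_Q = P(Q^y)$ and $(QT^x)^y = \exp((h + h'x)y)$, for $y \in R$ and
  $x \in R[[h,h']]$.\<close>

definition Qpow :: "(complex \<Rightarrow> 'r::idom) \<Rightarrow> 'r \<Rightarrow> 'r fps fps" where
  "Qpow \<kappa> y = fexp2 \<kappa> (hvar * const2 y)"

definition brace :: "(complex \<Rightarrow> 'r::idom) \<Rightarrow> nat \<Rightarrow> 'r \<Rightarrow> 'r fps fps" where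
  "brace \<kappa> g y = Pfun \<kappa> g (Qpow \<kappa> y)"

definition QTpow :: "(complex \<Rightarrow> 'r::idom) \<Rightarrow> 'r fps fps \<Rightarrow> 'r \<Rightarrow> 'r fps fps" where
  "QTpow \<kappa> x y = fexp2 \<kappa> ((hvar + hvar' * x) * const2 y)"

text \<open>$[y]_{QT^{\{y\}}}$; numerator and denominator are first divided by $h + h'\{y\}$, after which the
  denominator is a unit.\<close>

definition qbracket :: "(complex \<Rightarrow> 'r::idom) \<Rightarrow> nat \<Rightarrow> 'r \<Rightarrow> 'r fps fps" where
  "qbracket \<kappa> g y = (let x = brace \<kappa> g y; w = hvar + hvar' * x in
     exact_div (exact_div (QTpow \<kappa> x y - QTpow \<kappa> x (- y)) w)
               (exact_div (QTpow \<kappa> x 1 - QTpow \<kappa> x (- 1)) w))"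

definition qint :: "nat \<Rightarrow> int \<Rightarrow> complex fps fps" where
  "qint g a = qbracket (\<lambda>c. c) g (of_int a)"

section \<open>The three algebras\<close>

datatype gen3 = Xp | Xm | Hg
datatype gen4 = G gen3 | Cg

definition U_ideal :: "gen3 free_alg set" where
  "U_ideal = Idl\<^bsub>type_ring\<^esub>
     {commutator (gen Hg) (gen Xp) - 2 * gen Xp,
      commutator (gen Hg) (gen Xm) + 2 * gen Xm,
      commutator (gen Xp) (gen Xm) - gen Hg}"

definition Usl :: "gen3 free_alg set ring" where
  "Usl = type_ring Quot U_ideal"

definition U_class :: "gen3 free_alg \<Rightarrow> gen3 free_alg set" where
  "U_class a = U_ideal +>\<^bsub>type_ring\<^esub> a"

text \<open>$\sinh(hH)/\sinh(h)$ as a series in $\mathbb{C}[H][[h]]$, and the substitution of the generator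
  for $H$.\<close>

definition sinh_quot :: "complex poly fps" where
  "sinh_quot = exact_div (fsinh (\<lambda>c. [:c:]) (fps_X * fps_const [:0, 1:]))
                         (fsinh (\<lambda>c. [:c:]) fps_X)"

definition eval_H :: "complex poly \<Rightarrow> gen3 free_alg" where
  "eval_H p = (\<Sum>b\<le>degree p. scal (coeff p b) * gen Hg ^ b)"

definition Uh_ideal :: "gen3 free_alg fps set" where
  "Uh_ideal = adic_closure (Idl\<^bsub>type_ring\<^esub>
     (let x = (\<lambda>y. fps_const (gen y)) in
     {commutator (x Hg) (x Xp) - 2 * x Xp,
      commutator (x Hg) (x Xm) + 2 * x Xm,
      commutator (x Xp) (x Xm) - fps_map eval_H sinh_quot}))"

definition Uh :: "gen3 free_alg fps set ring" where
  "Uh = type_ring Quot Uh_ideal"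

definition Uh_class :: "gen3 free_alg fps \<Rightarrow> gen3 free_alg fps set" where
  "Uh_class a = Uh_ideal +>\<^bsub>type_ring\<^esub> a"

text \<open>
  \<open>complex poly poly\<close> is $\mathbb{C}[H][\sqrt C]$ in \<open>H_elt\<close>, and $\mathbb{C}[H][C]$ in \<open>eval_HC\<close>; the
  inner variable is $H$. The parameters \<open>\<sigma>\<close> and \<open>e\<close> are $\pm 1$, with \<open>\<sigma>\<close> the sign in $H_e^\pm$.
\<close>

abbreviation kappa_HC :: "complex \<Rightarrow> complex poly poly" where
  "kappa_HC c \<equiv> [:[:c:]:]"

definition H_elt :: "int \<Rightarrow> int \<Rightarrow> complex poly poly" where
  "H_elt \<sigma> e = kappa_HC (1/2) * ([:0, 1:] + of_int e * [:[:0, 1:]:] - of_int (\<sigma> * e))"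

definition XX_series :: "nat \<Rightarrow> int \<Rightarrow> complex poly poly fps fps" where
  "XX_series g \<sigma> = (\<Prod>e\<in>{1, - 1}. qbracket kappa_HC g (H_elt \<sigma> e))"

text \<open>Replaces $(\sqrt C)^2$ by $C$ in a polynomial that is even in $\sqrt C$.\<close>

definition sqrt_elim :: "complex poly poly \<Rightarrow> complex poly poly" where
  "sqrt_elim p = (THE r. pcompose r [:0, 0, 1:] = p)"

definition eval_HC :: "complex poly poly \<Rightarrow> gen4 free_alg" where
  "eval_HC r = (\<Sum>c\<le>degree r. \<Sum>b\<le>degree (coeff r c).
     scal (coeff (coeff r c) b) * gen (G Hg) ^ b * gen Cg ^ c)"

definition XX_rhs :: "nat \<Rightarrow> int \<Rightarrow> gen4 free_alg fps fps" where
  "XX_rhs g \<sigma> = fps_map2 (\<lambda>p. eval_HC (sqrt_elim p)) (XX_series g \<sigma>)"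

definition Uhh_ideal :: "nat \<Rightarrow> gen4 free_alg fps fps set" where
  "Uhh_ideal g = adic_closure2 (Idl\<^bsub>type_ring\<^esub>
     (let x = (\<lambda>y. const2 (gen y)) in
     {commutator (x Cg) (x (G Xp)),
      commutator (x Cg) (x (G Xm)),
      commutator (x Cg) (x (G Hg)),
      commutator (x (G Hg)) (x (G Xp)) - 2 * x (G Xp),
      commutator (x (G Hg)) (x (G Xm)) + 2 * x (G Xm),
      x (G Xp) * x (G Xm) - XX_rhs g 1,
      x (G Xm) * x (G Xp) - XX_rhs g (- 1)}))"

definition Uhh :: "nat \<Rightarrow> gen4 free_alg fps fps set ring" where
  "Uhh g = type_ring Quot Uhh_ideal g"

definition Uhh_class :: "nat \<Rightarrow> gen4 free_alg fps fps \<Rightarrow> gen4 free_alg fps fps set" where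
  "Uhh_class g a = Uhh_ideal g +>\<^bsub>type_ring\<^esub> a"

text \<open>Structure maps of the algebras over $\mathbb{C}$, $\mathbb{C}[[h]]$, $\mathbb{C}[[h,h']]$.\<close>

definition U_scal :: "complex \<Rightarrow> gen3 free_alg set" where
  "U_scal c = U_class (scal c)"

definition Uh_scal :: "complex fps \<Rightarrow> gen3 free_alg fps set" where
  "Uh_scal c = Uh_class (fps_map scal c)"

definition Uhh_scal :: "nat \<Rightarrow> complex fps fps \<Rightarrow> gen4 free_alg fps fps set" where
  "Uhh_scal g c = Uhh_class g (fps_map2 scal c)"

definition Uhh_gen :: "nat \<Rightarrow> gen4 \<Rightarrow> gen4 free_alg fps fps set" where
  "Uhh_gen g y = Uhh_class g (const2 (gen y))"

text \<open>
  The (topological) bases $(X^-)^a H^b (X^+)^c$. The identifications $U[[h]] = U^h$ and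
  $U[[h,h']] = U^h[[h']] = U^{h,h'}$ match the elements with the same coordinates \<open>p\<close>, so \<open>Uhh_pbw g p\<close>
  reduces to \<open>U_pbw (fps_nth (fps_nth p 0) 0)\<close> modulo $(h,h')$ and to \<open>Uh_pbw (fps_nth p 0)\<close>
  modulo $h'$.
\<close>

type_synonym pbw = "(nat \<times> nat \<times> nat) \<Rightarrow>\<^sub>0 complex"

definition pbw3 :: "nat \<times> nat \<times> nat \<Rightarrow> gen3 free_alg" where
  "pbw3 = (\<lambda>(a, b, c). gen Xm ^ a * gen Hg ^ b * gen Xp ^ c)"

definition pbw4 :: "nat \<times> nat \<times> nat \<Rightarrow> gen4 free_alg" where
  "pbw4 = (\<lambda>(a, b, c). gen (G Xm) ^ a * gen (G Hg) ^ b * gen (G Xp) ^ c)"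

definition U_pbw :: "pbw \<Rightarrow> gen3 free_alg set" where
  "U_pbw p = U_class (lin_ext pbw3 p)"

definition Uh_pbw :: "pbw fps \<Rightarrow> gen3 free_alg fps set" where
  "Uh_pbw p = Uh_class (fps_map (lin_ext pbw3) p)"

definition Uhh_pbw :: "nat \<Rightarrow> pbw fps fps \<Rightarrow> gen4 free_alg fps fps set" where
  "Uhh_pbw g p = Uhh_class g (fps_map2 (lin_ext pbw4) p)"

section \<open>Left modules\<close>

text \<open>The locale \<open>module\<close> of HOL-Algebra requires a commutative ring.\<close>

locale left_module = R?: ring R + M?: abelian_group M
  for R :: "('a, 'd) ring_scheme" (structure) and M :: "('a, 'b, 'c) module_scheme" (structure) +
  assumes smult_closed:
      "\<lbrakk>a \<in> carrier R; x \<in> carrier M\<rbrakk> \<Longrightarrow> a \<odot>\<^bsub>M\<^esub> x \<in> carrier M"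
    and smult_l_distr:
      "\<lbrakk>a \<in> carrier R; b \<in> carrier R; x \<in> carrier M\<rbrakk> \<Longrightarrow>
       (a \<oplus>\<^bsub>R\<^esub> b) \<odot>\<^bsub>M\<^esub> x = a \<odot>\<^bsub>M\<^esub> x \<oplus>\<^bsub>M\<^esub> b \<odot>\<^bsub>M\<^esub> x"
    and smult_r_distr:
      "\<lbrakk>a \<in> carrier R; x \<in> carrier M; y \<in> carrier M\<rbrakk> \<Longrightarrow>
       a \<odot>\<^bsub>M\<^esub> (x \<oplus>\<^bsub>M\<^esub> y) = a \<odot>\<^bsub>M\<^esub> x \<oplus>\<^bsub>M\<^esub> a \<odot>\<^bsub>M\<^esub> y"
    and smult_assoc:
      "\<lbrakk>a \<in> carrier R; b \<in> carrier R; x \<in> carrier M\<rbrakk> \<Longrightarrow>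
       (a \<otimes>\<^bsub>R\<^esub> b) \<odot>\<^bsub>M\<^esub> x = a \<odot>\<^bsub>M\<^esub> (b \<odot>\<^bsub>M\<^esub> x)"
    and smult_one: "x \<in> carrier M \<Longrightarrow> \<one>\<^bsub>R\<^esub> \<odot>\<^bsub>M\<^esub> x = x"

definition regular_module :: "'a ring \<Rightarrow> ('a, 'a) module" where
  "regular_module A = \<lparr>carrier = carrier A, mult = mult A, one = one A, zero = zero A,
     add = add A, smult = mult A\<rparr>"

definition quot_module :: "('a, 'b) module \<Rightarrow> 'b set \<Rightarrow> ('a, 'b set) module" where
  "quot_module M N = \<lparr>carrier = a_rcosets\<^bsub>M\<^esub> N, mult = undefined, one = undefined, zero = N,
     add = set_add M, smult = (\<lambda>a S. \<Union>x\<in>S. N +>\<^bsub>M\<^esub> (a \<odot>\<^bsub>M\<^esub> x))\<rparr>"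

definition restrict_scalars :: "('r \<Rightarrow> 'a) \<Rightarrow> ('a, 'b) module \<Rightarrow> ('r, 'b) module" where
  "restrict_scalars \<eta> M = \<lparr>carrier = carrier M, mult = undefined, one = undefined, zero = zero M,
     add = add M, smult = (\<lambda>c. smult M (\<eta> c))\<rparr>"

definition irreducible_module :: "'a ring \<Rightarrow> ('a, 'b) module \<Rightarrow> bool" where
  "irreducible_module A M \<longleftrightarrow> left_module A M \<and> carrier M \<noteq> {zero M} \<and>
     (\<forall>N. Module.submodule N A M \<longrightarrow> N = {zero M} \<or> N = carrier M)"

definition module_iso :: "('r, 'b) module \<Rightarrow> ('r::comm_ring_1, 'c) module \<Rightarrow> ('b \<Rightarrow> 'c) set" where
  "module_iso M N = {\<phi> \<in> module_hom type_ring M N. bij_betw \<phi> (carrier M) (carrier N)}"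

text \<open>$V[[t]]$ for an \<open>'r\<close>-module $V$, as a module over \<open>'r fps\<close>. Applied twice, it gives
  $V[[h,h']]$, with the same order of indices as for \<open>fps fps\<close>.\<close>

definition series_module :: "('r, 'v) module \<Rightarrow> ('r fps, nat \<Rightarrow> 'v) module" where
  "series_module V = \<lparr>carrier = {f. \<forall>i. f i \<in> carrier V}, mult = undefined, one = undefined,
     zero = (\<lambda>_. zero V), add = (\<lambda>f f' i. f i \<oplus>\<^bsub>V\<^esub> f' i),
     smult = (\<lambda>c f i. \<Oplus>\<^bsub>V\<^esub> k\<in>{..i}. fps_nth c k \<odot>\<^bsub>V\<^esub> f (i - k))\<rparr>"

definition const_series :: "('r, 'v) module \<Rightarrow> 'v \<Rightarrow> nat \<Rightarrow> 'v" where
  "const_series V v = (\<lambda>i. if i = 0 then v else zero V)"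

definition is_direct_sum :: "('a, 'b) module \<Rightarrow> ('i \<Rightarrow> 'b set) \<Rightarrow> bool" where
  "is_direct_sum M W \<longleftrightarrow> (\<forall>i. W i \<subseteq> carrier M) \<and>
     (\<forall>x\<in>carrier M. \<exists>!f. (\<forall>i. f i \<in> W i) \<and> finite {i. f i \<noteq> zero M} \<and>
        x = (\<Oplus>\<^bsub>M\<^esub> i\<in>{i. f i \<noteq> zero M}. f i))"

section \<open>Verma modules and their finite quotients\<close>

definition verma_ideal :: "'a ring \<Rightarrow> 'a \<Rightarrow> 'a \<Rightarrow> nat \<Rightarrow> 'a set" where
  "verma_ideal A X H n = {a \<otimes>\<^bsub>A\<^esub> X \<oplus>\<^bsub>A\<^esub> b \<otimes>\<^bsub>A\<^esub> (H \<ominus>\<^bsub>A\<^esub> [n] \<cdot>\<^bsub>A\<^esub> \<one>\<^bsub>A\<^esub>) | a b.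
     a \<in> carrier A \<and> b \<in> carrier A}"

definition verma :: "'a ring \<Rightarrow> 'a \<Rightarrow> 'a \<Rightarrow> nat \<Rightarrow> ('a, 'a set) module" where
  "verma A X H n = quot_module (regular_module A) (verma_ideal A X H n)"

definition verma_class :: "'a ring \<Rightarrow> 'a \<Rightarrow> 'a \<Rightarrow> nat \<Rightarrow> 'a \<Rightarrow> 'a set" where
  "verma_class A X H n a = verma_ideal A X H n +>\<^bsub>A\<^esub> a"

definition Verma :: "nat \<Rightarrow> (gen3 free_alg set, gen3 free_alg set set) module" where
  "Verma n = verma Usl (U_class (gen Xp)) (U_class (gen Hg)) n"

definition M_class :: "nat \<Rightarrow> gen3 free_alg set \<Rightarrow> gen3 free_alg set set" where
  "M_class n = verma_class Usl (U_class (gen Xp)) (U_class (gen Hg)) n"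

definition Verma_h :: "nat \<Rightarrow> (gen3 free_alg fps set, gen3 free_alg fps set set) module" where
  "Verma_h n = verma Uh (Uh_class (fps_const (gen Xp))) (Uh_class (fps_const (gen Hg))) n"

definition Mh_class :: "nat \<Rightarrow> gen3 free_alg fps set \<Rightarrow> gen3 free_alg fps set set" where
  "Mh_class n = verma_class Uh (Uh_class (fps_const (gen Xp))) (Uh_class (fps_const (gen Hg))) n"

definition Verma_hh ::
  "nat \<Rightarrow> nat \<Rightarrow> (gen4 free_alg fps fps set, gen4 free_alg fps fps set set) module" where
  "Verma_hh n g = verma (Uhh g) (Uhh_gen g (G Xp)) (Uhh_gen g (G Hg)) n"

definition Mhh_class ::
  "nat \<Rightarrow> nat \<Rightarrow> gen4 free_alg fps fps set \<Rightarrow> gen4 free_alg fps fps set set" where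
  "Mhh_class n g = verma_class (Uhh g) (Uhh_gen g (G Xp)) (Uhh_gen g (G Hg)) n"

text \<open>
  The subrepresentations $\bigoplus_{j\ge n+1}\mathbb{C}m_j$, $(\bigoplus_{j\ge n+1}\mathbb{C}m_j)[[h]]$ and
  $(\bigoplus_{j\ge n+1}\mathbb{C}m_j)[[h,h']]$. Here \<open>p\<close> is a series of vectors in the coordinates
  $(m_j)_j$ of $M(n)$, and since $m_j = (X^-)^j m_0$ it is matched with the class of the series
  obtained by replacing $m_j$ by $(X^-)^j$.
\<close>

definition M_sub :: "nat \<Rightarrow> gen3 free_alg set set set" where
  "M_sub n = {M_class n (U_class (lin_ext (\<lambda>j. gen Xm ^ j) p)) | p :: nat \<Rightarrow>\<^sub>0 complex.
     Poly_Mapping.keys p \<subseteq> {n + 1..}}"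

definition Mh_sub :: "nat \<Rightarrow> gen3 free_alg fps set set set" where
  "Mh_sub n = {Mh_class n (Uh_class (fps_map (lin_ext (\<lambda>j. gen Xm ^ j)) p)) |
     p :: (nat \<Rightarrow>\<^sub>0 complex) fps. \<forall>i. Poly_Mapping.keys (fps_nth p i) \<subseteq> {n + 1..}}"

definition Mhh_sub :: "nat \<Rightarrow> nat \<Rightarrow> gen4 free_alg fps fps set set set" where
  "Mhh_sub n g = {Mhh_class n g (Uhh_class g (fps_map2 (lin_ext (\<lambda>j. gen (G Xm) ^ j)) p)) |
     p :: (nat \<Rightarrow>\<^sub>0 complex) fps fps.
       \<forall>i j. Poly_Mapping.keys (fps_nth (fps_nth p j) i) \<subseteq> {n + 1..}}"

definition Lrep :: "nat \<Rightarrow> (gen3 free_alg set, gen3 free_alg set set set) module" where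
  "Lrep n = quot_module (Verma n) (M_sub n)"

definition Lrep_h :: "nat \<Rightarrow> (gen3 free_alg fps set, gen3 free_alg fps set set set) module" where
  "Lrep_h n = quot_module (Verma_h n) (Mh_sub n)"

definition Lrep_hh ::
  "nat \<Rightarrow> nat \<Rightarrow> (gen4 free_alg fps fps set, gen4 free_alg fps fps set set set) module" where
  "Lrep_hh n g = quot_module (Verma_hh n g) (Mhh_sub n g)"

text \<open>The classes of $m_j = (X^-)^j m_0$ in the three quotients.\<close>

definition L_vec :: "nat \<Rightarrow> nat \<Rightarrow> gen3 free_alg set set set" where
  "L_vec n j = M_sub n +>\<^bsub>Verma n\<^esub>
     ((U_class (gen Xm) [^]\<^bsub>Usl\<^esub> j) \<odot>\<^bsub>Verma n\<^esub> M_class n \<one>\<^bsub>Usl\<^esub>)"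

definition Lh_vec :: "nat \<Rightarrow> nat \<Rightarrow> gen3 free_alg fps set set set" where
  "Lh_vec n j = Mh_sub n +>\<^bsub>Verma_h n\<^esub>
     ((Uh_class (fps_const (gen Xm)) [^]\<^bsub>Uh\<^esub> j) \<odot>\<^bsub>Verma_h n\<^esub> Mh_class n \<one>\<^bsub>Uh\<^esub>)"

definition Lhh_vec :: "nat \<Rightarrow> nat \<Rightarrow> nat \<Rightarrow> gen4 free_alg fps fps set set set" where
  "Lhh_vec n g j = Mhh_sub n g +>\<^bsub>Verma_hh n g\<^esub>
     ((Uhh_gen g (G Xm) [^]\<^bsub>Uhh g\<^esub> j) \<odot>\<^bsub>Verma_hh n g\<^esub> Mhh_class n g \<one>\<^bsub>Uhh g\<^esub>)"

section \<open>Representations and formal deformations\<close>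

abbreviation over_C :: "(gen3 free_alg set, 'v) module \<Rightarrow> (complex, 'v) module" where
  "over_C W \<equiv> restrict_scalars U_scal W"

abbreviation over_Ch :: "(gen3 free_alg fps set, 'v) module \<Rightarrow> (complex fps, 'v) module" where
  "over_Ch W \<equiv> restrict_scalars Uh_scal W"

abbreviation over_Chh ::
  "nat \<Rightarrow> (gen4 free_alg fps fps set, 'v) module \<Rightarrow> (complex fps fps, 'v) module" where
  "over_Chh g W \<equiv> restrict_scalars (Uhh_scal g) W"

text \<open>\<open>W\<close> is a left module acted on by linear operators whose underlying module is identified
  with $V[[h]]$ (resp. $V[[h,h']]$) through \<open>\<phi>\<close>.\<close>

definition representation_h ::
  "(complex, 'v) module \<Rightarrow> (gen3 free_alg fps set, 'w) module \<Rightarrow> ((nat \<Rightarrow> 'v) \<Rightarrow> 'w) \<Rightarrow> bool" where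
  "representation_h V W \<phi> \<longleftrightarrow> vectorspace type_ring V \<and> left_module Uh W \<and>
     (\<forall>x\<in>carrier Uh. (\<lambda>w. x \<odot>\<^bsub>W\<^esub> w) \<in> module_hom type_ring (over_Ch W) (over_Ch W)) \<and>
     \<phi> \<in> module_iso (series_module V) (over_Ch W)"

definition representation_hh ::
  "nat \<Rightarrow> (complex, 'v) module \<Rightarrow> (gen4 free_alg fps fps set, 'w) module \<Rightarrow>
   ((nat \<Rightarrow> nat \<Rightarrow> 'v) \<Rightarrow> 'w) \<Rightarrow> bool" where
  "representation_hh g V W \<phi> \<longleftrightarrow> vectorspace type_ring V \<and> left_module (Uhh g) W \<and>
     (\<forall>x\<in>carrier (Uhh g).
        (\<lambda>w. x \<odot>\<^bsub>W\<^esub> w) \<in> module_hom type_ring (over_Chh g W) (over_Chh g W)) \<and>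
     \<phi> \<in> module_iso (series_module (series_module V)) (over_Chh g W)"

text \<open>The representation \<open>W\<close> on $V[[h,h']]$ induces modulo $(h,h')$ the given representation of $U$ on
  \<open>V\<close>.\<close>

definition deformation_along_hh ::
  "nat \<Rightarrow> (gen3 free_alg set, 'v) module \<Rightarrow> (gen4 free_alg fps fps set, 'w) module \<Rightarrow>
   ((nat \<Rightarrow> nat \<Rightarrow> 'v) \<Rightarrow> 'w) \<Rightarrow> bool" where
  "deformation_along_hh g V W \<phi> \<longleftrightarrow>
     left_module Usl V \<and> representation_hh g (over_C V) W \<phi> \<and>
     (\<forall>p. \<forall>f\<in>carrier (series_module (series_module (over_C V))).
      \<forall>f'\<in>carrier (series_module (series_module (over_C V))).
        \<phi> f' = Uhh_pbw g p \<odot>\<^bsub>W\<^esub> \<phi> f \<longrightarrow>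
        f' 0 0 = U_pbw (fps_nth (fps_nth p 0) 0) \<odot>\<^bsub>V\<^esub> f 0 0)"

text \<open>The representation \<open>W\<close> of \<open>Uhh g\<close> on $V[[h]][[h']]$ induces modulo $h'$ the representation \<open>Vh\<close> of
  \<open>Uh\<close> on $V[[h]]$; \<open>\<chi>\<close> identifies $V[[h]]$ with \<open>Vh\<close>, and \<open>\<psi>\<close> identifies \<open>Vh\<close>$[[h']]$ with \<open>W\<close>.\<close>

definition deformation_along_h' ::
  "nat \<Rightarrow> (complex, 'u) module \<Rightarrow> (gen3 free_alg fps set, 'v) module \<Rightarrow>
   (gen4 free_alg fps fps set, 'w) module \<Rightarrow> ((nat \<Rightarrow> 'u) \<Rightarrow> 'v) \<Rightarrow> ((nat \<Rightarrow> 'v) \<Rightarrow> 'w) \<Rightarrow> bool" where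
  "deformation_along_h' g V Vh W \<chi> \<psi> \<longleftrightarrow>
     representation_h V Vh \<chi> \<and> representation_hh g V W (\<lambda>f. \<psi> (\<lambda>j. \<chi> (f j))) \<and>
     \<psi> \<in> module_iso (series_module (over_Ch Vh)) (over_Chh g W) \<and>
     (\<forall>p. \<forall>f\<in>carrier (series_module (over_Ch Vh)). \<forall>f'\<in>carrier (series_module (over_Ch Vh)).
        \<psi> f' = Uhh_pbw g p \<odot>\<^bsub>W\<^esub> \<psi> f \<longrightarrow>
        f' 0 = Uh_pbw (fps_nth p 0) \<odot>\<^bsub>Vh\<^esub> f 0)"

definition weight_space ::
  "nat \<Rightarrow> (gen4 free_alg fps fps set, 'w) module \<Rightarrow> int \<Rightarrow> 'w set" where
  "weight_space g W m =
     {f \<in> carrier W. Uhh_gen g (G Hg) \<odot>\<^bsub>W\<^esub> f = Uhh_scal g (of_int m) \<odot>\<^bsub>W\<^esub> f}"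

definition weight_representation ::
  "nat \<Rightarrow> (gen4 free_alg fps fps set, 'w) module \<Rightarrow> bool" where
  "weight_representation g W \<longleftrightarrow> is_direct_sum W (weight_space g W)"

end

theory Submission
  imports Defs
begin

text \<open>
  The modules $L(n)$, $L^h(n)$, $L^{h,h'}(n,g)$ are generated by the class $m_0$ of $1$, so they have the form
  $A/K$ where $A$ is a free algebra, or a ring of power series over one, and $K$ is the left ideal
  of all elements that kill $m_0$. The proof computes $K$ by comparing two descriptions.

  From above: the free algebra acts on sequences $(u_j)_{j \<ge> 0}$, read as $\sum_j u_j m_j$,
  with $X^-$ the shift, $H$ diagonal, $C$ the scalar $(n+1)^2$ and $X^+ m_j = a_j m_{j-1}$, where
  $a_j$ is $[j]_{QT^{\{j\}}}[n-j+1]_{QT^{\{n-j+1\}}}$, $[j]_Q[n-j+1]_Q$ or $j(n-j+1)$. The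
  relations hold for these operators (\<open>rep0_kills\<close>, \<open>rep1_kills\<close>, \<open>rep2_kills\<close>). For
  $X^\pm X^\mp$ the reason is that $H = n-2j$ and $\sqrt C = n+1$ turn the two numbers $H_e^\pm$ into
  $n-j$ and $j+1$, respectively $n-j+1$ and $j$, and that brackets commute with ring homomorphisms
  (\<open>qbracket_map\<close>). For $U_h$ it is the identity $[a+1][b]-[a][b+1]=[b-a]$
  (\<open>sinh_ratio_commutator\<close>). Because $a_{n+1} = 0$, the sequences that vanish on
  $\{0,\dots,n\}$ form a subrepresentation, and the first $n+1$ entries of $a m_0$ are coordinates
  of the class of $a$.

  From below: modulo the relations and the left ideal generated by $X^+$ and $H-n$, every element is a
  series of polynomials in $X^-$ (\<open>decomp0\<close>, \<open>decomp1\<close>, \<open>decomp2\<close>). Only the classical limit requires a computation; it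
  is lifted to power series by successive approximation. In the classical limit the relations for
  $X^\pm X^\mp$ say that $[X^+,X^-]=H$ and that $C$ is the Casimir element $4X^-X^+ + (H+1)^2$.

  Together (\<open>verma_quotient\<close>) these show that the coordinates identify the three modules with
  $\mathbb{C}^{n+1}$, $\mathbb{C}[[h]]^{n+1}$ and $\mathbb{C}[[h,h']]^{n+1}$. All assertions are then read
  off in coordinates. In particular $\phi$, $\chi$, $\psi$ are the maps that preserve coordinates, and
  they are compatible with reduction of the parameters because $a_j$ reduces to its analogue.
\<close>

unbundle fps_syntax

section \<open>Quotients of left modules\<close>

lemma submodule_imp_abelian_subgroup:
  assumes "left_module A M" and "Module.submodule N A M"
  shows "abelian_subgroup N M"
proof -
  interpret left_module A M by fact
  interpret subgroup N "add_monoid M" using assms(2) by (simp add: Module.submodule_def)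
  show ?thesis
    by (rule abelian_subgroupI3) (unfold_locales)
qed

lemma quot_module_carrier:
  fixes M (structure)
  shows "carrier (quot_module M N) = {N +> x | x. x \<in> carrier M}"
  by (auto simp: quot_module_def A_RCOSETS_def')

lemma quot_module_zero: "\<zero>\<^bsub>quot_module M N\<^esub> = N"
  by (simp add: quot_module_def)

lemma quot_module_add:
  fixes M (structure)
  assumes "left_module A M" and "Module.submodule N A M" and "x \<in> carrier M" "y \<in> carrier M"
  shows "(N +> x) \<oplus>\<^bsub>quot_module M N\<^esub> (N +> y) = N +> (x \<oplus> y)"
proof -
  interpret abelian_subgroup N M by (rule submodule_imp_abelian_subgroup) fact+
  show ?thesis using assms(3,4) by (simp add: quot_module_def a_rcos_sum)
qed

lemma quot_module_eq_iff:
  fixes M (structure)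
  assumes "left_module A M" and "Module.submodule N A M" and "x \<in> carrier M" "y \<in> carrier M"
  shows "N +> x = N +> y \<longleftrightarrow> x \<ominus> y \<in> N"
proof -
  interpret abelian_subgroup N M by (rule submodule_imp_abelian_subgroup) fact+
  have "x \<in> N +> y \<longleftrightarrow> x \<ominus> y \<in> N"
    using a_rcos_module[of y x] assms(3,4) by (simp add: a_minus_def)
  thus ?thesis
    using a_repr_independence'[of x y] a_rcos_self[of x] assms(3,4) by auto
qed

text \<open>The union that defines the scalar multiplication runs over all representatives of a coset; since
  $N$ is a submodule, all its members coincide.\<close>

lemma quot_module_smult:
  fixes M (structure)
  assumes "left_module A M" and "Module.submodule N A M" and a: "a \<in> carrier A" and x: "x \<in> carrier M"
  shows "a \<odot>\<^bsub>quot_module M N\<^esub> (N +> x) = N +> (a \<odot> x)"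
proof -
  interpret left_module A M by fact
  interpret abelian_subgroup N M by (rule submodule_imp_abelian_subgroup) fact+
  have "N +> (a \<odot> x') = N +> (a \<odot> x)" if "x' \<in> N +> x" for x'
  proof -
    from that obtain k where k: "k \<in> N" "x' = k \<oplus> x" by (auto simp: a_r_coset_def')
    have kc: "k \<in> carrier M" and ak: "a \<odot> k \<in> N"
      using k a_subset Module.submodule.smult_closed[OF assms(2) a] by auto
    have "a \<odot> x' = a \<odot> k \<oplus> a \<odot> x" using k kc a x smult_r_distr by simp
    hence "a \<odot> x' \<in> N +> (a \<odot> x)" using ak by (auto simp: a_r_coset_def')
    thus ?thesis using a_repr_independence' smult_closed[OF a x] by metis
  qed
  hence "(\<Union>x'\<in>N +> x. N +> (a \<odot> x')) =
      (\<Union>x'\<in>N +> x. N +> (a \<odot> x))"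
    by (rule SUP_cong[OF refl])
  moreover have "N +> x \<noteq> {}" using a_rcos_self[OF x] by blast
  ultimately show ?thesis by (simp only: quot_module_def module.simps UN_constant if_False)
qed

lemma quot_module_left_module:
  fixes M (structure)
  assumes LM: "left_module A M" and SM: "Module.submodule N A M"
  shows "left_module A (quot_module M N)"
proof -
  interpret left_module A M by fact
  interpret abelian_subgroup N M by (rule submodule_imp_abelian_subgroup) fact+
  have zero: "\<zero>\<^bsub>quot_module M N\<^esub> = N +> \<zero>"
    by (simp add: quot_module_zero a_coset_add_zero a_subset)
  note [simp] = quot_module_add[OF LM SM] quot_module_smult[OF LM SM] smult_closed
  have "abelian_group (quot_module M N)"
  proof (rule abelian_groupI)
    fix x assume "x \<in> carrier (quot_module M N)"
    then obtain x' where x': "x' \<in> carrier M" "x = N +> x'" by (auto simp: quot_module_carrier)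
    have "(N +> (\<ominus> x')) \<oplus>\<^bsub>quot_module M N\<^esub> x = \<zero>\<^bsub>quot_module M N\<^esub>"
      using x' by (simp add: M.l_neg zero)
    thus "\<exists>y\<in>carrier (quot_module M N). y \<oplus>\<^bsub>quot_module M N\<^esub> x = \<zero>\<^bsub>quot_module M N\<^esub>"
      using x' unfolding quot_module_carrier
      by (intro bexI[of _ "N +> (\<ominus> x')"]) auto
  next
    show "\<zero>\<^bsub>quot_module M N\<^esub> \<in> carrier (quot_module M N)"
      unfolding quot_module_carrier zero by blast
  next
    fix x assume "x \<in> carrier (quot_module M N)"
    thus "\<zero>\<^bsub>quot_module M N\<^esub> \<oplus>\<^bsub>quot_module M N\<^esub> x = x"
      by (auto simp: quot_module_carrier zero)
  qed (auto simp: quot_module_carrier M.a_ac)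
  thus ?thesis
    by (intro left_module.intro left_module_axioms.intro R.ring_axioms)
      (auto simp: quot_module_carrier smult_l_distr smult_r_distr smult_assoc smult_one)
qed

lemma regular_module_left_module:
  assumes "ring A"
  shows "left_module A (regular_module A)"
proof -
  interpret ring A by fact
  have "abelian_group (regular_module A)"
  proof (rule abelian_groupI)
    fix x assume "x \<in> carrier (regular_module A)"
    thus "\<exists>y\<in>carrier (regular_module A). y \<oplus>\<^bsub>regular_module A\<^esub> x = \<zero>\<^bsub>regular_module A\<^esub>"
      using l_neg by (auto simp: regular_module_def)
  qed (auto simp: regular_module_def a_ac)
  thus ?thesis
    by (intro left_module.intro left_module_axioms.intro assms)
      (auto simp: regular_module_def l_distr r_distr m_assoc)
qed

lemma left_module_zero_smult:
  fixes M (structure)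
  assumes "left_module A M" and x: "x \<in> carrier M"
  shows "\<zero>\<^bsub>A\<^esub> \<odot> x = \<zero>"
proof -
  interpret left_module A M by fact
  have "\<zero>\<^bsub>A\<^esub> \<odot> x \<oplus> \<zero>\<^bsub>A\<^esub> \<odot> x = \<zero>\<^bsub>A\<^esub> \<odot> x"
    using smult_l_distr[of "\<zero>\<^bsub>A\<^esub>" "\<zero>\<^bsub>A\<^esub>" x] x by simp
  thus ?thesis using smult_closed[of "\<zero>\<^bsub>A\<^esub>" x] x by simp
qed

lemma left_submoduleI:
  fixes M (structure)
  assumes LM: "left_module A M" and N: "N \<subseteq> carrier M" "\<zero> \<in> N"
    and add: "\<And>x y. x \<in> N \<Longrightarrow> y \<in> N \<Longrightarrow> x \<oplus> y \<in> N"
    and smult: "\<And>a x. a \<in> carrier A \<Longrightarrow> x \<in> N \<Longrightarrow> a \<odot> x \<in> N"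
  shows "Module.submodule N A M"
proof -
  interpret left_module A M by fact
  have "\<ominus> x \<in> N" if x: "x \<in> N" for x
  proof -
    have xc: "x \<in> carrier M" using x N by auto
    have "(\<ominus>\<^bsub>A\<^esub> \<one>\<^bsub>A\<^esub>) \<odot> x \<oplus> x = (\<ominus>\<^bsub>A\<^esub> \<one>\<^bsub>A\<^esub> \<oplus>\<^bsub>A\<^esub> \<one>\<^bsub>A\<^esub>) \<odot> x"
      using xc by (subst smult_l_distr) (auto simp: smult_one)
    hence "(\<ominus>\<^bsub>A\<^esub> \<one>\<^bsub>A\<^esub>) \<odot> x \<oplus> x = \<zero>"
      using left_module_zero_smult[OF LM xc] by (simp add: R.l_neg)
    hence "\<ominus> x = (\<ominus>\<^bsub>A\<^esub> \<one>\<^bsub>A\<^esub>) \<odot> x"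
      using xc by (intro M.minus_equality) (auto intro: smult_closed)
    thus ?thesis using x by (auto intro: smult)
  qed
  thus ?thesis
    using assms M.add.group_axioms
    by (auto intro!: Module.submodule.intro M.add.subgroupI simp: submodule_axioms_def a_inv_def)
qed

section \<open>Rings given by type classes\<close>

lemma ring_type_ring: "ring (type_ring :: 'a::ring_1 ring)"
proof -
  have "\<exists>y. y + x = 0" for x :: 'a by (rule exI[of _ "- x"]) simp
  thus ?thesis by unfold_locales (auto simp: algebra_simps Units_def add_eq_0_iff)
qed

lemma cring_type_ring: "cring (type_ring :: 'a::comm_ring_1 ring)"
  using ring_type_ring by (auto intro!: cring.intro comm_monoid.intro simp: ring_def comm_monoid_axioms_def mult.commute)

lemma field_type_ring: "field (type_ring :: 'a::field ring)"
proof (rule cring.cring_fieldI2[OF cring_type_ring])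
  fix a :: 'a assume "a \<noteq> \<zero>\<^bsub>type_ring\<^esub>"
  thus "\<exists>b\<in>carrier type_ring. a \<otimes>\<^bsub>type_ring\<^esub> b = \<one>\<^bsub>type_ring\<^esub>"
    by (auto intro!: exI[of _ "inverse a"])
qed auto

lemma type_ring_idealI:
  fixes I :: "'a::ring_1 set"
  assumes "0 \<in> I" "\<And>a b. a \<in> I \<Longrightarrow> b \<in> I \<Longrightarrow> a + b \<in> I"
    "\<And>a b. a \<in> I \<Longrightarrow> b * a \<in> I" "\<And>a b. a \<in> I \<Longrightarrow> a * b \<in> I"
  shows "ideal I type_ring"
proof (rule idealI)
  interpret R: ring "type_ring :: 'a ring" by (rule ring_type_ring)
  show "ring (type_ring :: 'a ring)" by (rule ring_type_ring)
  show "subgroup I (add_monoid type_ring)"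
  proof (rule R.add.subgroupI)
    fix x assume x: "x \<in> I"
    have "\<ominus>\<^bsub>type_ring\<^esub> x = - x" by (rule R.minus_equality) auto
    thus "\<ominus>\<^bsub>type_ring\<^esub> x \<in> I"
      using assms(3)[OF x, of "- 1"] by simp
  qed (use assms in auto)
qed (use assms in auto)

lemma type_ring_idealD:
  fixes I :: "'a::ring_1 set"
  assumes "ideal I type_ring"
  shows "0 \<in> I" "a \<in> I \<Longrightarrow> b \<in> I \<Longrightarrow> a + b \<in> I" "a \<in> I \<Longrightarrow> b * a \<in> I" "a \<in> I \<Longrightarrow> a * b \<in> I"
    "a \<in> I \<Longrightarrow> - a \<in> I" "a \<in> I \<Longrightarrow> b \<in> I \<Longrightarrow> a - b \<in> I"
proof -
  interpret ideal I type_ring by fact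
  show 1: "0 \<in> I" "a \<in> I \<Longrightarrow> b \<in> I \<Longrightarrow> a + b \<in> I" "a \<in> I \<Longrightarrow> b * a \<in> I" "a \<in> I \<Longrightarrow> a * b \<in> I" for a b
    using additive_subgroup.zero_closed[OF ideal.axioms(1)[OF assms]]
      additive_subgroup.a_closed[OF ideal.axioms(1)[OF assms]] I_l_closed I_r_closed by auto
  show 2: "a \<in> I \<Longrightarrow> - a \<in> I" for a using 1(3)[of a "- 1"] by simp
  show "a \<in> I \<Longrightarrow> b \<in> I \<Longrightarrow> a - b \<in> I" using 1(2)[of a "- b"] 2[of b] by simp
qed

section \<open>Modules with finitely many coordinates\<close>

lemma finsum_restrict_scalars: "finsum (restrict_scalars \<eta> M) f S = finsum M f S"
  by (simp add: finsum_def finprod_def restrict_scalars_def)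

text \<open>A module over \<open>'r\<close> that is free of rank $n+1$, given through coordinate functions. The conditions only
  concern \<open>co x k\<close> for $k \<le> n$, so \<open>co\<close> may list the first entries of an infinite sequence.\<close>

locale coord_module =
  fixes n :: nat and V :: "('r::comm_ring_1, 'v) module" (structure) and co :: "'v \<Rightarrow> nat \<Rightarrow> 'r"
  assumes abgroup: "abelian_group V"
    and smult_carrier: "x \<in> carrier V \<Longrightarrow> c \<odot> x \<in> carrier V"
    and co_add: "\<lbrakk>x \<in> carrier V; y \<in> carrier V; k \<le> n\<rbrakk> \<Longrightarrow> co (x \<oplus> y) k = co x k + co y k"
    and co_smult: "\<lbrakk>x \<in> carrier V; k \<le> n\<rbrakk> \<Longrightarrow> co (c \<odot> x) k = c * co x k"
    and co_inj: "\<lbrakk>x \<in> carrier V; y \<in> carrier V; \<And>k. k \<le> n \<Longrightarrow> co x k = co y k\<rbrakk> \<Longrightarrow> x = y"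
    and co_surj: "\<exists>x\<in>carrier V. \<forall>k\<le>n. co x k = v k"
begin

sublocale abelian_group V by (rule abgroup)

definition mk :: "(nat \<Rightarrow> 'r) \<Rightarrow> 'v" where
  "mk c = (SOME x. x \<in> carrier V \<and> (\<forall>k\<le>n. co x k = c k))"

lemma mk: "mk c \<in> carrier V" "k \<le> n \<Longrightarrow> co (mk c) k = c k"
  using someI_ex[of "\<lambda>x. x \<in> carrier V \<and> (\<forall>k\<le>n. co x k = c k)"] co_surj[of c]
  by (auto simp: mk_def)

lemma co_zero: "k \<le> n \<Longrightarrow> co \<zero> k = 0"
  using co_add[of "\<zero>" "\<zero>" k] by simp

lemma co_finsum:
  "finite S \<Longrightarrow> (\<And>i. i \<in> S \<Longrightarrow> f i \<in> carrier V) \<Longrightarrow> k \<le> n \<Longrightarrow>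
     co (\<Oplus>i\<in>S. f i) k = (\<Sum>i\<in>S. co (f i) k)"
proof (induction S rule: finite_induct)
  case (insert a S)
  have "(\<Oplus>i\<in>S. f i) \<in> carrier V" using insert by (intro finsum_closed) auto
  thus ?case using insert by (subst finsum_insert) (auto simp: co_add)
qed (simp add: co_zero)

lemma module: "Module.module type_ring V"
  by (rule Module.moduleI[OF cring_type_ring abgroup])
     (auto intro!: co_inj smult_carrier simp: co_add co_smult algebra_simps smult_carrier)

end

text \<open>All identifications of modules below are of this form: they preserve coordinates.\<close>

lemma coord_module_isoI:
  assumes "coord_module n V co" and "coord_module n W co'"
    and "\<And>x. x \<in> carrier V \<Longrightarrow> \<phi> x \<in> carrier W"
    and "\<And>x k. x \<in> carrier V \<Longrightarrow> k \<le> n \<Longrightarrow> co' (\<phi> x) k = co x k"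
  shows "\<phi> \<in> module_iso V W"
proof -
  interpret V: coord_module n V co by fact
  interpret W: coord_module n W co' by fact
  note W.smult_carrier[simp] V.smult_carrier[simp]
  have "bij_betw \<phi> (carrier V) (carrier W)"
  proof (rule bij_betw_byWitness[where f' = "\<lambda>y. V.mk (co' y)"])
    show "\<forall>x\<in>carrier V. V.mk (co' (\<phi> x)) = x"
      using assms(3,4) by (auto intro!: V.co_inj simp: V.mk)
    show "\<forall>y\<in>carrier W. \<phi> (V.mk (co' y)) = y"
      using assms(3,4) by (auto intro!: W.co_inj simp: V.mk)
  qed (use assms(3) V.mk in auto)
  thus ?thesis
    unfolding module_iso_def LinearCombinations.module_hom_def
    using assms(3,4)
    by (auto intro!: W.co_inj simp: V.co_add V.co_smult W.co_add W.co_smult)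
qed

subsection \<open>Power series over a module with coordinates\<close>

definition series_co :: "('v \<Rightarrow> nat \<Rightarrow> 'r) \<Rightarrow> (nat \<Rightarrow> 'v) \<Rightarrow> nat \<Rightarrow> 'r fps" where
  "series_co co f k = Abs_fps (\<lambda>i. co (f i) k)"

lemma series_co_nth [simp]: "series_co co f k $ i = co (f i) k"
  by (simp add: series_co_def)

lemma coord_module_series:
  fixes V :: "('r::comm_ring_1, 'v) module"
  assumes "coord_module n V co"
  shows "coord_module n (series_module V) (series_co co)"
proof -
  interpret coord_module n V co by fact
  have sm: "(\<Oplus>\<^bsub>V\<^esub> k\<in>{..i}. c $ k \<odot>\<^bsub>V\<^esub> f (i - k)) \<in> carrier V"
    if "\<And>i. f i \<in> carrier V" for c f i
    using that by (intro finsum_closed) (auto simp: smult_carrier)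
  show ?thesis
  proof (rule coord_module.intro)
    show "abelian_group (series_module V)"
    proof (rule abelian_groupI)
      fix x assume "x \<in> carrier (series_module V)"
      thus "\<exists>y\<in>carrier (series_module V). y \<oplus>\<^bsub>series_module V\<^esub> x = \<zero>\<^bsub>series_module V\<^esub>"
        by (intro bexI[of _ "\<lambda>i. \<ominus>\<^bsub>V\<^esub> x i"]) (auto simp: series_module_def l_neg)
    next
      fix x y z assume "x \<in> carrier (series_module V)" "y \<in> carrier (series_module V)" "z \<in> carrier (series_module V)"
      thus "x \<oplus>\<^bsub>series_module V\<^esub> y \<oplus>\<^bsub>series_module V\<^esub> z =
            x \<oplus>\<^bsub>series_module V\<^esub> (y \<oplus>\<^bsub>series_module V\<^esub> z)"
        by (simp add: series_module_def a_assoc)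
    next
      fix x y assume "x \<in> carrier (series_module V)" "y \<in> carrier (series_module V)"
      thus "x \<oplus>\<^bsub>series_module V\<^esub> y = y \<oplus>\<^bsub>series_module V\<^esub> x"
        using a_comm by (simp add: series_module_def fun_eq_iff)
    qed (auto simp: series_module_def)
    fix c :: "'r fps" and x assume "x \<in> carrier (series_module V)"
    hence x: "\<And>i. x i \<in> carrier V" by (auto simp: series_module_def)
    show "c \<odot>\<^bsub>series_module V\<^esub> x \<in> carrier (series_module V)"
      using sm[OF x] by (auto simp: series_module_def)
    show "series_co co (c \<odot>\<^bsub>series_module V\<^esub> x) k = c * series_co co x k" if "k \<le> n" for k
      using that x
      by (auto simp: series_module_def fps_eq_iff fps_mult_nth co_finsum co_smult smult_carrier
          atLeast0AtMost)
  next
    fix x y k assume "x \<in> carrier (series_module V)" "y \<in> carrier (series_module V)" "k \<le> n"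
    thus "series_co co (x \<oplus>\<^bsub>series_module V\<^esub> y) k = series_co co x k + series_co co y k"
      by (auto simp: series_module_def fps_eq_iff co_add)
  next
    fix x y assume *: "x \<in> carrier (series_module V)" "y \<in> carrier (series_module V)"
      "\<And>k. k \<le> n \<Longrightarrow> series_co co x k = series_co co y k"
    show "x = y"
    proof
      fix i
      have "co (x i) k = co (y i) k" if "k \<le> n" for k
        using arg_cong[OF *(3)[OF that], of "\<lambda>f. f $ i"] by simp
      thus "x i = y i" using * by (intro co_inj) (auto simp: series_module_def)
    qed
  next
    fix c :: "nat \<Rightarrow> 'r fps"
    show "\<exists>x\<in>carrier (series_module V). \<forall>k\<le>n. series_co co x k = c k"
      by (rule bexI[of _ "\<lambda>i. mk (\<lambda>k. c k $ i)"])
         (auto simp: series_module_def mk fps_eq_iff)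
  qed
qed

subsection \<open>Bases\<close>

context coord_module
begin

definition unit_vec :: "nat \<Rightarrow> 'v" where
  "unit_vec j = mk (\<lambda>k. if k = j then 1 else 0)"

lemma unit_vec: "unit_vec j \<in> carrier V" "k \<le> n \<Longrightarrow> co (unit_vec j) k = (if k = j then 1 else 0)"
  by (auto simp: unit_vec_def mk)

lemma co_comb:
  assumes "k \<le> n" "\<And>j. j \<le> n \<Longrightarrow> m j \<in> carrier V"
    and "\<And>j k. j \<le> n \<Longrightarrow> k \<le> n \<Longrightarrow> co (m j) k = (if k = j then 1 else 0)"
  shows "co (\<Oplus> j\<in>{..n}. c j \<odot> m j) k = c k"
proof -
  have "co (\<Oplus> j\<in>{..n}. c j \<odot> m j) k = (\<Sum>j\<le>n. co (c j \<odot> m j) k)"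
    using assms by (intro co_finsum) (auto simp: smult_carrier)
  also have "\<dots> = (\<Sum>j\<le>n. if j = k then c k else 0)"
    using assms by (intro sum.cong) (auto simp: co_smult)
  finally have "co (\<Oplus> j\<in>{..n}. c j \<odot> m j) k = (\<Sum>j\<le>n. if j = k then c k else 0)" .
  thus ?thesis using assms(1) by simp
qed

end

text \<open>The unit vectors form a basis.\<close>

lemma coord_module_dim:
  fixes V :: "('r::field, 'v) module"
  assumes "coord_module n V co"
  shows "vectorspace type_ring V" "vectorspace.fin_dim type_ring V"
    "vectorspace.dim type_ring V = n + 1"
proof -
  interpret coord_module n V co by fact
  show VS: "vectorspace type_ring V"
    using module field_type_ring by (auto intro: vectorspace.intro)
  interpret vectorspace type_ring V by (rule VS)
  let ?B = "unit_vec ` {..n}"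
  have inj: "inj_on unit_vec {..n}"
  proof (rule inj_onI)
    fix i j assume "i \<in> {..n}" "j \<in> {..n}" "unit_vec i = unit_vec j"
    thus "i = j" using unit_vec(2)[of i i] unit_vec(2)[of i j] by (auto split: if_splits)
  qed
  have lc: "lincomb a ?B = mk (\<lambda>k. a (unit_vec k))" for a
  proof (rule co_inj)
    have "lincomb a ?B = (\<Oplus>\<^bsub>V\<^esub> j\<in>{..n}. a (unit_vec j) \<odot>\<^bsub>V\<^esub> unit_vec j)"
      unfolding lincomb_def using inj
      by (intro abelian_monoid.finsum_reindex[OF abelian_group.axioms(1)[OF abgroup]])
         (auto simp: smult_carrier unit_vec)
    thus "co (lincomb a ?B) k = co (mk (\<lambda>k. a (unit_vec k))) k" if "k \<le> n" for k
      using that co_comb[of k unit_vec "\<lambda>j. a (unit_vec j)"] by (simp add: unit_vec mk)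
  qed (use unit_vec in \<open>auto simp: mk intro!: lincomb_closed\<close>)
  have "v \<in> span ?B" if v: "v \<in> carrier V" for v
  proof -
    define a where "a u = co v (inv_into {..n} unit_vec u)" for u
    have "lincomb a ?B = v"
      unfolding lc using v inj by (auto intro!: co_inj simp: mk a_def)
    thus ?thesis by (auto intro!: exI[of _ a] exI[of _ ?B] simp: span_def)
  qed
  hence gen: "gen_set ?B"
    using span_is_subset2[of ?B] unit_vec(1) by blast
  have "lin_indpt ?B"
  proof (rule finite_lin_indpt2)
    fix a assume "a \<in> ?B \<rightarrow> carrier type_ring" and a0: "lincomb a ?B = \<zero>\<^bsub>V\<^esub>"
    show "\<forall>v\<in>?B. a v = \<zero>\<^bsub>type_ring\<^esub>"
    proof clarsimp
      fix j assume "j \<le> n"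
      thus "a (unit_vec j) = 0" using a0 mk(2)[of j "\<lambda>k. a (unit_vec k)"] by (simp add: lc co_zero)
    qed
  qed (auto simp: unit_vec)
  hence "basis ?B" using gen unit_vec by (auto simp: basis_def)
  thus "dim = n + 1" using dim_basis[of ?B] inj by (simp add: card_image)
  show "fin_dim" using gen unit_vec unfolding fin_dim_def by (intro exI[of _ ?B]) auto
qed

section \<open>Finite quotients of Verma modules\<close>

text \<open>The finite quotient of a Verma module of $A = R/I$ is computed inside $R$. The elements \<open>X\<close>, \<open>H\<close>,
  \<open>Y\<close> of $R$ lift $X^+$, $H$, $X^-$; the number \<open>co a k\<close> is the coordinate of $a m_0$ at $m_k$, and
  \<open>T\<close> consists of the lifts of the vectors $\sum_j p_j m_j$. The elements of \<open>I\<close>, \<open>X\<close> and $H-n$ kill $m_0$; \<open>decomp\<close>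
  says that conversely, up to these, every element of $R$ is in \<open>T\<close>.\<close>

locale verma_quotient =
  fixes I :: "'a::ring_1 set" and X H Y :: 'a and n :: nat and T :: "'a set"
    and co :: "'a \<Rightarrow> nat \<Rightarrow> 'r::comm_ring_1" and sc :: "'r \<Rightarrow> 'a"
  assumes ideal: "ideal I type_ring"
    and co_add: "k \<le> n \<Longrightarrow> co (a + b) k = co a k + co b k"
    and co_mult: "(\<And>k. k \<le> n \<Longrightarrow> co a k = 0) \<Longrightarrow> k \<le> n \<Longrightarrow> co (b * a) k = 0"
    and co_ideal: "a \<in> I \<Longrightarrow> k \<le> n \<Longrightarrow> co a k = 0"
    and co_X: "k \<le> n \<Longrightarrow> co X k = 0"
    and co_H: "k \<le> n \<Longrightarrow> co (H - of_nat n) k = 0"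
    and co_Y: "k \<le> n \<Longrightarrow> co (Y ^ j) k = (if j = k then 1 else 0)"
    and co_sc: "k \<le> n \<Longrightarrow> co (sc r * a) k = r * co a k"
    and sc_central: "sc r * a = a * sc r"
    and decomp: "\<exists>i\<in>I. \<exists>b c. \<exists>t\<in>T. a = i + b * X + c * (H - of_nat n) + t"
begin

text \<open>The algebra, the projection onto it, its Verma module and the projection onto that, the
  subrepresentation, the quotient, and the class of $a m_0$ there.\<close>

definition A :: "'a set ring" where "A = type_ring Quot I"
definition q :: "'a \<Rightarrow> 'a set" where "q a = I +>\<^bsub>type_ring\<^esub> a"
definition M :: "('a set, 'a set set) module" where "M = verma A (q X) (q H) n"
definition mc :: "'a set \<Rightarrow> 'a set set" where "mc = verma_class A (q X) (q H) n"
definition N :: "'a set set set" where "N = {mc (q t) | t. t \<in> T \<and> (\<forall>k\<le>n. co t k = 0)}"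
definition W :: "('a set, 'a set set set) module" where "W = quot_module M N"
definition cls :: "'a \<Rightarrow> 'a set set set" where "cls a = N +>\<^bsub>M\<^esub> mc (q a)"

lemma co_0: "k \<le> n \<Longrightarrow> co 0 k = 0"
  using co_add[of k 0 0] by simp

lemma co_minus: "k \<le> n \<Longrightarrow> co (- a) k = - co a k"
  using co_add[of k "- a" a] co_0[of k] by (simp add: eq_neg_iff_add_eq_0)

lemma co_diff: "k \<le> n \<Longrightarrow> co (a - b) k = co a k - co b k"
  using co_add[of k a "- b"] by (simp add: co_minus)

lemma ring_A: "ring A"
  unfolding A_def by (rule ideal.quotient_is_ring[OF ideal])

lemma carrier_A: "carrier A = range q"
  by (auto simp: A_def q_def FactRing_def A_RCOSETS_def')

lemma q_hom: "q \<in> ring_hom type_ring A"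
  unfolding A_def q_def using ideal.rcos_ring_hom[OF ideal] by simp

lemma q_simps: "q a \<in> carrier A" "q a \<oplus>\<^bsub>A\<^esub> q b = q (a + b)" "q a \<otimes>\<^bsub>A\<^esub> q b = q (a * b)" "\<one>\<^bsub>A\<^esub> = q 1"
  using ring_hom_closed[OF q_hom, of a] ring_hom_add[OF q_hom, of a b]
    ring_hom_mult[OF q_hom, of a b] ring_hom_one[OF q_hom]
  by auto

lemmas I_closed = type_ring_idealD[OF ideal]

lemma q_eq_iff: "q a = q b \<longleftrightarrow> a - b \<in> I"
proof -
  have mem: "x \<in> q y \<longleftrightarrow> x - y \<in> I" for x y
    by (auto simp: q_def a_r_coset_def' intro!: bexI[of _ "x - y"])
  show ?thesis
  proof
    assume "q a = q b" thus "a - b \<in> I" using mem[of a a] mem[of a b] I_closed by simp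
  next
    assume ab: "a - b \<in> I"
    show "q a = q b"
    proof (intro Set.set_eqI)
      fix x
      have "x - b = (x - a) + (a - b)" "x - a = (x - b) + - (a - b)" by simp_all
      thus "x \<in> q a \<longleftrightarrow> x \<in> q b" using ab I_closed unfolding mem by metis
    qed
  qed
qed

lemma zero_A: "\<zero>\<^bsub>A\<^esub> = q 0"
proof -
  interpret A: ring A by (rule ring_A)
  have "q 0 \<oplus>\<^bsub>A\<^esub> q 0 = q 0" by (simp add: q_simps)
  thus ?thesis using q_simps(1)[of 0] by simp
qed

lemma minus_A: "q a \<ominus>\<^bsub>A\<^esub> q b = q (a - b)"
proof -
  interpret A: ring A by (rule ring_A)
  have "\<ominus>\<^bsub>A\<^esub> q b = q (- b)"
    by (rule A.minus_equality) (auto simp: q_simps zero_A)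
  thus ?thesis by (simp add: a_minus_def q_simps)
qed

lemma of_nat_A: "[k] \<cdot>\<^bsub>A\<^esub> \<one>\<^bsub>A\<^esub> = q (of_nat k)" for k :: nat
proof -
  interpret A: ring A by (rule ring_A)
  show ?thesis
    by (induction k) (auto simp: q_simps zero_A A.add.nat_pow_Suc add.commute)
qed

lemma pow_A: "q a [^]\<^bsub>A\<^esub> j = q (a ^ j)" for j :: nat
proof -
  interpret A: ring A by (rule ring_A)
  show ?thesis by (induction j) (auto simp: q_simps power_commutes)
qed

definition J :: "'a set set" where "J = verma_ideal A (q X) (q H) n"

lemma J_eq: "J = {q (b * X + c * (H - of_nat n)) | b c. True}"
proof -
  have "J = {q b \<otimes>\<^bsub>A\<^esub> q X \<oplus>\<^bsub>A\<^esub> q c \<otimes>\<^bsub>A\<^esub> (q H \<ominus>\<^bsub>A\<^esub> [n] \<cdot>\<^bsub>A\<^esub> \<one>\<^bsub>A\<^esub>) | b c. True}"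
    unfolding J_def verma_ideal_def carrier_A by blast
  thus ?thesis by (simp add: of_nat_A minus_A q_simps(1-3))
qed

lemma regular_A: "left_module A (regular_module A)"
  by (rule regular_module_left_module[OF ring_A])

lemma J_submodule: "Module.submodule J A (regular_module A)"
proof (rule left_submoduleI[OF regular_A])
  show "J \<subseteq> carrier (regular_module A)" by (auto simp: J_eq regular_module_def q_simps)
  have "q 0 = q (0 * X + 0 * (H - of_nat n))" by simp
  thus "\<zero>\<^bsub>regular_module A\<^esub> \<in> J" unfolding J_eq regular_module_def by (simp only: ring_record_simps zero_A) blast
  fix x y assume "x \<in> J" "y \<in> J"
  then obtain b c b' c' where "x = q (b * X + c * (H - of_nat n))" "y = q (b' * X + c' * (H - of_nat n))"
    by (auto simp: J_eq)
  hence "x \<oplus>\<^bsub>regular_module A\<^esub> y = q ((b + b') * X + (c + c') * (H - of_nat n))"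
    by (simp add: regular_module_def q_simps algebra_simps)
  thus "x \<oplus>\<^bsub>regular_module A\<^esub> y \<in> J" unfolding J_eq by blast
next
  fix a x assume "a \<in> carrier A" "x \<in> J"
  then obtain b c d where "x = q (b * X + c * (H - of_nat n))" "a = q d"
    by (auto simp: J_eq carrier_A)
  hence "a \<odot>\<^bsub>regular_module A\<^esub> x = q ((d * b) * X + (d * c) * (H - of_nat n))"
    by (simp add: regular_module_def q_simps algebra_simps)
  thus "a \<odot>\<^bsub>regular_module A\<^esub> x \<in> J" unfolding J_eq by blast
qed

lemma mc_eq: "mc x = J +>\<^bsub>regular_module A\<^esub> x"
  by (simp add: mc_def verma_class_def J_def a_r_coset_def' regular_module_def)

lemma M_eq: "M = quot_module (regular_module A) J"
  by (simp add: M_def verma_def J_def)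

lemma M_left_module: "left_module A M"
  unfolding M_eq by (rule quot_module_left_module[OF regular_A J_submodule])

lemma carrier_M: "carrier M = range (\<lambda>a. mc (q a))"
  by (auto simp: M_eq quot_module_carrier mc_eq regular_module_def carrier_A)

lemma M_add: "mc (q a) \<oplus>\<^bsub>M\<^esub> mc (q b) = mc (q (a + b))"
  unfolding M_eq mc_eq
  by (subst quot_module_add[OF regular_A J_submodule]) (auto simp: regular_module_def q_simps)

lemma M_smult: "q a \<odot>\<^bsub>M\<^esub> mc (q b) = mc (q (a * b))"
  unfolding M_eq mc_eq
  by (subst quot_module_smult[OF regular_A J_submodule]) (auto simp: regular_module_def q_simps)

lemma M_zero: "\<zero>\<^bsub>M\<^esub> = mc (q 0)"
proof -
  interpret left_module A M by (rule M_left_module)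
  have "mc (q 0) \<oplus>\<^bsub>M\<^esub> mc (q 0) = mc (q 0)" by (simp add: M_add)
  moreover have "mc (q 0) \<in> carrier M" by (auto simp: carrier_M)
  ultimately show ?thesis by simp
qed

lemma M_minus: "mc (q a) \<ominus>\<^bsub>M\<^esub> mc (q b) = mc (q (a - b))"
proof -
  interpret left_module A M by (rule M_left_module)
  have "\<ominus>\<^bsub>M\<^esub> mc (q b) = mc (q (- b))"
    by (rule M.minus_equality) (auto simp: M_add M_zero carrier_M)
  thus ?thesis by (simp add: a_minus_def M_add)
qed

lemma mc_eq_iff: "mc (q a) = mc (q b) \<longleftrightarrow> (\<exists>c d. a - b - (c * X + d * (H - of_nat n)) \<in> I)"
proof -
  have "a \<ominus>\<^bsub>regular_module A\<^esub> b = a \<ominus>\<^bsub>A\<^esub> b" for a b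
    by (simp add: a_minus_def a_inv_def m_inv_def regular_module_def)
  hence "mc (q a) = mc (q b) \<longleftrightarrow> q (a - b) \<in> J"
    unfolding mc_eq
    by (subst quot_module_eq_iff[OF regular_A J_submodule]) (auto simp: minus_A regular_module_def q_simps)
  thus ?thesis by (auto simp: J_eq q_eq_iff)
qed

lemma co_J: "k \<le> n \<Longrightarrow> co (c * X + d * (H - of_nat n)) k = 0"
  by (simp add: co_add co_mult co_X co_H)

text \<open>The subrepresentation was given by lifts in \<open>T\<close> only. By \<open>decomp\<close>, any $a$ whose first $n+1$
  coordinates vanish has the same class as an element of \<open>T\<close> with this property. In this
  form stability under $A$ is evident.\<close>

lemma N_eq: "N = {mc (q a) | a. \<forall>k\<le>n. co a k = 0}"
proof (intro equalityI subsetI)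
  fix x assume "x \<in> {mc (q a) | a. \<forall>k\<le>n. co a k = 0}"
  then obtain a where a: "\<forall>k\<le>n. co a k = 0" "x = mc (q a)" by auto
  obtain i b c t where t: "i \<in> I" "t \<in> T" "a = i + b * X + c * (H - of_nat n) + t"
    using decomp by blast
  have "a = (i + (b * X + c * (H - of_nat n))) + t" using t(3) by (simp add: add.assoc)
  hence "co a k = co t k" if "k \<le> n" for k
    using t that co_J co_ideal co_add by simp
  moreover have "mc (q a) = mc (q t)"
    unfolding mc_eq_iff using t by (intro exI[of _ b] exI[of _ c]) simp
  ultimately show "x \<in> N" using a t by (auto simp: N_def)
qed (auto simp: N_def)

lemma N_mem_iff: "mc (q a) \<in> N \<longleftrightarrow> (\<forall>k\<le>n. co a k = 0)"
proof
  assume "mc (q a) \<in> N"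
  then obtain b where b: "\<forall>k\<le>n. co b k = 0" "mc (q a) = mc (q b)" by (auto simp: N_eq)
  then obtain c d where i: "a - b - (c * X + d * (H - of_nat n)) \<in> I" by (auto simp: mc_eq_iff)
  show "\<forall>k\<le>n. co a k = 0"
  proof (intro allI impI)
    fix k assume k: "k \<le> n"
    have "co (a - b - (c * X + d * (H - of_nat n))) k = co a k"
      using k b(1) co_J[OF k, of c d] by (simp only: co_diff diff_0_right)
    thus "co a k = 0" using co_ideal[OF i k] by simp
  qed
qed (auto simp: N_eq)

lemma N_submodule: "Module.submodule N A M"
proof (rule left_submoduleI[OF M_left_module])
  show "N \<subseteq> carrier M" by (auto simp: N_def carrier_M)
  show "\<zero>\<^bsub>M\<^esub> \<in> N" by (simp add: M_zero N_mem_iff co_0)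
  fix x y assume "x \<in> N" "y \<in> N"
  then obtain a b where "x = mc (q a)" "y = mc (q b)" "\<forall>k\<le>n. co a k = 0" "\<forall>k\<le>n. co b k = 0"
    by (auto simp: N_eq)
  thus "x \<oplus>\<^bsub>M\<^esub> y \<in> N" by (simp add: M_add N_mem_iff co_add)
next
  fix a x assume "a \<in> carrier A" "x \<in> N"
  then obtain b c where "a = q b" "x = mc (q c)" "\<forall>k\<le>n. co c k = 0" by (auto simp: N_eq carrier_A)
  thus "a \<odot>\<^bsub>M\<^esub> x \<in> N" by (simp add: M_smult N_mem_iff co_mult)
qed

lemma W_left_module: "left_module A W"
  unfolding W_def by (rule quot_module_left_module[OF M_left_module N_submodule])

lemma carrier_W: "carrier W = range cls"
  by (auto simp: W_def quot_module_carrier cls_def carrier_M)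

lemma cls_add: "cls a \<oplus>\<^bsub>W\<^esub> cls b = cls (a + b)"
  unfolding W_def cls_def
  by (subst quot_module_add[OF M_left_module N_submodule]) (auto simp: M_add carrier_M)

lemma cls_smult: "q a \<odot>\<^bsub>W\<^esub> cls b = cls (a * b)"
  unfolding W_def cls_def
  by (subst quot_module_smult[OF M_left_module N_submodule]) (auto simp: M_smult carrier_M q_simps)

lemma cls_eq_iff: "cls a = cls b \<longleftrightarrow> (\<forall>k\<le>n. co a k = co b k)"
  unfolding cls_def
  by (subst quot_module_eq_iff[OF M_left_module N_submodule])
     (auto simp: M_minus N_mem_iff carrier_M co_diff)

lemma cls_Y: "N +>\<^bsub>M\<^esub> ((q Y [^]\<^bsub>A\<^esub> j) \<odot>\<^bsub>M\<^esub> mc \<one>\<^bsub>A\<^esub>) = cls (Y ^ j)" for j :: nat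
  by (simp add: pow_A q_simps M_smult cls_def)

text \<open>Well defined for $k \<le> n$, because the class of $a$ determines these coordinates of $a m_0$.\<close>

definition cw :: "'a set set set \<Rightarrow> nat \<Rightarrow> 'r" where
  "cw x = co (SOME a. x = cls a)"

lemma cw_cls: "k \<le> n \<Longrightarrow> cw (cls a) k = co a k"
  using someI[of "\<lambda>b. cls a = cls b" a] unfolding cw_def by (auto simp: cls_eq_iff)

lemma coord_module_W: "coord_module n (restrict_scalars (\<lambda>r. q (sc r)) W) cw" (is "coord_module n ?V cw")
proof (rule coord_module.intro)
  interpret left_module A W by (rule W_left_module)
  have add: "add ?V = add W" and car: "carrier ?V = carrier W" and zer: "zero ?V = zero W"
    by (simp_all add: restrict_scalars_def)
  show "abelian_group ?V"
  proof (rule abelian_groupI)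
    fix x assume "x \<in> carrier ?V"
    thus "\<exists>y\<in>carrier ?V. y \<oplus>\<^bsub>?V\<^esub> x = \<zero>\<^bsub>?V\<^esub>"
      unfolding add car zer by (intro bexI[of _ "\<ominus>\<^bsub>W\<^esub> x"]) (auto simp: M.l_neg)
  qed (auto simp: add car zer M.a_ac)
next
  fix r x assume "x \<in> carrier ?V"
  then obtain a where x: "x = cls a" by (auto simp: restrict_scalars_def carrier_W)
  have *: "r \<odot>\<^bsub>?V\<^esub> x = cls (sc r * a)" by (simp add: restrict_scalars_def x cls_smult)
  thus "r \<odot>\<^bsub>?V\<^esub> x \<in> carrier ?V" by (simp add: restrict_scalars_def carrier_W)
  show "cw (r \<odot>\<^bsub>?V\<^esub> x) k = r * cw x k" if "k \<le> n" for k
    using that by (simp only: *) (simp add: x cw_cls co_sc)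
next
  fix x y k assume "x \<in> carrier ?V" "y \<in> carrier ?V" "k \<le> n"
  thus "cw (x \<oplus>\<^bsub>?V\<^esub> y) k = cw x k + cw y k"
    by (auto simp: restrict_scalars_def carrier_W cls_add cw_cls co_add)
next
  fix x y assume *: "x \<in> carrier ?V" "y \<in> carrier ?V" "\<And>k. k \<le> n \<Longrightarrow> cw x k = cw y k"
  then obtain a b where "x = cls a" "y = cls b" by (auto simp: restrict_scalars_def carrier_W)
  thus "x = y" using *(3) by (simp add: cw_cls cls_eq_iff)
next
  fix v :: "nat \<Rightarrow> 'r"
  have "co (\<Sum>j\<in>S. sc (v j) * Y ^ j) k = (\<Sum>j\<in>S. if j = k then v k else 0)"
    if "finite S" "k \<le> n" for S k
    using that by (induction S rule: finite_induct) (auto simp: co_0 co_add co_sc co_Y)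
  from this[of "{..n}"] show "\<exists>x\<in>carrier ?V. \<forall>k\<le>n. cw x k = v k"
    by (intro bexI[of _ "cls (\<Sum>j\<le>n. sc (v j) * Y ^ j)"])
       (auto simp: restrict_scalars_def carrier_W cw_cls)
qed

text \<open>Linearity over the scalars holds because the scalars are central in $R$.\<close>

lemma action_linear:
  assumes "x \<in> carrier A"
  shows "(\<lambda>w. x \<odot>\<^bsub>W\<^esub> w) \<in> LinearCombinations.module_hom type_ring
    (restrict_scalars (\<lambda>r. q (sc r)) W) (restrict_scalars (\<lambda>r. q (sc r)) W)"
proof -
  obtain a where a: "x = q a" using assms by (auto simp: carrier_A)
  have "a * (sc r * b) = sc r * (a * b)" for r b
    by (metis mult.assoc sc_central)
  thus ?thesis
    unfolding LinearCombinations.module_hom_def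
    by (auto simp: restrict_scalars_def carrier_W cls_add cls_smult a distrib_left)
qed

end

section \<open>Operators on sequences\<close>

definition linear_op :: "((nat \<Rightarrow> complex) \<Rightarrow> (nat \<Rightarrow> complex)) \<Rightarrow> bool" where
  "linear_op F \<longleftrightarrow> (\<forall>c u v. F (\<lambda>j. c * u j + v j) = (\<lambda>j. c * F u j + F v j))"

text \<open>A sequence $u$ stands for $\sum_j u_j m_j$. Sequences of infinite support are allowed, since all
  operators that occur are defined on them; \<open>shift\<close> is the action of $X^-$ and
  \<open>lower a\<close> sends $m_j$ to $a_j m_{j-1}$.\<close>

typedef oper = "{F. linear_op F}" morphisms app Oper
  by (rule exI[of _ "\<lambda>u. u"]) (simp add: linear_op_def)

setup_lifting type_definition_oper

lemma app_linear: "app A (\<lambda>j. c * u j + v j) = (\<lambda>j. c * app A u j + app A v j)"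
  using app[of A] by (simp add: linear_op_def)

lemma oper_eqI: "(\<And>u j. app A u j = app B u j) \<Longrightarrow> A = B"
  by (metis app_inject ext)

instantiation oper :: ring_1
begin

lift_definition zero_oper :: oper is "\<lambda>u j. 0" by (simp add: linear_op_def)
lift_definition one_oper :: oper is "\<lambda>u. u" by (simp add: linear_op_def)
lift_definition plus_oper :: "oper \<Rightarrow> oper \<Rightarrow> oper" is "\<lambda>F G u j. F u j + G u j"
  by (simp add: linear_op_def algebra_simps)
lift_definition minus_oper :: "oper \<Rightarrow> oper \<Rightarrow> oper" is "\<lambda>F G u j. F u j - G u j"
  by (simp add: linear_op_def algebra_simps)
lift_definition uminus_oper :: "oper \<Rightarrow> oper" is "\<lambda>F u j. - F u j"
  by (simp add: linear_op_def algebra_simps)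
lift_definition times_oper :: "oper \<Rightarrow> oper \<Rightarrow> oper" is "\<lambda>F G u. F (G u)"
  by (simp add: linear_op_def)

lemmas app_simps [simp] = zero_oper.rep_eq one_oper.rep_eq plus_oper.rep_eq minus_oper.rep_eq
  uminus_oper.rep_eq times_oper.rep_eq

instance
proof
  fix A B C :: oper
  show "A * (B + C) = A * B + A * C"
    using app_linear[of A 1] by (intro oper_eqI) simp
  show "(0::oper) \<noteq> 1"
  proof
    assume "(0::oper) = 1"
    from arg_cong[OF this, of "\<lambda>A. app A (\<lambda>_. 1) 0"] show False by simp
  qed
qed (auto intro!: oper_eqI)

end

lift_definition diag :: "(nat \<Rightarrow> complex) \<Rightarrow> oper" is "\<lambda>d u j. d j * u j"
  by (simp add: linear_op_def algebra_simps)
lift_definition shift :: oper is "\<lambda>u j. if j = 0 then 0 else u (j - 1)"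
  by (simp add: linear_op_def fun_eq_iff)
lift_definition lower :: "(nat \<Rightarrow> complex) \<Rightarrow> oper" is "\<lambda>a u j. a (Suc j) * u (Suc j)"
  by (simp add: linear_op_def algebra_simps)

lemmas app_ops [simp] = diag.rep_eq shift.rep_eq lower.rep_eq

abbreviation opc :: "complex \<Rightarrow> oper" where "opc c \<equiv> diag (\<lambda>_. c)"

lemma app_sum: "app (\<Sum>i\<in>S. A i) u j = (\<Sum>i\<in>S. app (A i) u j)"
  by (induction S rule: infinite_finite_induct) auto

lemma app_smult: "app A (\<lambda>j. c * u j) = (\<lambda>j. c * app A u j)"
proof -
  have "app A (\<lambda>j. 0) = (\<lambda>j. 0)"
    using app_linear[of A 1 "\<lambda>_. 0" "\<lambda>_. 0"] by (auto simp: fun_eq_iff)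
  thus ?thesis using app_linear[of A c u "\<lambda>_. 0"] by simp
qed

lemma app_diff: "app A (\<lambda>j. u j - v j) = (\<lambda>j. app A u j - app A v j)"
  using app_linear[of A "-1" v u] by (simp add: algebra_simps)

section \<open>Homomorphisms out of free algebras\<close>

definition ring_map :: "('a::ring_1 \<Rightarrow> 'b::ring_1) \<Rightarrow> bool" where
  "ring_map f \<longleftrightarrow> (\<forall>x y. f (x + y) = f x + f y) \<and> (\<forall>x y. f (x * y) = f x * f y) \<and> f 1 = 1"

text \<open>Consequences of multiplicativity and additivity, collected for use as rewrite rules.\<close>

lemma ring_mapD:
  assumes "ring_map f"
  shows "f (x + y) = f x + f y" "f (x * y) = f x * f y" "f 1 = 1" "f 0 = 0" "f (- x) = - f x"
    "f (x - y) = f x - f y" "f (x ^ k) = f x ^ k" "f (of_nat k) = of_nat k" "f (of_int i) = of_int i"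
    "f (numeral w) = numeral w" "f (sum h S) = (\<Sum>s\<in>S. f (h s))"
proof -
  show a: "f (x + y) = f x + f y" "f (x * y) = f x * f y" "f 1 = 1" for x y
    using assms by (auto simp: ring_map_def)
  show z: "f 0 = 0" using a(1)[of 0 0] by simp
  show m: "f (- x) = - f x" for x using a(1)[of "- x" x] by (simp add: z eq_neg_iff_add_eq_0)
  show "f (x - y) = f x - f y" using a(1)[of x "- y"] by (simp add: m)
  show "f (x ^ k) = f x ^ k" by (induction k) (auto simp: a)
  show n: "f (of_nat k) = of_nat k" for k by (induction k) (auto simp: a z)
  show "f (of_int i) = of_int i" by (cases i rule: int_cases2) (auto simp: n m)
  show "f (numeral w) = numeral w" using n[of "numeral w"] by simp
  show "f (sum h S) = (\<Sum>s\<in>S. f (h s))" by (induction S rule: infinite_finite_induct) (auto simp: a z)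
qed

lemma ring_map_prod:
  fixes f :: "'a::comm_ring_1 \<Rightarrow> 'b::comm_ring_1"
  shows "ring_map f \<Longrightarrow> f (prod h S) = (\<Prod>s\<in>S. f (h s))"
  by (induction S rule: infinite_finite_induct) (auto simp: ring_mapD)

lemma ring_map_comp: "ring_map f \<Longrightarrow> ring_map g \<Longrightarrow> ring_map (\<lambda>x. g (f x))"
  by (simp add: ring_map_def)

lemma ring_map_opc: "ring_map opc"
  by (auto simp: ring_map_def intro!: oper_eqI simp: algebra_simps)

lemma opc_central: "opc c * A = A * opc c"
  by (rule oper_eqI) (simp add: app_smult)

fun word_of :: "'x fword \<Rightarrow> 'x list" where "word_of (FWord w) = w"

lemma word_of_add: "word_of (u + v) = word_of u @ word_of v"
  by (cases u; cases v) simp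

lemma word_of_0: "word_of 0 = []"
  by (simp add: zero_fword_def)

definition free_map :: "(complex \<Rightarrow> 'b::ring_1) \<Rightarrow> ('x \<Rightarrow> 'b) \<Rightarrow> 'x free_alg \<Rightarrow> 'b" where
  "free_map \<kappa> u p = (\<Sum>w\<in>Poly_Mapping.keys p. \<kappa> (Poly_Mapping.lookup p w) * prod_list (map u (word_of w)))"

lemma poly_mapping_sum_induct [case_names zero single add]:
  assumes "P 0" "\<And>k c. P (Poly_Mapping.single k c)" "\<And>p q. P p \<Longrightarrow> P q \<Longrightarrow> P (p + q)"
  shows "P (p :: 'a \<Rightarrow>\<^sub>0 'b::comm_monoid_add)"
proof -
  have "P (\<Sum>k\<in>S. Poly_Mapping.single k (Poly_Mapping.lookup p k))" if "finite S" for S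
    using that by (induction S rule: finite_induct) (auto intro: assms)
  from this[of "Poly_Mapping.keys p"]
  have "P (\<Sum>k\<in>Poly_Mapping.keys p. Poly_Mapping.single k (Poly_Mapping.lookup p k))" by simp
  also have "(\<Sum>k\<in>Poly_Mapping.keys p. Poly_Mapping.single k (Poly_Mapping.lookup p k)) = p"
  proof (rule poly_mapping_eqI)
    fix k
    have "(\<Sum>i\<in>Poly_Mapping.keys p. Poly_Mapping.lookup p i when i = k) = Poly_Mapping.lookup p k"
      by (simp add: when_def in_keys_iff)
    thus "Poly_Mapping.lookup (\<Sum>k\<in>Poly_Mapping.keys p. Poly_Mapping.single k (Poly_Mapping.lookup p k)) k
        = Poly_Mapping.lookup p k"
      by (simp add: lookup_sum lookup_single)
  qed
  finally show ?thesis .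
qed

locale free_hom =
  fixes \<kappa> :: "complex \<Rightarrow> 'b::ring_1" and u :: "'x \<Rightarrow> 'b"
  assumes \<kappa>: "ring_map \<kappa>" and \<kappa>_central: "\<kappa> c * b = b * \<kappa> c"
begin

abbreviation "F \<equiv> free_map \<kappa> u"

lemma F_sum:
  assumes "finite S" "Poly_Mapping.keys p \<subseteq> S"
  shows "F p = (\<Sum>w\<in>S. \<kappa> (Poly_Mapping.lookup p w) * prod_list (map u (word_of w)))"
  unfolding free_map_def using assms
  by (intro sum.mono_neutral_left) (auto simp: in_keys_iff ring_mapD[OF \<kappa>])

lemma F_add: "F (p + q) = F p + F q"
proof -
  let ?S = "Poly_Mapping.keys p \<union> Poly_Mapping.keys q"
  have "Poly_Mapping.keys (p + q) \<subseteq> ?S" by (rule Poly_Mapping.keys_add)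
  thus ?thesis
    by (simp add: F_sum[of ?S] ring_mapD[OF \<kappa>] Poly_Mapping.lookup_add distrib_right sum.distrib)
qed

lemma F_single: "F (Poly_Mapping.single w c) = \<kappa> c * prod_list (map u (word_of w))"
  using F_sum[of "{w}" "Poly_Mapping.single w c"] by (simp add: when_def)

lemma F_0: "F 0 = 0" by (simp add: free_map_def)

lemma F_mult_single:
  "F (Poly_Mapping.single w c * Poly_Mapping.single v d) = F (Poly_Mapping.single w c) * F (Poly_Mapping.single v d)"
proof -
  have "F (Poly_Mapping.single w c * Poly_Mapping.single v d) =
      \<kappa> c * \<kappa> d * (prod_list (map u (word_of w)) * prod_list (map u (word_of v)))"
    by (simp add: mult_single F_single word_of_add ring_mapD[OF \<kappa>])
  also have "\<dots> = \<kappa> c * (prod_list (map u (word_of w)) * \<kappa> d) * prod_list (map u (word_of v))"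
    by (metis \<kappa>_central mult.assoc)
  finally show ?thesis by (simp add: F_single mult.assoc)
qed

lemma F_ring_map: "ring_map F"
proof -
  have 1: "F (Poly_Mapping.single w c * q) = F (Poly_Mapping.single w c) * F q" for w c q
    by (induction q rule: poly_mapping_sum_induct)
      (simp_all only: F_0 mult_zero_right F_mult_single distrib_left F_add)
  have "F (p * q) = F p * F q" for p q
    by (induction p rule: poly_mapping_sum_induct) (auto simp: F_0 1 distrib_right F_add)
  moreover have "F 1 = 1"
    unfolding single_one[symmetric] by (simp only: F_single word_of_0) (simp add: ring_mapD[OF \<kappa>])
  ultimately show ?thesis by (simp add: ring_map_def F_add)
qed

lemma F_gen: "F (gen x) = u x"
  by (simp add: gen_def F_single ring_mapD[OF \<kappa>])

lemma F_scal: "F (scal c) = \<kappa> c"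
  by (simp add: scal_def F_single word_of_0)

end

lemma scal_central: "scal c * p = p * scal c"
  by (induction p rule: poly_mapping_sum_induct)
    (auto simp: scal_def mult_single distrib_left distrib_right mult.commute)

lemma ring_map_scal: "ring_map scal"
  by (simp add: ring_map_def scal_def Poly_Mapping.single_add mult_single)

lemma free_alg_induct [case_names scal gen add mult]:
  assumes "\<And>c. P (scal c)" "\<And>x. P (gen x)" "\<And>p q. P p \<Longrightarrow> P q \<Longrightarrow> P (p + q)"
    "\<And>x q. P q \<Longrightarrow> P (gen x * q)"
  shows "P p"
proof (induction p rule: poly_mapping_sum_induct)
  case (single w c)
  obtain xs where w: "w = FWord xs" by (cases w)
  have "P (Poly_Mapping.single (FWord xs) c)"
  proof (induction xs)
    case Nil
    thus ?case using assms(1)[of c] by (simp add: scal_def zero_fword_def)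
  next
    case (Cons x xs)
    thus ?case using assms(4)[OF Cons, of x] by (simp add: gen_def mult_single)
  qed
  thus ?case by (simp add: w)
qed (use assms assms(1)[of 0] in \<open>auto simp: scal_def\<close>)

lemma lin_ext_sum:
  assumes "finite S" "Poly_Mapping.keys p \<subseteq> S"
  shows "lin_ext b p = (\<Sum>k\<in>S. scal (Poly_Mapping.lookup p k) * b k)"
  unfolding lin_ext_def using assms
  by (intro sum.mono_neutral_left) (auto simp: in_keys_iff ring_mapD[OF ring_map_scal])

lemma lin_ext_add: "lin_ext b (p + q) = lin_ext b p + lin_ext b q"
proof -
  let ?S = "Poly_Mapping.keys p \<union> Poly_Mapping.keys q"
  have "Poly_Mapping.keys (p + q) \<subseteq> ?S" by (rule Poly_Mapping.keys_add)
  thus ?thesis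
    by (simp add: lin_ext_sum[of ?S] ring_mapD[OF ring_map_scal] Poly_Mapping.lookup_add distrib_right sum.distrib)
qed

lemma lin_ext_single: "lin_ext b (Poly_Mapping.single k c) = scal c * b k"
  by (subst lin_ext_sum[of "{k}"]) auto

lemma lin_ext_0: "lin_ext b 0 = 0" by (simp add: lin_ext_def)

section \<open>Continuous extension to power series\<close>

lemma fps_map_nth [simp]: "fps_map f a $ i = f (a $ i)"
  by (simp add: fps_map_def)

lemma ring_map_fps_map:
  assumes "ring_map f" shows "ring_map (fps_map f)"
  unfolding ring_map_def
  by (auto simp: fps_eq_iff fps_mult_nth ring_mapD[OF assms])

lemma ring_map_fps_const: "ring_map (fps_const :: 'a::ring_1 \<Rightarrow> 'a fps)"
  by (auto simp: ring_map_def fps_eq_iff)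

lemma ring_map_nth0: "ring_map (\<lambda>f. f $ 0 :: 'a::ring_1)"
  by (simp add: ring_map_def)

lemma fps_map_const: "f 0 = 0 \<Longrightarrow> fps_map f (fps_const a) = fps_const (f a)"
  by (simp add: fps_eq_iff)

text \<open>Setting the two variables of a series in two variables equal.\<close>

definition fps_collapse :: "'a::ring_1 fps fps \<Rightarrow> 'a fps" where
  "fps_collapse f = Abs_fps (\<lambda>m. \<Sum>i\<le>m. f $ i $ (m - i))"

lemma ring_map_collapse: "ring_map (fps_collapse :: 'a::ring_1 fps fps \<Rightarrow> 'a fps)"
proof -
  have "fps_collapse (f * g) = fps_collapse f * fps_collapse g" for f g :: "'a fps fps"
  proof (rule fps_ext)
    fix m
    define h where "h a b c d = f $ a $ c * g $ b $ d" for a b c d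
    have "(fps_collapse (f * g)) $ m =
        (\<Sum>i\<le>m. \<Sum>a\<le>i. \<Sum>c\<le>m - i. h a (i - a) c (m - i - c))"
      by (simp add: fps_collapse_def fps_mult_nth h_def fps_sum_nth atLeast0AtMost)
    also have "\<dots> = (\<Sum>(i,a,c)\<in>(SIGMA i:{..m}. SIGMA a:{..i}. {..m - i}). h a (i - a) c (m - i - c))"
      by (simp add: sum.Sigma)
    also have "\<dots> = (\<Sum>(k,a,b)\<in>(SIGMA k:{..m}. SIGMA a:{..k}. {..m - k}). h a b (k - a) (m - k - b))"
      by (rule sum.reindex_bij_witness[where i = "\<lambda>(k,a,b). (a + b, a, k - a)" and j = "\<lambda>(i,a,c). (a + c, a, i - a)"])
         (auto simp: algebra_simps)
    also have "\<dots> = (\<Sum>k\<le>m. \<Sum>a\<le>k. \<Sum>b\<le>m - k. h a b (k - a) (m - k - b))"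
      by (simp add: sum.Sigma)
    also have "\<dots> = (fps_collapse f * fps_collapse g) $ m"
      by (simp add: fps_collapse_def fps_mult_nth h_def sum_product atLeast0AtMost)
    finally show "(fps_collapse (f * g)) $ m = (fps_collapse f * fps_collapse g) $ m" .
  qed
  moreover have "fps_collapse (f + g) = fps_collapse f + fps_collapse g" for f g :: "'a fps fps"
    by (simp add: fps_eq_iff fps_collapse_def sum.distrib)
  moreover have "fps_collapse (1 :: 'a fps fps) = 1"
  proof (rule fps_ext)
    fix m
    have "(fps_collapse (1 :: 'a fps fps)) $ m = (\<Sum>i\<le>m. if i = 0 then 1 $ m else 0)"
      unfolding fps_collapse_def fps_nth_Abs_fps by (intro sum.cong) auto
    thus "(fps_collapse (1 :: 'a fps fps)) $ m = 1 $ m" by simp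
  qed
  ultimately show ?thesis by (simp add: ring_map_def)
qed

definition fps_swap :: "'a::ring_1 fps fps \<Rightarrow> 'a fps fps" where
  "fps_swap f = Abs_fps (\<lambda>i. Abs_fps (\<lambda>j. f $ j $ i))"

lemma fps_swap_nth: "fps_swap f $ i $ j = f $ j $ i"
  by (simp add: fps_swap_def)

lemma ring_map_swap: "ring_map (fps_swap :: 'a::ring_1 fps fps \<Rightarrow> 'a fps fps)"
  unfolding ring_map_def
proof (intro conjI allI)
  fix f g :: "'a fps fps"
  show "fps_swap (f * g) = fps_swap f * fps_swap g"
    by (auto simp: fps_eq_iff fps_swap_nth fps_mult_nth fps_sum_nth intro: sum.swap)
qed (auto simp: fps_eq_iff fps_swap_nth)

text \<open>The extension of \<open>r\<close> that sends $\sum_i a_i t^i$ to $\sum_i r(a_i) t^i$. It is multiplicative as a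
  composition of the coefficientwise map into series in $s,t$ with the substitution $s = t$. In two
  variables one extends first along the inner and then along the outer variable, exchanging
  them in between.\<close>

definition fps_extend :: "('a::ring_1 \<Rightarrow> 'b::ring_1 fps) \<Rightarrow> 'a fps \<Rightarrow> 'b fps" where
  "fps_extend r a = fps_collapse (fps_map r a)"

definition fps_extend2 :: "('a::ring_1 \<Rightarrow> 'b::ring_1 fps fps) \<Rightarrow> 'a fps fps \<Rightarrow> 'b fps fps" where
  "fps_extend2 r = fps_extend (\<lambda>a. fps_swap (fps_extend (\<lambda>x. fps_swap (r x)) a))"

lemma fps_extend_nth:
  "fps_extend r a $ m = (\<Sum>i\<le>m. (r (a $ i)) $ (m - i))"
  by (simp add: fps_extend_def fps_collapse_def)

lemma fps_extend2_nth:
  "fps_extend2 r a $ m $ l =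
     (\<Sum>j\<le>m. \<Sum>i\<le>l. ((r (a $ j $ i)) $ (m - j)) $ (l - i))"
  by (simp add: fps_extend2_def fps_extend_nth fps_sum_nth fps_swap_nth)

lemma ring_map_extend: "ring_map r \<Longrightarrow> ring_map (fps_extend r)"
  unfolding fps_extend_def by (intro ring_map_comp[OF ring_map_fps_map ring_map_collapse])

lemma ring_map_extend2: "ring_map r \<Longrightarrow> ring_map (fps_extend2 r)"
  unfolding fps_extend2_def
  by (intro ring_map_extend ring_map_comp[OF ring_map_extend[OF ring_map_comp[OF _ ring_map_swap]] ring_map_swap])

lemma fps_extend_map:
  assumes "\<And>x. r (f x) = fps_const (s x)"
  shows "fps_extend r (fps_map f a) = fps_map s a"
proof (rule fps_ext)
  fix m
  have "(fps_extend r (fps_map f a)) $ m = (\<Sum>i\<le>m. if i = m then s (a $ m) else 0)"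
    unfolding fps_extend_nth using assms by (intro sum.cong) auto
  thus "(fps_extend r (fps_map f a)) $ m = fps_map s a $ m" by simp
qed

lemma fps_extend2_map:
  assumes "\<And>x. r (f x) = const2 (s x)" and "s 0 = 0"
  shows "fps_extend2 r (fps_map2 f a) = fps_map2 s a"
proof -
  have "fps_swap (const2 x) = const2 x" for x :: 'b
    by (auto simp: fps_eq_iff fps_swap_nth)
  hence 1: "fps_extend (\<lambda>x. fps_swap (r x)) (fps_map f b) = fps_map (\<lambda>x. fps_const (s x)) b" for b
    by (intro fps_extend_map) (simp add: assms)
  have "fps_swap (fps_map (\<lambda>x. fps_const (s x)) b) = fps_const (fps_map s b)" for b
    using assms(2) by (auto simp: fps_eq_iff fps_swap_nth)
  thus ?thesis unfolding fps_extend2_def by (intro fps_extend_map) (simp only: 1)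
qed

lemma fps_extend_const: "ring_map r \<Longrightarrow> fps_extend r (fps_const x) = r x"
proof (rule fps_ext)
  fix m assume r: "ring_map r"
  have "(fps_extend r (fps_const x)) $ m = (\<Sum>i\<le>m. if i = 0 then (r x) $ m else 0)"
    unfolding fps_extend_nth by (intro sum.cong) (auto simp: ring_mapD[OF r])
  thus "(fps_extend r (fps_const x)) $ m = r x $ m" by simp
qed

lemma fps_extend2_const: "ring_map r \<Longrightarrow> fps_extend2 r (const2 x) = r x"
proof -
  assume r: "ring_map r"
  have s: "fps_swap (fps_swap y) = y" for y :: "'b fps fps" by (auto simp: fps_eq_iff fps_swap_nth)
  show ?thesis
    unfolding fps_extend2_def
    by (simp add: fps_extend_const ring_map_comp[OF r ring_map_swap] s
        ring_map_comp[OF ring_map_extend[OF ring_map_comp[OF r ring_map_swap]] ring_map_swap])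
qed

lemma fps_extend2_nth0: "fps_extend2 r a $ 0 = fps_extend (\<lambda>x. r x $ 0) (a $ 0)"
  by (rule fps_ext) (simp add: fps_extend2_nth fps_extend_nth)

lemma fps_extend_nth0: "fps_extend r a $ 0 = (r (a $ 0)) $ 0"
  by (simp add: fps_extend_nth)

section \<open>Closed ideals\<close>

lemma ideal_kernel: "ring_map f \<Longrightarrow> ideal {a. f a = 0} type_ring"
  by (rule type_ring_idealI) (auto simp: ring_mapD)

lemma genideal_type_ring:
  fixes S :: "'a::ring_1 set"
  shows "ideal (Idl\<^bsub>type_ring\<^esub> S) type_ring" "S \<subseteq> Idl\<^bsub>type_ring\<^esub> S"
    "ideal I type_ring \<Longrightarrow> S \<subseteq> I \<Longrightarrow> Idl\<^bsub>type_ring\<^esub> S \<subseteq> I"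
  using ring.genideal_ideal[OF ring_type_ring, of S] ring.genideal_self[OF ring_type_ring, of S]
    ring.genideal_minimal[OF ring_type_ring, of I S] by auto

lemma adic_closure_subset: "S \<subseteq> adic_closure S"
  by (auto simp: adic_closure_def)

lemma adic_closure2_subset: "S \<subseteq> adic_closure2 S"
  by (auto simp: adic_closure2_def)

lemma adic_closure2_idem: "adic_closure2 (adic_closure2 S) = adic_closure2 S"
proof
  show "adic_closure2 (adic_closure2 S) \<subseteq> adic_closure2 S"
  proof
    fix f assume f: "f \<in> adic_closure2 (adic_closure2 S)"
    show "f \<in> adic_closure2 S" unfolding adic_closure2_def
    proof (safe)
      fix N
      obtain s where s: "s \<in> adic_closure2 S" "\<forall>i j. i + j < N \<longrightarrow> f $ j $ i = s $ j $ i"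
        using f unfolding adic_closure2_def by blast
      obtain t where "t \<in> S" "\<forall>i j. i + j < N \<longrightarrow> s $ j $ i = t $ j $ i"
        using s(1) unfolding adic_closure2_def by blast
      thus "\<exists>s\<in>S. \<forall>i j. i + j < N \<longrightarrow> f $ j $ i = s $ j $ i"
        using s(2) by (intro bexI[of _ t]) auto
    qed
  qed
qed (rule adic_closure2_subset)

lemma ideal_adic_closure:
  fixes S :: "'a::ring_1 fps set"
  assumes "ideal S type_ring" shows "ideal (adic_closure S) type_ring"
proof (rule type_ring_idealI)
  note S = type_ring_idealD[OF assms]
  show "0 \<in> adic_closure S" using S(1) adic_closure_subset by auto
  fix a b assume a: "a \<in> adic_closure S"
  have eq: "(u * a) $ i = (u * s) $ i" "(a * u) $ i = (s * u) $ i"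
    if "\<forall>i<N. a $ i = s $ i" "i < N" for u s i N
    using that by (auto simp: fps_mult_nth intro!: sum.cong)
  have "\<exists>s\<in>S. \<forall>i<N. a $ i = s $ i" for N
    using a by (simp add: adic_closure_def)
  hence "(\<exists>s\<in>S. \<forall>i<N. (b * a) $ i = s $ i) \<and> (\<exists>s\<in>S. \<forall>i<N. (a * b) $ i = s $ i)" for N
    using eq[of N _ _ b] S(3)[of _ b] S(4)[of _ b] by meson
  thus "b * a \<in> adic_closure S" "a * b \<in> adic_closure S"
    by (simp_all add: adic_closure_def)
  assume b: "b \<in> adic_closure S"
  show "a + b \<in> adic_closure S"
    unfolding adic_closure_def
  proof safe
    fix N
    obtain s t where "s \<in> S" "t \<in> S" "\<forall>i<N. a $ i = s $ i" "\<forall>i<N. b $ i = t $ i"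
      using a b unfolding adic_closure_def by blast
    thus "\<exists>s\<in>S. \<forall>i<N. (a + b) $ i = s $ i"
      using S(2) by (intro bexI[of _ "s + t"]) auto
  qed
qed

lemma ideal_adic_closure2:
  fixes S :: "'a::ring_1 fps fps set"
  assumes "ideal S type_ring" shows "ideal (adic_closure2 S) type_ring"
proof (rule type_ring_idealI)
  note S = type_ring_idealD[OF assms]
  show "0 \<in> adic_closure2 S" using S(1) adic_closure2_subset by auto
  fix a b assume a: "a \<in> adic_closure2 S"
  have eq: "(u * a) $ j $ i = (u * s) $ j $ i"
     "(a * u) $ j $ i = (s * u) $ j $ i"
    if "\<forall>i j. i + j < N \<longrightarrow> a $ j $ i = s $ j $ i" "i + j < N" for u s i j N
    using that by (auto simp: fps_mult_nth fps_sum_nth intro!: sum.cong)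
  have "\<exists>s\<in>S. \<forall>i j. i + j < N \<longrightarrow> a $ j $ i = s $ j $ i" for N
    using a by (simp add: adic_closure2_def)
  hence "(\<exists>s\<in>S. \<forall>i j. i + j < N \<longrightarrow> (b * a) $ j $ i = s $ j $ i) \<and>
      (\<exists>s\<in>S. \<forall>i j. i + j < N \<longrightarrow> (a * b) $ j $ i = s $ j $ i)" for N
    using eq[of N _ _ _ b] S(3)[of _ b] S(4)[of _ b] by meson
  thus "b * a \<in> adic_closure2 S" "a * b \<in> adic_closure2 S"
    by (simp_all add: adic_closure2_def)
  assume b: "b \<in> adic_closure2 S"
  show "a + b \<in> adic_closure2 S"
    unfolding adic_closure2_def
  proof safe
    fix N
    obtain s t where "s \<in> S" "t \<in> S"
      "\<forall>i j. i + j < N \<longrightarrow> a $ j $ i = s $ j $ i"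
      "\<forall>i j. i + j < N \<longrightarrow> b $ j $ i = t $ j $ i"
      using a b unfolding adic_closure2_def by blast
    thus "\<exists>s\<in>S. \<forall>i j. i + j < N \<longrightarrow> (a + b) $ j $ i = s $ j $ i"
      using S(2) by (intro bexI[of _ "s + t"]) auto
  qed
qed

text \<open>Each coefficient of the extension depends on finitely many coefficients of the argument, so
  the kernel is closed.\<close>

lemma fps_extend_closure:
  assumes "\<And>s. s \<in> S \<Longrightarrow> fps_extend r s = 0" "a \<in> adic_closure S"
  shows "fps_extend r a = 0"
proof (rule fps_ext)
  fix m
  obtain s where "s \<in> S" "\<forall>i<Suc m. a $ i = s $ i"
    using assms(2) unfolding adic_closure_def by blast
  hence "fps_extend r a $ m = fps_extend r s $ m"
    unfolding fps_extend_nth by (intro sum.cong) auto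
  thus "fps_extend r a $ m = 0 $ m" using assms(1)[OF \<open>s \<in> S\<close>] by simp
qed

lemma fps_extend2_closure:
  assumes "\<And>s. s \<in> S \<Longrightarrow> fps_extend2 r s = 0" "a \<in> adic_closure2 S"
  shows "fps_extend2 r a = 0"
proof (intro fps_ext)
  fix m l
  obtain s where "s \<in> S" "\<forall>i j. i + j < Suc (m + l) \<longrightarrow> a $ j $ i = s $ j $ i"
    using assms(2) unfolding adic_closure2_def by blast
  hence "fps_extend2 r a $ m $ l = fps_extend2 r s $ m $ l"
    unfolding fps_extend2_nth by (intro sum.cong) auto
  thus "fps_extend2 r a $ m $ l = 0 $ m $ l" using assms(1)[OF \<open>s \<in> S\<close>] by simp
qed

section \<open>Successive approximation\<close>

text \<open>If the constant terms of an ideal together with $T$ exhaust the coefficient ring, then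
  repeatedly subtracting an approximation and dividing by the variable decomposes every series.\<close>

lemma successive_approximation:
  fixes I :: "'a::ring_1 fps set"
  assumes "\<And>a. \<exists>r\<in>I. \<exists>t\<in>T. a = r $ 0 + t"
  shows "\<exists>r t. (\<forall>i. r i \<in> I) \<and> (\<forall>i. t $ i \<in> T) \<and> a = fps_collapse (Abs_fps r) + t"
proof -
  obtain R S where RS: "\<And>a. R a \<in> I" "\<And>a. S a \<in> T" "\<And>a. a = R a $ 0 + S a"
    using assms by metis
  define e where "e = rec_nat a (\<lambda>_ e. fps_shift 1 (e - R (e $ 0)))"
  define r where "r i = R (e i $ 0)" for i
  define t where "t = Abs_fps (\<lambda>i. S (e i $ 0))"
  have e_Suc: "e (Suc i) = fps_shift 1 (e i - r i)" for i by (simp add: e_def r_def)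
  have "e m $ l = a $ (m + l) - (\<Sum>i<m. r i $ (m + l - i))" for m l
  proof (induction m arbitrary: l)
    case 0 show ?case by (simp add: e_def)
  next
    case (Suc m)
    show ?case using Suc[of "Suc l"] by (simp add: e_Suc)
  qed
  from this[of _ 0] have "a $ m = (\<Sum>i<m. r i $ (m - i)) + e m $ 0" for m
    by simp
  moreover have "e m $ 0 = r m $ 0 + t $ m" for m
    using RS(3)[of "e m $ 0"] by (simp add: r_def t_def)
  ultimately have "a = fps_collapse (Abs_fps r) + t"
    by (simp add: fps_eq_iff fps_collapse_def lessThan_Suc_atMost[symmetric] add.assoc)
  thus ?thesis using RS by (intro exI[of _ r] exI[of _ t]) (auto simp: r_def t_def)
qed

section \<open>Quantum brackets\<close>

lemma exact_div_eqI: "a = q * b \<Longrightarrow> b \<noteq> 0 \<Longrightarrow> exact_div a b = q"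
  unfolding exact_div_def by (rule the_equality) auto

lemma ring_map_const2: "ring_map (const2 :: 'a::ring_1 \<Rightarrow> _)"
  by (rule ring_map_comp[OF ring_map_fps_const ring_map_fps_const])

lemma fps2_unit:
  fixes f :: "'a::ring_1 fps fps"
  assumes "f $ 0 $ 0 * c = 1"
  shows "\<exists>g. f * g = 1"
proof -
  have "f $ 0 * fps_right_inverse (f $ 0) c = 1"
    by (rule fps_right_inverse[OF assms])
  thus ?thesis using fps_right_inverse[of f] by blast
qed

subsection \<open>Sums of series of increasing order\<close>

definition ord2 :: "nat \<Rightarrow> 'a::ring_1 fps fps \<Rightarrow> bool" where
  "ord2 k f \<longleftrightarrow> (\<forall>i j. i + j < k \<longrightarrow> f $ j $ i = 0)"

lemma fps2_mult_nth: "(f * g) $ j $ i =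
    (\<Sum>b\<le>j. \<Sum>a\<le>i. f $ b $ a * (g $ (j - b)) $ (i - a))"
  by (simp add: fps_mult_nth fps_sum_nth atLeast0AtMost)

lemma ord2_mult: "ord2 k f \<Longrightarrow> ord2 l g \<Longrightarrow> ord2 (k + l) (f * g)"
  unfolding ord2_def
proof (intro allI impI)
  fix i j assume f: "\<forall>i j. i + j < k \<longrightarrow> f $ j $ i = 0"
    and g: "\<forall>i j. i + j < l \<longrightarrow> g $ j $ i = 0" and ij: "i + j < k + l"
  have "f $ b $ a * (g $ (j - b)) $ (i - a) = 0" if "b \<le> j" "a \<le> i" for a b
  proof (cases "a + b < k")
    case False
    hence "i - a + (j - b) < l" using that ij by simp
    thus ?thesis using g by simp
  qed (use f in simp)
  thus "(f * g) $ j $ i = 0" by (simp add: fps2_mult_nth)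
qed

lemma ord2_0: "ord2 0 f" by (simp add: ord2_def)

lemma ord2_power: "ord2 1 f \<Longrightarrow> ord2 k (f ^ k)"
  by (induction k) (use ord2_mult[of 1 f] in \<open>auto simp: ord2_0\<close>)

lemma ord2_mult_right: "ord2 k f \<Longrightarrow> ord2 k (g * f)"
  using ord2_mult[OF ord2_0, of k f g] by simp

text \<open>The sum $\sum_k s_k$, for $s_k$ of order at least $k$ in the two variables together.\<close>

definition ssum :: "(nat \<Rightarrow> 'a::ring_1 fps fps) \<Rightarrow> 'a fps fps" where
  "ssum s = Abs_fps (\<lambda>j. Abs_fps (\<lambda>i. \<Sum>k\<le>i + j. s k $ j $ i))"

lemma ssum_nth:
  assumes "\<And>k. ord2 k (s k)" "i + j \<le> m"
  shows "ssum s $ j $ i = (\<Sum>k\<le>m. s k) $ j $ i"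
proof -
  have "(\<Sum>k\<le>i + j. s k $ j $ i) = (\<Sum>k\<le>m. s k $ j $ i)"
    using assms by (intro sum.mono_neutral_left) (auto simp: ord2_def)
  thus ?thesis by (simp add: ssum_def fps_sum_nth)
qed

lemma ssum_mult_left_nth:
  assumes "\<And>k. ord2 k (s k)" "i + j \<le> m"
  shows "(c * ssum s) $ j $ i = (c * (\<Sum>k\<le>m. s k)) $ j $ i"
  unfolding fps2_mult_nth using assms(2) by (intro sum.cong refl) (simp add: ssum_nth[OF assms(1), of _ _ m])

lemma ssum_mult:
  fixes s t :: "nat \<Rightarrow> 'a::comm_ring_1 fps fps"
  assumes s: "\<And>k. ord2 k (s k)" and t: "\<And>k. ord2 k (t k)"
  shows "ssum s * ssum t = ssum (\<lambda>k. \<Sum>a\<le>k. s a * t (k - a))"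
proof (intro fps_ext)
  fix j i :: nat
  define m where "m = i + j"
  let ?c = "\<lambda>f :: 'a fps fps. f $ j $ i"
  have ord: "?c (s a * t b) = 0" if "\<not> a + b \<le> m" for a b
    using ord2_mult[OF s t, of a b] that by (simp add: ord2_def m_def)
  have "?c (ssum s * ssum t) = ?c (ssum s * (\<Sum>b\<le>m. t b))"
    by (rule ssum_mult_left_nth[OF t]) (simp add: m_def)
  also have "\<dots> = ?c ((\<Sum>b\<le>m. t b) * ssum s)" by (simp add: mult.commute)
  also have "\<dots> = ?c ((\<Sum>b\<le>m. t b) * (\<Sum>a\<le>m. s a))"
    by (rule ssum_mult_left_nth[OF s]) (simp add: m_def)
  also have "\<dots> = ?c (\<Sum>a\<le>m. \<Sum>b\<le>m. s a * t b)" by (simp only: mult.commute sum_product)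
  also have "\<dots> = (\<Sum>(a,b)\<in>{..m} \<times> {..m}. ?c (s a * t b))"
    by (simp add: fps_sum_nth sum.cartesian_product case_prod_unfold)
  also have "\<dots> = (\<Sum>(a,b)\<in>{(a,b). a + b \<le> m}. ?c (s a * t b))"
    using ord by (intro sum.mono_neutral_right) auto
  also have "\<dots> = (\<Sum>k\<le>m. \<Sum>a\<le>k. ?c (s a * t (k - a)))" by (rule sum.triangle_reindex_eq)
  also have "\<dots> = ?c (\<Sum>k\<le>m. \<Sum>a\<le>k. s a * t (k - a))" by (simp add: fps_sum_nth)
  also have "\<dots> = ?c (ssum (\<lambda>k. \<Sum>a\<le>k. s a * t (k - a)))"
    by (simp add: ssum_def m_def fps_sum_nth)
  finally show "?c (ssum s * ssum t) = ?c (ssum (\<lambda>k. \<Sum>a\<le>k. s a * t (k - a)))" .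
qed

lemma ssum_map:
  assumes "ring_map f" shows "fps_map2 f (ssum s) = ssum (\<lambda>k. fps_map2 f (s k))"
  by (simp add: fps_eq_iff ssum_def ring_mapD[OF assms])

lemma ssum_cong: "(\<And>k. s k = t k) \<Longrightarrow> ssum s = ssum t" by (simp add: ssum_def)

subsection \<open>Exponentials\<close>

lemma fexp2_eq: "fexp2 \<kappa> f = ssum (\<lambda>k. const2 (\<kappa> (1 / fact k)) * f ^ k)"
  by (simp add: fexp2_def ssum_def)

text \<open>The binomial theorem gives $\sum_{a+b=k} f^a(-f)^b/(a!\,b!) = (f-f)^k/k!$.\<close>

lemma fexp2_inverse:
  assumes \<kappa>: "ring_map \<kappa>" and f: "ord2 1 (f :: 'r::idom fps fps)"
  shows "fexp2 \<kappa> f * fexp2 \<kappa> (- f) = 1"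
proof -
  note c2 = ring_map_comp[OF \<kappa> ring_map_const2]
  let ?s = "\<lambda>f k. const2 (\<kappa> (1 / fact k)) * f ^ k"
  have f': "ord2 1 (- f)" using f by (simp add: ord2_def)
  have o: "ord2 k (?s f k)" "ord2 k (?s (- f) k)" for k
    by (intro ord2_mult_right ord2_power f f')+
  have "(\<Sum>a\<le>k. ?s f a * ?s (- f) (k - a)) = (if k = 0 then 1 else 0)" for k
  proof -
    have "?s f a * ?s (- f) (k - a) = const2 (\<kappa> (1 / fact k)) * (of_nat (k choose a) * f ^ a * (- f) ^ (k - a))"
      if "a \<le> k" for a
    proof -
      have "1 / fact a * (1 / fact (k - a)) = 1 / fact k * (of_nat (k choose a) :: complex)"
        using that by (simp add: binomial_fact field_simps)
      hence "const2 (\<kappa> (1 / fact a)) * const2 (\<kappa> (1 / fact (k - a))) = const2 (\<kappa> (1 / fact k)) * of_nat (k choose a)"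
        by (metis ring_mapD(2,8)[OF c2])
      thus ?thesis by (simp add: mult_ac)
    qed
    hence "(\<Sum>a\<le>k. ?s f a * ?s (- f) (k - a)) = const2 (\<kappa> (1 / fact k)) * (f + - f) ^ k"
      unfolding binomial_ring sum_distrib_left by (intro sum.cong) auto
    thus ?thesis by (simp add: ring_mapD[OF \<kappa>] power_0_left)
  qed
  hence "fexp2 \<kappa> f * fexp2 \<kappa> (- f) = ssum (\<lambda>k. if k = 0 then 1 else 0)"
    unfolding fexp2_eq by (subst ssum_mult[OF o]) (rule ssum_cong)
  also have "\<dots> = 1"
  proof (intro fps_ext)
    fix j i
    have "(if k = 0 then 1 else 0) $ j $ i = (if k = 0 then 1 $ j $ i else (0::'r))" for k :: nat
      by simp
    thus "(ssum (\<lambda>k. if k = 0 then 1 else 0)) $ j $ i = (1 :: 'r fps fps) $ j $ i"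
      by (simp only: ssum_def fps_nth_Abs_fps) simp
  qed
  finally show ?thesis .
qed

lemma fps_map2_simps:
  assumes "ring_map f"
  shows "fps_map2 f (a + b) = fps_map2 f a + fps_map2 f b" "fps_map2 f (a * b) = fps_map2 f a * fps_map2 f b"
    "fps_map2 f 1 = 1" "fps_map2 f 0 = 0" "fps_map2 f (- a) = - fps_map2 f a"
    "fps_map2 f (a - b) = fps_map2 f a - fps_map2 f b" "fps_map2 f (a ^ k) = fps_map2 f a ^ k"
    "fps_map2 f (const2 c) = const2 (f c)"
  using ring_mapD[OF ring_map_fps_map[OF ring_map_fps_map[OF assms]]]
  by (auto simp: fps_map_const ring_mapD[OF assms] ring_mapD[OF ring_map_fps_map[OF assms]])

lemma fexp2_map:
  assumes "ring_map f" "\<And>c. f (\<kappa> c) = \<kappa>' c"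
  shows "fps_map2 f (fexp2 \<kappa> a) = fexp2 \<kappa>' (fps_map2 f a)"
  unfolding fexp2_eq by (simp add: ssum_map assms fps_map2_simps)

lemma fps_map2_vars:
  assumes "ring_map f" shows "fps_map2 f hvar = hvar" "fps_map2 f hvar' = hvar'"
  by (auto simp: hvar_def hvar'_def fps_eq_iff fps_X_def ring_mapD[OF assms])

lemma ord2_hvar: "ord2 1 (hvar * a)" "ord2 1 (hvar' * a)"
  by (auto simp: ord2_def hvar_def hvar'_def)

lemma Qpow_inverse: "ring_map \<kappa> \<Longrightarrow> Qpow \<kappa> y * Qpow \<kappa> (- y) = 1"
  using fexp2_inverse[of \<kappa> "hvar * const2 y"] ord2_hvar[of "const2 y"]
  by (simp add: Qpow_def flip: fps_const_neg)

lemma exact_div_Qpow: "ring_map \<kappa> \<Longrightarrow> exact_div 1 (Qpow \<kappa> y) = Qpow \<kappa> (- y)"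
  using Qpow_inverse[of \<kappa> y] by (intro exact_div_eqI) (auto simp: mult.commute)

lemma Qpow_map:
  assumes "ring_map f" "\<And>c. f (\<kappa> c) = \<kappa>' c"
  shows "fps_map2 f (Qpow \<kappa> y) = Qpow \<kappa>' (f y)"
  using assms by (simp add: Qpow_def fexp2_map[OF assms] fps_map2_simps fps_map2_vars)

lemma brace_eq:
  assumes "ring_map \<kappa>"
  shows "brace \<kappa> g y = const2 (\<kappa> (1/2)) * (Qpow \<kappa> y ^ (g - 1) + Qpow \<kappa> (- y) ^ (g - 1)) *
     (\<Prod>k = 1..g - 1. const2 (\<kappa> (1 / (eps g ^ k - inverse (eps g ^ k)))) *
        (const2 (\<kappa> (eps g ^ k)) * Qpow \<kappa> y - const2 (\<kappa> (inverse (eps g ^ k))) * Qpow \<kappa> (- y)))"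
  by (simp add: brace_def Pfun_def Let_def exact_div_Qpow[OF assms])

lemma brace_map:
  assumes f: "ring_map f" "\<And>c. f (\<kappa> c) = \<kappa>' c" and "ring_map \<kappa>" "ring_map \<kappa>'"
  shows "fps_map2 f (brace \<kappa> g y) = brace \<kappa>' g (f y)"
  by (simp add: brace_eq assms fps_map2_simps[OF f(1)] Qpow_map[OF f] ring_mapD(5)[OF f(1)]
      ring_map_prod[OF ring_map_fps_map[OF ring_map_fps_map[OF f(1)]]])

text \<open>Inverting $u$ permutes the factors of $P(u)$ by $k \mapsto g - k$, because
  $\varepsilon^{g-k} = -\varepsilon^{-k}$.\<close>

lemma brace_minus:
  assumes "ring_map \<kappa>" shows "brace \<kappa> g (- y) = brace \<kappa> g y"
proof -
  let ?F = "\<lambda>y k. const2 (\<kappa> (1 / (eps g ^ k - inverse (eps g ^ k)))) *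
        (const2 (\<kappa> (eps g ^ k)) * Qpow \<kappa> y - const2 (\<kappa> (inverse (eps g ^ k))) * Qpow \<kappa> (- y))"
  have "(\<Prod>k = 1..g - 1. ?F (- y) k) = (\<Prod>k = 1..g - 1. ?F y k)"
  proof (rule prod.reindex_bij_witness[where i = "\<lambda>k. g - k" and j = "\<lambda>k. g - k"])
    fix k assume k: "k \<in> {1..g - 1}"
    have "eps g ^ g = exp (of_nat g * (\<i> * of_real pi / of_nat g))"
      by (simp only: eps_def exp_of_nat_mult)
    also have "of_nat g * (\<i> * of_real pi / of_nat g) = \<i> * of_real pi"
      using k by (cases "g = 0") auto
    also have "exp \<dots> = -1" by simp
    finally have "eps g ^ (g - k) * eps g ^ k = -1"
      using k by (cases "k \<le> g") (auto simp flip: power_add)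
    moreover have ne: "eps g \<noteq> 0" by (simp add: eps_def)
    ultimately have e: "eps g ^ (g - k) = - inverse (eps g ^ k)" by (simp add: field_simps)
    hence "inverse (eps g ^ (g - k)) = - (eps g ^ k)" by simp
    thus "?F y (g - k) = ?F (- y) k"
      by (simp add: e ring_mapD[OF assms] algebra_simps) (simp flip: fps_const_neg)
  qed auto
  thus ?thesis by (simp add: brace_eq[OF assms] add.commute)
qed

subsection \<open>The bracket\<close>

text \<open>The quotient $(e^{wy} - e^{-wy})/w$.\<close>

definition shq :: "(complex \<Rightarrow> 'r::idom) \<Rightarrow> 'r fps fps \<Rightarrow> 'r \<Rightarrow> 'r fps fps" where
  "shq \<kappa> w y = ssum (\<lambda>k. const2 (\<kappa> (1 / fact (Suc k)) * (y ^ Suc k - (- y) ^ Suc k)) * w ^ k)"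

lemma shq_mult:
  assumes \<kappa>: "ring_map \<kappa>" and w: "ord2 1 (w :: 'r::idom fps fps)"
  shows "w * shq \<kappa> w y = fexp2 \<kappa> (w * const2 y) - fexp2 \<kappa> (w * const2 (- y))"
proof (intro fps_ext)
  fix j i :: nat
  define m where "m = i + j"
  let ?c = "\<lambda>f :: 'r fps fps. f $ j $ i"
  define s where "s k = const2 (\<kappa> (1 / fact (Suc k)) * (y ^ Suc k - (- y) ^ Suc k)) * w ^ k" for k
  define t where "t k = const2 (\<kappa> (1 / fact k) * (y ^ k - (- y) ^ k)) * w ^ k" for k
  have s: "ord2 k (s k)" and t: "ord2 k (t k)" for k
    unfolding s_def t_def by (intro ord2_mult_right ord2_power w)+
  have st: "w * s k = t (Suc k)" for k by (simp add: s_def t_def mult_ac)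
  have "?c (w * shq \<kappa> w y) = ?c (w * (\<Sum>k\<le>m. s k))"
    unfolding shq_def s_def[symmetric] by (rule ssum_mult_left_nth[OF s]) (simp add: m_def)
  also have "\<dots> = ?c (\<Sum>k\<le>m. t (Suc k))" by (simp add: sum_distrib_left st)
  also have "\<dots> = ?c (\<Sum>k\<le>Suc m. t k)"
    unfolding sum.atMost_Suc_shift[of t] by (simp add: t_def)
  also have "\<dots> = ?c (\<Sum>k\<le>m. t k)" using t[of "Suc m"] by (simp add: ord2_def m_def)
  also have "(\<Sum>k\<le>m. t k) = (\<Sum>k\<le>m. const2 (\<kappa> (1 / fact k)) * (w * const2 y) ^ k - const2 (\<kappa> (1 / fact k)) * (w * const2 (- y)) ^ k)"
  proof (rule sum.cong[OF refl])
    fix k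
    have "t k = (const2 (\<kappa> (1 / fact k)) * (const2 y ^ k - const2 (- y) ^ k)) * w ^ k"
      unfolding t_def by (simp only: ring_mapD(2,6,7)[OF ring_map_const2])
    thus "t k = const2 (\<kappa> (1 / fact k)) * (w * const2 y) ^ k - const2 (\<kappa> (1 / fact k)) * (w * const2 (- y)) ^ k"
      by (simp only: power_mult_distrib right_diff_distrib left_diff_distrib mult_ac)
  qed
  also have "?c (\<Sum>k\<le>m. const2 (\<kappa> (1 / fact k)) * (w * const2 y) ^ k - const2 (\<kappa> (1 / fact k)) * (w * const2 (- y)) ^ k)
     = ?c (fexp2 \<kappa> (w * const2 y) - fexp2 \<kappa> (w * const2 (- y)))"
    by (simp only: fexp2_eq ssum_def m_def fps_sum_nth fps_nth_Abs_fps fps_sub_nth sum_subtractf)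
  finally show "?c (w * shq \<kappa> w y) = ?c (fexp2 \<kappa> (w * const2 y) - fexp2 \<kappa> (w * const2 (- y)))" .
qed

lemma shq_00: "ring_map \<kappa> \<Longrightarrow> (shq \<kappa> w y) $ 0 $ 0 = 2 * y"
  by (simp add: shq_def ssum_def ring_mapD)

lemma two_unit: "ring_map (\<kappa> :: complex \<Rightarrow> 'r::idom) \<Longrightarrow> 2 * \<kappa> (1/2) = 1"
  using ring_mapD(2)[of \<kappa> "2 :: complex" "1/2"] by (simp add: ring_mapD)

lemma shq_1_unit: "ring_map \<kappa> \<Longrightarrow> \<exists>v. shq \<kappa> w 1 * v = 1"
  by (rule fps2_unit[where c = "\<kappa> (1/2)"]) (simp add: shq_00 two_unit)

lemma shq_minus: "shq \<kappa> w (- y) = - shq \<kappa> w y"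
proof -
  have "shq \<kappa> w (- y) = ssum (\<lambda>k. - (const2 (\<kappa> (1 / fact (Suc k)) * (y ^ Suc k - (- y) ^ Suc k)) * w ^ k))"
    unfolding shq_def
  proof (rule ssum_cong)
    fix k
    have "(- y) ^ Suc k - (- (- y)) ^ Suc k = - (y ^ Suc k - (- y) ^ Suc k)" by simp
    thus "const2 (\<kappa> (1 / fact (Suc k)) * ((- y) ^ Suc k - (- (- y)) ^ Suc k)) * w ^ k =
      - (const2 (\<kappa> (1 / fact (Suc k)) * (y ^ Suc k - (- y) ^ Suc k)) * w ^ k)"
      by (simp only: mult_minus_right) (simp flip: fps_const_neg)
  qed
  thus ?thesis by (simp add: shq_def ssum_def fps_eq_iff sum_negf del: power_Suc)
qed

lemma shq_map:
  assumes "ring_map f" "\<And>c. f (\<kappa> c) = \<kappa>' c"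
  shows "fps_map2 f (shq \<kappa> w y) = shq \<kappa>' (fps_map2 f w) (f y)"
  unfolding shq_def by (simp add: ssum_map assms fps_map2_simps ring_mapD[OF assms(1)] del: power_Suc fps_const_mult)

text \<open>The series $h + h'\{y\}$.\<close>

definition wt :: "(complex \<Rightarrow> 'r::idom) \<Rightarrow> nat \<Rightarrow> 'r \<Rightarrow> 'r fps fps" where
  "wt \<kappa> g y = hvar + hvar' * brace \<kappa> g y"

lemma ord2_wt: "ord2 1 (wt \<kappa> g y)"
  by (auto simp: wt_def ord2_def hvar_def hvar'_def)

lemma wt_nth0: "(wt \<kappa> g y) $ 0 = fps_X"
  by (simp add: wt_def hvar_def hvar'_def)

lemma wt_neq_0: "wt \<kappa> g y \<noteq> 0"
  using wt_nth0[of \<kappa> g y] by auto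

lemma QTpow_diff:
  assumes "ring_map \<kappa>"
  shows "QTpow \<kappa> (brace \<kappa> g z) y - QTpow \<kappa> (brace \<kappa> g z) (- y) = shq \<kappa> (wt \<kappa> g z) y * wt \<kappa> g z"
  using shq_mult[OF assms ord2_wt[of \<kappa> g z]] by (simp add: QTpow_def wt_def mult.commute)

text \<open>This equation determines the bracket, since the factor is a unit with constant term $2$.
  The properties of the bracket below are derived from it and not from the iterated quotient.\<close>

lemma qbracket_mult:
  assumes "ring_map \<kappa>"
  shows "qbracket \<kappa> g y * shq \<kappa> (wt \<kappa> g y) 1 = shq \<kappa> (wt \<kappa> g y) y"
proof -
  obtain v where v: "shq \<kappa> (wt \<kappa> g y) 1 * v = 1" using shq_1_unit[OF assms] by blast
  have "exact_div (QTpow \<kappa> (brace \<kappa> g y) z - QTpow \<kappa> (brace \<kappa> g y) (- z)) (wt \<kappa> g y) = shq \<kappa> (wt \<kappa> g y) z" for z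
    by (rule exact_div_eqI[OF QTpow_diff[OF assms] wt_neq_0])
  hence "qbracket \<kappa> g y = exact_div (shq \<kappa> (wt \<kappa> g y) y) (shq \<kappa> (wt \<kappa> g y) 1)"
    by (simp add: qbracket_def Let_def wt_def)
  also have "\<dots> = shq \<kappa> (wt \<kappa> g y) y * v"
    using v by (intro exact_div_eqI) (auto simp: mult.assoc mult.commute)
  finally show ?thesis using v by (simp add: mult_ac)
qed

lemma qbracket_eqI:
  assumes "ring_map \<kappa>" "q * shq \<kappa> (wt \<kappa> g y) 1 = shq \<kappa> (wt \<kappa> g y) y"
  shows "qbracket \<kappa> g y = q"
proof -
  obtain v where "shq \<kappa> (wt \<kappa> g y) 1 * v = 1" using shq_1_unit[OF assms(1)] by blast
  hence "shq \<kappa> (wt \<kappa> g y) 1 \<noteq> 0" by auto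
  thus ?thesis using qbracket_mult[OF assms(1), of g y] assms(2) by (metis mult_right_cancel)
qed

text \<open>A ring homomorphism maps the equation that characterizes $[y]$ to the one for $[f(y)]$.\<close>

lemma qbracket_map:
  assumes f: "ring_map f" "\<And>c. f (\<kappa> c) = \<kappa>' c" and \<kappa>: "ring_map \<kappa>" "ring_map \<kappa>'"
  shows "fps_map2 f (qbracket \<kappa> g y) = qbracket \<kappa>' g (f y)"
proof -
  have w: "fps_map2 f (wt \<kappa> g y) = wt \<kappa>' g (f y)"
    by (simp add: wt_def fps_map2_simps f fps_map2_vars brace_map[OF f \<kappa>])
  have "fps_map2 f (qbracket \<kappa> g y) * shq \<kappa>' (wt \<kappa>' g (f y)) 1 = shq \<kappa>' (wt \<kappa>' g (f y)) (f y)"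
    using arg_cong[OF qbracket_mult[OF \<kappa>(1), of g y], of "fps_map2 f"]
    by (simp add: fps_map2_simps f shq_map[OF f] w ring_mapD(3)[OF f(1)])
  thus ?thesis using qbracket_eqI[OF \<kappa>(2)] by simp
qed

lemma qbracket_minus:
  assumes "ring_map \<kappa>" shows "qbracket \<kappa> g (- y) = - qbracket \<kappa> g y"
proof -
  have "wt \<kappa> g (- y) = wt \<kappa> g y" by (simp add: wt_def brace_minus[OF assms])
  thus ?thesis using qbracket_mult[OF assms, of g y]
    by (intro qbracket_eqI[OF assms]) (simp add: shq_minus)
qed

lemma qbracket_00:
  assumes "ring_map (\<kappa> :: complex \<Rightarrow> 'r::idom)" shows "(qbracket \<kappa> g y) $ 0 $ 0 = y"
proof -
  have "(qbracket \<kappa> g y) $ 0 $ 0 * 2 = y * 2"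
    using arg_cong[OF qbracket_mult[OF assms, of g y], of "\<lambda>f. f $ 0 $ 0"]
    by (simp add: shq_00[OF assms] mult.commute)
  moreover have "(2::'r) \<noteq> 0" using two_unit[OF assms] by auto
  ultimately show ?thesis by simp
qed

lemma qbracket_0: "ring_map \<kappa> \<Longrightarrow> qbracket \<kappa> g 0 = 0"
  by (rule qbracket_eqI) (simp_all add: shq_def ssum_def fps_eq_iff)

lemma fexp2_nth0: "(fexp2 \<kappa> f) $ 0 = fexp \<kappa> (f $ 0)"
proof -
  have "(f ^ k) $ 0 = (f $ 0) ^ k" for k by (induction k) auto
  thus ?thesis by (simp add: fexp2_def fexp_def)
qed

lemma qbracket_nth0:
  assumes "ring_map \<kappa>"
  shows "(qbracket \<kappa> g y) $ 0 * (fexp \<kappa> fps_X - fexp \<kappa> (- fps_X)) =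
    fexp \<kappa> (fps_X * fps_const y) - fexp \<kappa> (- (fps_X * fps_const y))"
proof -
  have nth0: "(QTpow \<kappa> (brace \<kappa> g y) z) $ 0 = fexp \<kappa> (fps_X * fps_const z)" for z
    by (simp add: QTpow_def fexp2_nth0 hvar_def hvar'_def)
  have "qbracket \<kappa> g y * (QTpow \<kappa> (brace \<kappa> g y) 1 - QTpow \<kappa> (brace \<kappa> g y) (- 1)) =
      QTpow \<kappa> (brace \<kappa> g y) y - QTpow \<kappa> (brace \<kappa> g y) (- y)"
    unfolding QTpow_diff[OF assms] using qbracket_mult[OF assms, of g y] by (simp add: mult.assoc[symmetric])
  from arg_cong[OF this, of "\<lambda>f. f $ 0"] show ?thesis
    by (simp add: nth0 flip: fps_const_neg)
qed

section \<open>Specializations of the structure series\<close>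

lemma ring_map_id: "ring_map (\<lambda>c. c)" by (simp add: ring_map_def)

lemma fexp_id_eq: "fexp (\<lambda>c. c) (fps_X * fps_const z) = fps_exp z"
proof (rule fps_ext)
  fix i
  have "(fexp (\<lambda>c. c) (fps_X * fps_const z)) $ i = (\<Sum>k\<le>i. 1 / fact k * (fps_X ^ k * fps_const (z ^ k)) $ i)"
    by (simp add: fexp_def power_mult_distrib)
  also have "\<dots> = (\<Sum>k\<le>i. if k = i then z ^ i / fact i else 0)"
    by (intro sum.cong) (auto simp: fps_X_power_iff)
  finally show "(fexp (\<lambda>c. c) (fps_X * fps_const z)) $ i = fps_exp z $ i" by simp
qed

text \<open>The reduction of $[z]$ modulo $h'$, that is $\sinh(hz)/\sinh(h)$. It does not depend on $g$
  (\<open>qbracket_nth0_sinh_ratio\<close>), so the definition uses $g = 1$.\<close>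

definition sinh_ratio :: "complex \<Rightarrow> complex fps" where
  "sinh_ratio z = (qbracket (\<lambda>c. c) 1 z) $ 0"

lemma qbracket_nth0_exp:
  "(qbracket (\<lambda>c. c) g z) $ 0 * (fps_exp 1 - fps_exp (- 1)) = fps_exp z - fps_exp (- z)"
proof -
  have "fexp (\<lambda>c. c) (- (fps_X * fps_const z)) = fps_exp (- z)" for z
    using fexp_id_eq[of "- z"] by (simp flip: fps_const_neg)
  from this this[of 1] show ?thesis
    using qbracket_nth0[OF ring_map_id, of g z] fexp_id_eq[of z] fexp_id_eq[of 1] by simp
qed

lemma exp_diff_neq_0: "fps_exp 1 - fps_exp (- 1 :: complex) \<noteq> 0"
proof
  assume "fps_exp 1 - fps_exp (- 1 :: complex) = 0"
  from arg_cong[OF this, of "\<lambda>f. f $ 1"] show False by simp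
qed

lemma qbracket_nth0_sinh_ratio: "(qbracket (\<lambda>c. c) g z) $ 0 = sinh_ratio z"
  using qbracket_nth0_exp[of g z] qbracket_nth0_exp[of 1 z] exp_diff_neq_0
  by (metis sinh_ratio_def mult_right_cancel)

lemma sinh_ratio_exp: "sinh_ratio z * (fps_exp 1 - fps_exp (- 1)) = fps_exp z - fps_exp (- z)"
  unfolding sinh_ratio_def by (rule qbracket_nth0_exp)

lemma sinh_ratio_nth0: "sinh_ratio z $ 0 = z"
  by (simp add: sinh_ratio_def qbracket_00[OF ring_map_id])

text \<open>The identity behind the commutator $[X^+,X^-]$ on a weight vector. Multiplied by
  $(e^h-e^{-h})^2$ it becomes an identity between exponentials.\<close>

lemma sinh_ratio_commutator: "sinh_ratio (a + 1) * sinh_ratio b - sinh_ratio a * sinh_ratio (b + 1) = sinh_ratio (b - a)"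
proof -
  define s where "s = fps_exp 1 - fps_exp (- 1 :: complex)"
  have h: "sinh_ratio z * s = fps_exp z - fps_exp (- z)" for z unfolding s_def by (rule sinh_ratio_exp)
  have "(sinh_ratio (a + 1) * sinh_ratio b - sinh_ratio a * sinh_ratio (b + 1)) * (s * s) =
      (sinh_ratio (a + 1) * s) * (sinh_ratio b * s) - (sinh_ratio a * s) * (sinh_ratio (b + 1) * s)"
    by (simp add: algebra_simps)
  also have "\<dots> = (sinh_ratio (b - a) * s) * s"
    unfolding h unfolding s_def
    by (simp add: left_diff_distrib right_diff_distrib flip: fps_exp_add_mult) (simp add: algebra_simps)
  finally show ?thesis using exp_diff_neq_0 by (simp add: s_def[symmetric] mult.assoc[symmetric])
qed

lemma ring_map_const_poly: "ring_map (\<lambda>c. [:c:] :: 'a::comm_ring_1 poly)"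
  by (simp add: ring_map_def one_pCons)

lemma ring_map_poly: "ring_map (\<lambda>p. poly p z)"
  by (simp add: ring_map_def)

lemma sinh_quot_eq: "sinh_quot = (qbracket (\<lambda>c. [:c:]) 1 [:0, 1:]) $ 0"
  unfolding sinh_quot_def
proof (rule exact_div_eqI)
  let ?\<kappa> = "\<lambda>c. [:c:] :: complex poly"
  show "fsinh ?\<kappa> (fps_X * fps_const [:0, 1:]) = (qbracket ?\<kappa> 1 [:0, 1:]) $ 0 * fsinh ?\<kappa> fps_X"
    unfolding fsinh_def using qbracket_nth0[OF ring_map_const_poly, of 1 "[:0, 1:]"] by (simp add: mult_ac)
  have "(fsinh ?\<kappa> fps_X) $ 1 = 1"
    by (simp add: fsinh_def fexp_def one_pCons)
  thus "fsinh ?\<kappa> fps_X \<noteq> 0" by auto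
qed

lemma sinh_quot_eval: "fps_map (\<lambda>p. poly p z) sinh_quot = sinh_ratio z"
proof -
  have "fps_map2 (\<lambda>p. poly p z) (qbracket (\<lambda>c. [:c:]) 1 [:0, 1:]) = qbracket (\<lambda>c. c) 1 z"
    using qbracket_map[OF ring_map_poly[of z] _ ring_map_const_poly ring_map_id, of 1 "[:0, 1:]"] by simp
  from arg_cong[OF this, of "\<lambda>f. f $ 0"] show ?thesis
    by (simp add: sinh_quot_eq sinh_ratio_def)
qed

lemma sinh_quot_0: "sinh_quot $ 0 = [:0, 1:]"
  by (simp add: sinh_quot_eq qbracket_00[OF ring_map_const_poly])

subsection \<open>Elimination of the square root\<close>

text \<open>Removing the two lowest coefficients $a$, $b$ of an even polynomial, where $b=-b$, leaves an even
  polynomial of smaller degree.\<close>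

lemma even_poly_is_compose:
  fixes p :: "complex poly poly"
  assumes "pcompose p [:0, - 1:] = p"
  shows "\<exists>r. pcompose r [:0, 0, 1:] = p"
  using assms
proof (induction "degree p" arbitrary: p rule: less_induct)
  case less
  obtain a q where p: "p = pCons a q" by (cases p)
  obtain b r where q: "q = pCons b r" by (cases q)
  have "[:a:] + [:0, - 1:] * ([:b:] + [:0, - 1:] * pcompose r [:0, - 1:]) = pCons a (pCons b r)"
    using less.prems by (simp add: p q pcompose_pCons)
  hence b: "- b = b" and r: "pcompose r [:0, - 1:] = r" by simp_all
  hence b0: "b = 0" by (simp add: equal_neg_zero)
  show ?case
  proof (cases "r = 0")
    case True
    thus ?thesis by (intro exI[of _ "[:a:]"]) (simp add: p q b0)
  next
    case False
    hence "degree r < degree p" by (simp add: p q)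
    from less.hyps[OF this r] obtain s where "pcompose s [:0, 0, 1:] = r" by blast
    thus ?thesis by (intro exI[of _ "pCons a s"]) (simp add: p q b0 pcompose_pCons)
  qed
qed

lemma sqrt_elim_eqI:
  assumes "pcompose r [:0, 0, 1:] = p" shows "sqrt_elim p = r"
  unfolding sqrt_elim_def
proof (rule the_equality)
  fix s assume "pcompose s [:0, 0, 1:] = p"
  hence "pcompose (s - r) [:0, 0, 1:] = 0" using assms by (simp add: pcompose_diff)
  hence "s - r = 0" by (rule pcompose_eq_0) simp
  thus "s = r" by simp
qed fact

lemma sqrt_elim_compose:
  assumes "pcompose p [:0, - 1:] = p" shows "pcompose (sqrt_elim p) [:0, 0, 1:] = p"
proof -
  obtain r where r: "pcompose r [:0, 0, 1:] = p" using even_poly_is_compose[OF assms] by blast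
  thus ?thesis by (simp only: sqrt_elim_eqI[OF r])
qed

lemma ring_map_kappa_HC: "ring_map kappa_HC"
  by (rule ring_map_comp[OF ring_map_const_poly ring_map_const_poly])

lemma ring_map_pcompose: "ring_map (\<lambda>p. pcompose p (q :: 'a::comm_ring_1 poly))"
  by (simp add: ring_map_def pcompose_add pcompose_mult pcompose_1)

lemma XX_series_eq: "XX_series g \<sigma> = qbracket kappa_HC g (H_elt \<sigma> 1) * qbracket kappa_HC g (H_elt \<sigma> (- 1))"
  by (simp add: XX_series_def)

text \<open>The sign change of $\sqrt C$ sends $H_e^\pm$ to $-H_{-e}^\pm$, and the bracket is odd.\<close>

lemma XX_series_even:
  "pcompose ((XX_series g \<sigma>) $ j $ i) [:0, - 1:] = (XX_series g \<sigma>) $ j $ i"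
proof -
  let ?\<tau> = "\<lambda>p :: complex poly poly. pcompose p [:0, - 1:]"
  have \<tau>: "?\<tau> [:0, 1:] = - [:0, 1:]" "?\<tau> [:a:] = [:a:]" for a
    by (simp_all add: pcompose_pCons)
  have "c * (- x + of_int e * y - of_int (\<sigma> * e)) = - (c * (x + of_int (- e) * y - of_int (\<sigma> * - e)))"
    for c x y :: "complex poly poly" and e by (simp add: algebra_simps)
  hence H: "?\<tau> (H_elt \<sigma> e) = - H_elt \<sigma> (- e)" for e
    unfolding H_elt_def by (simp only: ring_mapD[OF ring_map_pcompose] \<tau>)
  have "fps_map2 ?\<tau> (qbracket kappa_HC g y) = qbracket kappa_HC g (?\<tau> y)" for y
    by (rule qbracket_map[OF ring_map_pcompose _ ring_map_kappa_HC ring_map_kappa_HC]) simp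
  hence "fps_map2 ?\<tau> (XX_series g \<sigma>) = XX_series g \<sigma>"
    by (simp add: XX_series_eq fps_map2_simps[OF ring_map_pcompose] H qbracket_minus[OF ring_map_kappa_HC])
  from arg_cong[OF this, of "\<lambda>f. f $ j $ i"] show ?thesis by simp
qed

text \<open>Evaluation at $\sqrt C = s$ and $H = z$ is a ring homomorphism, so it can be applied inside the
  brackets.\<close>

lemma XX_series_eval:
  "poly (poly (sqrt_elim ((XX_series g \<sigma>) $ j $ i)) [:s\<^sup>2:]) z =
    (qbracket (\<lambda>c. c) g ((s + z - of_int \<sigma>) / 2) * qbracket (\<lambda>c. c) g ((s - z + of_int \<sigma>) / 2)) $ j $ i"
proof -
  let ?\<theta> = "\<lambda>p :: complex poly poly. poly (poly p [:s:]) z"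
  have \<theta>: "ring_map ?\<theta>" by (simp add: ring_map_def)
  have H: "?\<theta> (H_elt \<sigma> e) = (s + of_int e * z - of_int (\<sigma> * e)) / 2" for e
    unfolding H_elt_def by (simp add: ring_mapD[OF \<theta>])
  have "fps_map2 ?\<theta> (qbracket kappa_HC g y) = qbracket (\<lambda>c. c) g (?\<theta> y)" for y
    by (rule qbracket_map[OF \<theta> _ ring_map_kappa_HC ring_map_id]) simp
  hence *: "fps_map2 ?\<theta> (XX_series g \<sigma>) =
      qbracket (\<lambda>c. c) g ((s + z - of_int \<sigma>) / 2) * qbracket (\<lambda>c. c) g ((s - z + of_int \<sigma>) / 2)"
    by (simp add: XX_series_eq fps_map2_simps[OF \<theta>] H)
  define p where "p = (XX_series g \<sigma>) $ j $ i"
  have "poly (poly (sqrt_elim p) [:s\<^sup>2:]) z = ?\<theta> (pcompose (sqrt_elim p) [:0, 0, 1:])"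
    by (simp add: poly_pcompose power2_eq_square)
  also have "\<dots> = ?\<theta> p" using XX_series_even[of g \<sigma> j i] by (simp add: p_def sqrt_elim_compose)
  also have "\<dots> = (fps_map2 ?\<theta> (XX_series g \<sigma>)) $ j $ i" by (simp add: p_def)
  finally show ?thesis by (simp only: * p_def)
qed

text \<open>In the classical limit $[y]$ is $y$, and the product over $e$ becomes
  $\frac14(\sqrt C+H-\sigma)(\sqrt C-H+\sigma)$.\<close>

lemma XX_rhs_00:
  assumes "\<sigma> \<in> {1, - 1}"
  shows "(XX_rhs g \<sigma>) $ 0 $ 0 =
    scal (1/4) * (gen Cg - (gen (G Hg) - scal (of_int \<sigma>)) * (gen (G Hg) - scal (of_int \<sigma>)))"
proof -
  let ?r = "[: [:- 1/4, of_int \<sigma> / 2, - 1/4:], [:1/4:] :] :: complex poly poly"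
  have "(XX_series g \<sigma>) $ 0 $ 0 = H_elt \<sigma> 1 * H_elt \<sigma> (- 1)"
    by (simp add: XX_series_eq qbracket_00[OF ring_map_kappa_HC])
  also have "\<dots> = pcompose ?r [:0, 0, 1:]"
    using assms by (auto simp: H_elt_def pcompose_pCons one_pCons)
  finally have "sqrt_elim ((XX_series g \<sigma>) $ 0 $ 0) = ?r"
    by (intro sqrt_elim_eqI) simp
  hence "(XX_rhs g \<sigma>) $ 0 $ 0 = eval_HC ?r" by (simp add: XX_rhs_def)
  also have "\<dots> = scal (- 1/4) + scal (of_int \<sigma> / 2) * gen (G Hg) + scal (- 1/4) * gen (G Hg) ^ 2 + scal (1/4) * gen Cg"
    by (simp add: eval_HC_def numeral_2_eq_2 add_ac)
  also have "\<dots> = scal (1/4) * (gen Cg - (gen (G Hg) - scal (of_int \<sigma>)) * (gen (G Hg) - scal (of_int \<sigma>)))"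
    (is "?l = ?r")
  proof -
    have m: "scal a * (scal b * x) = scal (a * b) * x" "scal a * scal b = scal (a * b)" for a b and x :: "gen4 free_alg"
      by (simp_all add: ring_mapD[OF ring_map_scal] mult.assoc)
    have "?r = scal (1/4) * gen Cg - scal (1/4) * gen (G Hg) ^ 2 + scal (1/4) * (scal (of_int \<sigma>) * gen (G Hg))
        + scal (1/4) * (scal (of_int \<sigma>) * gen (G Hg)) - scal (1/4) * (scal (of_int \<sigma>) * scal (of_int \<sigma>))"
      by (simp add: algebra_simps power2_eq_square scal_central[of "of_int \<sigma>" "gen (G Hg)"])
    also have "\<dots> = ?l"
    proof -
      have "scal (of_int \<sigma> / 2) = scal (1/4 * of_int \<sigma>) + (scal (1/4 * of_int \<sigma>) :: gen4 free_alg)"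
        by (subst ring_mapD(1)[OF ring_map_scal, symmetric]) simp
      moreover have "of_int \<sigma> * of_int \<sigma> = (1 :: complex)" using assms by auto
      moreover have "scal (- 1/4) = - (scal (1/4) :: gen4 free_alg)"
        by (subst ring_mapD(5)[OF ring_map_scal, symmetric]) simp
      ultimately show ?thesis by (simp add: m distrib_right)
    qed
    finally show ?thesis ..
  qed
  finally show ?thesis .
qed

section \<open>The Verma modules as operators on sequences\<close>

text \<open>The eigenvalue of $H$ on $m_j$, and the coefficient $a_j$ of $X^+ m_j = a_j m_{j-1}$ for $U$, $U_h$ and
  $U_{h,h'}$.\<close>

definition wtH :: "nat \<Rightarrow> nat \<Rightarrow> complex" where "wtH n j = of_nat n - 2 * of_nat j"

definition xp0 :: "nat \<Rightarrow> nat \<Rightarrow> complex" where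
  "xp0 n j = of_nat j * (of_nat n - of_nat j + 1)"
definition xp1 :: "nat \<Rightarrow> nat \<Rightarrow> complex fps" where
  "xp1 n j = sinh_ratio (of_nat j) * sinh_ratio (of_nat n - of_nat j + 1)"
definition xp2 :: "nat \<Rightarrow> nat \<Rightarrow> nat \<Rightarrow> complex fps fps" where
  "xp2 g n j = qbracket (\<lambda>c. c) g (of_nat j) * qbracket (\<lambda>c. c) g (of_nat n - of_nat j + 1)"

definition lower1 :: "(nat \<Rightarrow> complex fps) \<Rightarrow> oper fps" where
  "lower1 c = Abs_fps (\<lambda>i. lower (\<lambda>j. c j $ i))"
definition lower2 :: "(nat \<Rightarrow> complex fps fps) \<Rightarrow> oper fps fps" where
  "lower2 c = Abs_fps (\<lambda>i. lower1 (\<lambda>j. c j $ i))"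

lemma lower1_nth [simp]: "lower1 c $ i = lower (\<lambda>j. c j $ i)"
  by (simp add: lower1_def)
lemma lower2_nth [simp]: "lower2 c $ i = lower1 (\<lambda>j. c j $ i)"
  by (simp add: lower2_def)

lemma xp2_nth0: "xp2 g n j $ 0 = xp1 n j"
  by (simp add: xp2_def xp1_def qbracket_nth0_sinh_ratio)
lemma xp1_nth0: "xp1 n j $ 0 = xp0 n j"
  by (simp add: xp1_def xp0_def sinh_ratio_nth0)

lemma sinh_ratio_0: "sinh_ratio 0 = 0" by (simp add: sinh_ratio_def qbracket_0[OF ring_map_id])

text \<open>The zero at $0$ expresses $X^-X^+ m_0 = 0$, and the zero at $n+1$ makes the span of the $m_j$ with $j > n$
  invariant.\<close>

lemma xp_0: "xp0 n 0 = 0" "xp1 n 0 = 0" "xp2 g n 0 = 0"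
  by (simp_all add: xp0_def xp1_def xp2_def sinh_ratio_0 qbracket_0[OF ring_map_id])
lemma xp_Suc_n: "xp0 n (Suc n) = 0" "xp1 n (Suc n) = 0" "xp2 g n (Suc n) = 0"
  by (simp_all add: xp0_def xp1_def xp2_def sinh_ratio_0 qbracket_0[OF ring_map_id])

fun gen_op0 :: "nat \<Rightarrow> gen3 \<Rightarrow> oper" where
  "gen_op0 n Xp = lower (xp0 n)"
| "gen_op0 n Xm = shift"
| "gen_op0 n Hg = diag (wtH n)"

fun gen_op1 :: "nat \<Rightarrow> gen3 \<Rightarrow> oper fps" where
  "gen_op1 n Xp = lower1 (xp1 n)"
| "gen_op1 n Xm = fps_const shift"
| "gen_op1 n Hg = fps_const (diag (wtH n))"

fun gen_op2 :: "nat \<Rightarrow> nat \<Rightarrow> gen4 \<Rightarrow> oper fps fps" where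
  "gen_op2 g n (G Xp) = lower2 (xp2 g n)"
| "gen_op2 g n (G Xm) = const2 shift"
| "gen_op2 g n (G Hg) = const2 (diag (wtH n))"
| "gen_op2 g n Cg = const2 (opc ((of_nat n + 1)\<^sup>2))"

lemma fps_central:
  fixes r a :: "'a::ring_1 fps"
  assumes "\<And>i x. r $ i * x = x * r $ i"
  shows "r * a = a * r"
proof (rule fps_ext)
  fix m
  have "(\<Sum>i\<le>m. r $ i * a $ (m - i)) = (\<Sum>i\<le>m. a $ i * r $ (m - i))"
    by (rule sum.reindex_bij_witness[where i = "\<lambda>i. m - i" and j = "\<lambda>i. m - i"]) (auto simp: assms)
  thus "(r * a) $ m = (a * r) $ m" by (simp add: fps_mult_nth atLeast0AtMost)
qed

lemma const_opc_central: "fps_const (opc c) * a = a * fps_const (opc c)"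
  by (rule fps_central) (simp add: opc_central)

lemma const2_opc_central: "const2 (opc c) * a = a * const2 (opc c)"
  by (rule fps_central) (simp add: const_opc_central)

interpretation F0: free_hom opc "gen_op0 n" for n
  by unfold_locales (auto simp: ring_map_opc opc_central)

interpretation F1: free_hom "\<lambda>c. fps_const (opc c)" "gen_op1 n" for n
  by unfold_locales (auto simp: ring_map_comp[OF ring_map_opc ring_map_fps_const] const_opc_central)

interpretation F2: free_hom "\<lambda>c. const2 (opc c)" "gen_op2 g n" for g n
  by unfold_locales (auto simp: ring_map_comp[OF ring_map_opc ring_map_const2] const2_opc_central)

text \<open>The operators assigned to the generators are series in $h,h'$ already, so the representation of
  the series ring is the continuous extension of the one of the free algebra.\<close>

definition rep0 :: "nat \<Rightarrow> gen3 free_alg \<Rightarrow> oper" where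
  "rep0 n = free_map opc (gen_op0 n)"
definition rep1 :: "nat \<Rightarrow> gen3 free_alg fps \<Rightarrow> oper fps" where
  "rep1 n = fps_extend (free_map (\<lambda>c. fps_const (opc c)) (gen_op1 n))"
definition rep2 :: "nat \<Rightarrow> nat \<Rightarrow> gen4 free_alg fps fps \<Rightarrow> oper fps fps" where
  "rep2 g n = fps_extend2 (free_map (\<lambda>c. const2 (opc c)) (gen_op2 g n))"

lemma ring_map_rep: "ring_map (rep0 n)" "ring_map (rep1 n)" "ring_map (rep2 g n)"
  unfolding rep0_def rep1_def rep2_def
  by (intro F0.F_ring_map F1.F_ring_map F2.F_ring_map ring_map_extend ring_map_extend2)+

lemma rep_gen: "rep0 n (gen y) = gen_op0 n y" "rep1 n (fps_const (gen y)) = gen_op1 n y"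
  "rep2 g n (const2 (gen z)) = gen_op2 g n z"
  by (simp_all add: rep0_def rep1_def rep2_def fps_extend_const fps_extend2_const
      F0.F_ring_map F1.F_ring_map F2.F_ring_map F0.F_gen F1.F_gen F2.F_gen)

lemma rep_scal: "rep0 n (scal c) = opc c" "rep1 n (fps_map scal r) = fps_map opc r"
  "rep2 g n (fps_map2 scal s) = fps_map2 opc s"
proof -
  have "opc 0 = 0" by (rule oper_eqI) simp
  thus "rep0 n (scal c) = opc c" "rep1 n (fps_map scal r) = fps_map opc r"
    "rep2 g n (fps_map2 scal s) = fps_map2 opc s"
    by (auto simp: rep0_def rep1_def rep2_def F0.F_scal F1.F_scal F2.F_scal fps_extend_map fps_extend2_map)
qed

subsection \<open>Commutation relations of the operators\<close>

lemma diag_simps: "diag d * diag d' = diag (\<lambda>j. d j * d' j)" "diag d + diag d' = diag (\<lambda>j. d j + d' j)"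
  "diag d - diag d' = diag (\<lambda>j. d j - d' j)" "diag (\<lambda>j. 0) = 0"
  by (auto intro!: oper_eqI simp: algebra_simps)

lemma diag_power: "diag d ^ k = diag (\<lambda>j. d j ^ k)"
  by (induction k) (auto intro!: oper_eqI simp: diag_simps)

lemma diag_sum: "(\<Sum>i\<in>S. diag (d i)) = diag (\<lambda>j. \<Sum>i\<in>S. d i j)"
  by (induction S rule: infinite_finite_induct) (auto simp: diag_simps)

lemma lower_shift: "lower a * shift = diag (\<lambda>j. a (Suc j))"
  by (rule oper_eqI) simp

lemma shift_lower: "a 0 = 0 \<Longrightarrow> shift * lower a = diag a"
  by (rule oper_eqI) (auto simp: gr0_conv_Suc)

lemma wtH_lower: "diag (wtH n) * lower a - lower a * diag (wtH n) = lower a + lower a"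
  by (rule oper_eqI) (simp add: wtH_def algebra_simps)

lemma wtH_shift: "diag (wtH n) * shift - shift * diag (wtH n) + (shift + shift) = 0"
  by (rule oper_eqI) (auto simp: wtH_def algebra_simps gr0_conv_Suc)

lemma rep0_kills: "a \<in> U_ideal \<Longrightarrow> rep0 n a = 0"
proof -
  have "U_ideal \<subseteq> {a. rep0 n a = 0}"
    unfolding U_ideal_def
  proof (rule genideal_type_ring(3)[OF ideal_kernel[OF ring_map_rep(1)]])
    have "lower (xp0 n) * shift - shift * lower (xp0 n) = diag (wtH n)"
      by (simp add: lower_shift shift_lower xp_0 diag_simps)
         (simp add: xp0_def wtH_def[abs_def] algebra_simps)
    thus "{commutator (gen Hg) (gen Xp) - 2 * gen Xp, commutator (gen Hg) (gen Xm) + 2 * gen Xm,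
      commutator (gen Xp) (gen Xm) - gen Hg} \<subseteq> {a. rep0 n a = 0}"
      by (simp add: commutator_def ring_mapD[OF ring_map_rep(1)] rep_gen mult_2 wtH_lower wtH_shift)
  qed
  thus "a \<in> U_ideal \<Longrightarrow> rep0 n a = 0" by auto
qed

lemma F1_eval_H: "free_map (\<lambda>c. fps_const (opc c)) (gen_op1 n) (eval_H p) = fps_const (diag (\<lambda>j. poly p (wtH n j)))"
proof -
  have "free_map (\<lambda>c. fps_const (opc c)) (gen_op1 n) (eval_H p) =
      (\<Sum>b\<le>degree p. fps_const (opc (coeff p b)) * fps_const (diag (wtH n)) ^ b)"
    by (simp add: eval_H_def ring_mapD[OF F1.F_ring_map] F1.F_scal F1.F_gen)
  also have "\<dots> = fps_const (\<Sum>b\<le>degree p. opc (coeff p b) * diag (wtH n) ^ b)"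
    by (simp only: ring_mapD[OF ring_map_fps_const])
  also have "(\<Sum>b\<le>degree p. opc (coeff p b) * diag (wtH n) ^ b) = diag (\<lambda>j. poly p (wtH n j))"
    by (simp add: diag_power diag_simps diag_sum poly_altdef)
  finally show ?thesis .
qed

definition Uh_rels :: "gen3 free_alg fps set" where
  "Uh_rels = (let x = (\<lambda>y. fps_const (gen y)) in
     {commutator (x Hg) (x Xp) - 2 * x Xp,
      commutator (x Hg) (x Xm) + 2 * x Xm,
      commutator (x Xp) (x Xm) - fps_map eval_H sinh_quot})"

lemma Uh_ideal_eq: "Uh_ideal = adic_closure (Idl\<^bsub>type_ring\<^esub> Uh_rels)"
  by (simp only: Uh_ideal_def Uh_rels_def Let_def)

lemma rep1_kills: "a \<in> Uh_ideal \<Longrightarrow> rep1 n a = 0"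
proof -
  have "Idl\<^bsub>type_ring\<^esub> Uh_rels \<subseteq> {a. rep1 n a = 0}"
  proof (rule genideal_type_ring(3)[OF ideal_kernel[OF ring_map_rep(2)]])
    have "rep1 n (fps_map eval_H sinh_quot) = fps_map (\<lambda>p. diag (\<lambda>j. poly p (wtH n j))) sinh_quot"
      unfolding rep1_def by (rule fps_extend_map) (rule F1_eval_H)
    also have "\<dots> = Abs_fps (\<lambda>i. diag (\<lambda>j. (sinh_ratio (wtH n j)) $ i))"
      by (simp add: fps_eq_iff flip: sinh_quot_eval)
    also have "\<dots> = lower1 (xp1 n) * fps_const shift - fps_const shift * lower1 (xp1 n)"
    proof (rule fps_ext)
      fix i
      have "xp1 n (Suc j) - xp1 n j = sinh_ratio (wtH n j)" for j
        using sinh_ratio_commutator[of "of_nat j" "of_nat n - of_nat j"] by (simp add: xp1_def wtH_def algebra_simps)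
      hence "(sinh_ratio (wtH n j)) $ i = (xp1 n (Suc j)) $ i - (xp1 n j) $ i" for j
        by (metis fps_sub_nth)
      thus "(Abs_fps (\<lambda>i. diag (\<lambda>j. (sinh_ratio (wtH n j)) $ i))) $ i =
          (lower1 (xp1 n) * fps_const shift - fps_const shift * lower1 (xp1 n)) $ i"
        by (simp add: lower_shift shift_lower xp_0 diag_simps)
    qed
    finally show "Uh_rels \<subseteq> {a. rep1 n a = 0}"
      by (simp add: Uh_rels_def Let_def commutator_def ring_mapD[OF ring_map_rep(2)] rep_gen mult_2
            del: fps_const_add fps_const_sub fps_const_mult)
         (simp add: fps_eq_iff wtH_lower wtH_shift)
  qed
  thus "a \<in> Uh_ideal \<Longrightarrow> rep1 n a = 0"
    unfolding Uh_ideal_eq using fps_extend_closure[of "Idl\<^bsub>type_ring\<^esub> Uh_rels"] unfolding rep1_def by blast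
qed

lemma F2_eval_HC: "free_map (\<lambda>c. const2 (opc c)) (gen_op2 g n) (eval_HC r) =
    const2 (diag (\<lambda>j. poly (poly r [:(of_nat n + 1)\<^sup>2:]) (wtH n j)))"
proof -
  let ?C = "(of_nat n + 1)\<^sup>2 :: complex"
  have "free_map (\<lambda>c. const2 (opc c)) (gen_op2 g n) (eval_HC r) =
      (\<Sum>c\<le>degree r. \<Sum>b\<le>degree (coeff r c). const2 (opc (coeff (coeff r c) b)) *
        const2 (diag (wtH n)) ^ b * const2 (opc ?C) ^ c)"
    by (simp add: eval_HC_def ring_mapD[OF F2.F_ring_map] F2.F_scal F2.F_gen)
  also have "\<dots> = const2 (\<Sum>c\<le>degree r. \<Sum>b\<le>degree (coeff r c). opc (coeff (coeff r c) b) *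
        diag (wtH n) ^ b * opc ?C ^ c)"
    by (simp only: ring_mapD[OF ring_map_const2])
  also have "(\<Sum>c\<le>degree r. \<Sum>b\<le>degree (coeff r c). opc (coeff (coeff r c) b) * diag (wtH n) ^ b * opc ?C ^ c) =
      diag (\<lambda>j. poly (poly r [:?C:]) (wtH n j))"
  proof -
    have "poly (poly r [:?C:]) z = (\<Sum>c\<le>degree r. \<Sum>b\<le>degree (coeff r c). coeff (coeff r c) b * z ^ b * ?C ^ c)" for z
      by (simp add: poly_altdef[of r] poly_sum poly_altdef[of "coeff r _"] sum_distrib_right)
    thus ?thesis by (simp add: diag_power diag_simps diag_sum)
  qed
  finally show ?thesis .
qed

text \<open>On $m_j$ one has $\sqrt C = n+1$ and $H = n-2j$, so $H_1^\pm$ and $H_{-1}^\pm$ are the integers $n-i+1$ and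
  $i$, where $i = j+1$ for the sign $+$ and $i = j$ for the sign $-$.\<close>

lemma rep2_XX_rhs:
  assumes "\<sigma> \<in> {1, - 1}"
  shows "(rep2 g n (XX_rhs g \<sigma>)) $ m $ l =
    diag (\<lambda>j. (xp2 g n (if \<sigma> = 1 then Suc j else j)) $ m $ l)"
proof -
  let ?s = "\<lambda>p. diag (\<lambda>j. poly (poly (sqrt_elim p) [:(of_nat n + 1)\<^sup>2:]) (wtH n j))"
  have "?s 0 = 0" using sqrt_elim_eqI[of 0 0] by (simp add: diag_simps)
  hence "rep2 g n (XX_rhs g \<sigma>) = fps_map2 ?s (XX_series g \<sigma>)"
    unfolding rep2_def XX_rhs_def by (intro fps_extend2_map F2_eval_HC)
  moreover have "qbracket (\<lambda>c. c) g ((of_nat n + 1 + wtH n j - of_int \<sigma>) / 2) *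
      qbracket (\<lambda>c. c) g ((of_nat n + 1 - wtH n j + of_int \<sigma>) / 2) = xp2 g n (if \<sigma> = 1 then Suc j else j)" for j
  proof -
    have "(of_nat n + 1 + wtH n j - of_int \<sigma>) / 2 = of_nat n - of_nat (if \<sigma> = 1 then Suc j else j) + 1"
      "(of_nat n + 1 - wtH n j + of_int \<sigma>) / 2 = of_nat (if \<sigma> = 1 then Suc j else j)"
      using assms by (auto simp: wtH_def field_simps)
    thus ?thesis by (simp only: xp2_def mult.commute)
  qed
  ultimately show ?thesis by (simp add: XX_series_eval)
qed

definition Uhh_rels :: "nat \<Rightarrow> gen4 free_alg fps fps set" where
  "Uhh_rels g = (let x = (\<lambda>y. const2 (gen y)) in
     {commutator (x Cg) (x (G Xp)),
      commutator (x Cg) (x (G Xm)),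
      commutator (x Cg) (x (G Hg)),
      commutator (x (G Hg)) (x (G Xp)) - 2 * x (G Xp),
      commutator (x (G Hg)) (x (G Xm)) + 2 * x (G Xm),
      x (G Xp) * x (G Xm) - XX_rhs g 1,
      x (G Xm) * x (G Xp) - XX_rhs g (- 1)})"

lemma Uhh_ideal_eq: "Uhh_ideal g = adic_closure2 (Idl\<^bsub>type_ring\<^esub> (Uhh_rels g))"
  by (simp only: Uhh_ideal_def Uhh_rels_def Let_def)

lemma rep2_kills: "a \<in> Uhh_ideal g \<Longrightarrow> rep2 g n a = 0"
proof -
  have "Idl\<^bsub>type_ring\<^esub> (Uhh_rels g) \<subseteq> {a. rep2 g n a = 0}"
  proof (rule genideal_type_ring(3)[OF ideal_kernel[OF ring_map_rep(3)]])
    have "rep2 g n (XX_rhs g 1) = lower2 (xp2 g n) * const2 shift"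
      by (simp add: fps_eq_iff rep2_XX_rhs lower_shift)
    moreover have "rep2 g n (XX_rhs g (- 1)) = const2 shift * lower2 (xp2 g n)"
      by (simp add: fps_eq_iff rep2_XX_rhs shift_lower xp_0)
    ultimately show "Uhh_rels g \<subseteq> {a. rep2 g n a = 0}"
      by (simp add: Uhh_rels_def Let_def commutator_def ring_mapD[OF ring_map_rep(3)] rep_gen mult_2 const2_opc_central
            del: fps_const_add fps_const_sub fps_const_mult)
         (simp add: fps_eq_iff wtH_lower wtH_shift const2_opc_central)
  qed
  thus "a \<in> Uhh_ideal g \<Longrightarrow> rep2 g n a = 0"
    unfolding Uhh_ideal_eq using fps_extend2_closure[of "Idl\<^bsub>type_ring\<^esub> (Uhh_rels g)"] unfolding rep2_def by blast
qed

subsection \<open>Reduction of the parameters\<close>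

text \<open>Since $C$ does not occur in $(X^-)^aH^b(X^+)^c$, it suffices to compare the generators $X^\pm$, $H$.\<close>

lemma rep_lin_ext_pbw:
  fixes f :: "gen4 free_alg \<Rightarrow> 'b::ring_1" and f' :: "gen3 free_alg \<Rightarrow> 'b"
  assumes f: "ring_map f" and f': "ring_map f'" and "\<And>c. f (scal c) = f' (scal c)" "\<And>y. f (gen (G y)) = f' (gen y)"
  shows "f (lin_ext pbw4 p) = f' (lin_ext pbw3 p)"
  by (simp add: lin_ext_def pbw4_def pbw3_def case_prod_unfold ring_mapD[OF f] ring_mapD[OF f'] assms(3,4))

lemma gen_op_nth0: "gen_op1 n y $ 0 = gen_op0 n y" "(gen_op2 g n (G y)) $ 0 = gen_op1 n y"
proof -
  show "gen_op1 n y $ 0 = gen_op0 n y" by (cases y) (auto simp: xp1_nth0)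
  have "lower1 (xp1 n) = lower1 (\<lambda>j. xp1 n j)" ..
  thus "(gen_op2 g n (G y)) $ 0 = gen_op1 n y" by (cases y) (auto simp: xp2_nth0)
qed

lemma rep2_pbw_nth0: "(rep2 g n (fps_map2 (lin_ext pbw4) p)) $ 0 = rep1 n (fps_map (lin_ext pbw3) (p $ 0))"
proof -
  have "(free_map (\<lambda>c. const2 (opc c)) (gen_op2 g n) (lin_ext pbw4 x)) $ 0 =
      free_map (\<lambda>c. fps_const (opc c)) (gen_op1 n) (lin_ext pbw3 x)" for x
    by (rule rep_lin_ext_pbw[OF ring_map_comp[OF F2.F_ring_map ring_map_nth0] F1.F_ring_map])
       (simp_all add: F2.F_scal F1.F_scal F2.F_gen F1.F_gen gen_op_nth0)
  thus ?thesis unfolding rep2_def rep1_def fps_extend2_nth0 by (simp add: fps_extend_nth fps_eq_iff)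
qed

lemma rep1_pbw_nth0: "(rep1 n (fps_map (lin_ext pbw3) p)) $ 0 = rep0 n (lin_ext pbw3 (p $ 0))"
proof -
  have "(free_map (\<lambda>c. fps_const (opc c)) (gen_op1 n) (gen y)) $ 0 = free_map opc (gen_op0 n) (gen y)" for y
    by (simp add: F1.F_gen F0.F_gen gen_op_nth0)
  hence "(free_map (\<lambda>c. fps_const (opc c)) (gen_op1 n) (lin_ext pbw3 x)) $ 0 = free_map opc (gen_op0 n) (lin_ext pbw3 x)" for x
    by (simp add: lin_ext_def pbw3_def case_prod_unfold ring_mapD[OF ring_map_comp[OF F1.F_ring_map ring_map_nth0]]
        ring_mapD[OF F0.F_ring_map] F1.F_scal F0.F_scal)
  thus ?thesis unfolding rep1_def rep0_def fps_extend_nth0 by simp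
qed

section \<open>Reduction to powers of the lowering operator\<close>

abbreviation "poly_in y \<equiv> lin_ext (\<lambda>j. y ^ j)"

text \<open>The classical situation. Here \<open>S\<close> is the sum of the relations, the left ideal of the Verma module
  and the polynomials in $X^-$. It contains $1$ and is stable under left multiplication by the
  generators, so it is everything.\<close>

locale lowering_spans =
  fixes I :: "'x free_alg set" and x y h :: 'x and n :: nat
  assumes ideal: "ideal I type_ring"
    and hy: "gen h * gen y - gen y * gen h + 2 * gen y \<in> I"
    and xy: "gen x * gen y - gen y * gen x - gen h \<in> I"
begin

lemmas I = type_ring_idealD[OF ideal]

definition S :: "'x free_alg set" where
  "S = {i + b * gen x + c * (gen h - of_nat n) + poly_in (gen y) p | i b c p. i \<in> I}"

lemma S_I: "i \<in> I \<Longrightarrow> i \<in> S"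
  unfolding S_def by (clarify, rule exI[of _ i], rule exI[of _ 0], rule exI[of _ 0], rule exI[of _ 0])
    (simp add: lin_ext_0)

lemma S_x: "b * gen x \<in> S"
  unfolding S_def by (clarify, rule exI[of _ 0], rule exI[of _ b], rule exI[of _ 0], rule exI[of _ 0])
    (simp add: lin_ext_0 I)

lemma S_h: "c * (gen h - of_nat n) \<in> S"
  unfolding S_def by (clarify, rule exI[of _ 0], rule exI[of _ 0], rule exI[of _ c], rule exI[of _ 0])
    (simp add: lin_ext_0 I)

lemma S_y: "poly_in (gen y) p \<in> S"
  unfolding S_def by (clarify, rule exI[of _ 0], rule exI[of _ 0], rule exI[of _ 0], rule exI[of _ p])
    (simp add: I)

lemma S_y': "scal r * gen y ^ k \<in> S"
  using S_y[of "Poly_Mapping.single k r"] by (simp add: lin_ext_single)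

lemma S_add: "a \<in> S \<Longrightarrow> b \<in> S \<Longrightarrow> a + b \<in> S"
proof -
  assume "a \<in> S" "b \<in> S"
  then obtain i c d p i' c' d' p' where ab: "i \<in> I" "i' \<in> I"
    "a = i + c * gen x + d * (gen h - of_nat n) + poly_in (gen y) p"
    "b = i' + c' * gen x + d' * (gen h - of_nat n) + poly_in (gen y) p'"
    unfolding S_def by blast
  have "a + b = (i + i') + (c + c') * gen x + (d + d') * (gen h - of_nat n) + poly_in (gen y) (p + p')"
    by (simp add: ab lin_ext_add distrib_right add_ac)
  thus "a + b \<in> S" using I(2)[OF ab(1,2)] unfolding S_def by blast
qed

lemma S_cong: "a - b \<in> I \<Longrightarrow> b \<in> S \<Longrightarrow> a \<in> S"
  using S_add[OF S_I, of "a - b" b] by simp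

text \<open>To see that $S$ is stable under left multiplication by $u$, only the powers of $y$ matter.\<close>

lemma S_left_mult:
  assumes "\<And>k. u * gen y ^ k \<in> S" and "a \<in> S"
  shows "u * a \<in> S"
proof -
  obtain i b c p where a: "i \<in> I" "a = i + b * gen x + c * (gen h - of_nat n) + poly_in (gen y) p"
    using assms(2) unfolding S_def by blast
  have scalS: "scal r * d \<in> S" if "d \<in> S" for r d
  proof -
    obtain i b c p where d: "i \<in> I" "d = i + b * gen x + c * (gen h - of_nat n) + poly_in (gen y) p"
      using \<open>d \<in> S\<close> unfolding S_def by blast
    have "scal r * poly_in (gen y) p \<in> S"
    proof (induction p rule: poly_mapping_sum_induct)
      case (single k s)
      thus ?case using S_y'[of "r * s" k]
        by (simp add: lin_ext_single ring_mapD[OF ring_map_scal] mult.assoc)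
    qed (auto simp: lin_ext_0 lin_ext_add distrib_left S_add S_I I)
    hence "scal r * i + (scal r * b) * gen x + (scal r * c) * (gen h - of_nat n) + scal r * poly_in (gen y) p \<in> S"
      using d by (intro S_add[OF S_add[OF S_add[OF S_I[OF I(3)] S_x] S_h]])
    thus ?thesis by (simp add: d distrib_left mult.assoc)
  qed
  have "u * poly_in (gen y) p \<in> S"
  proof (induction p rule: poly_mapping_sum_induct)
    case (single k r)
    have "u * (scal r * gen y ^ k) = scal r * (u * gen y ^ k)"
      by (metis scal_central mult.assoc)
    thus ?case using scalS[OF assms(1)] by (simp add: lin_ext_single)
  qed (auto simp: lin_ext_0 lin_ext_add distrib_left S_add S_I I)
  hence "u * i + (u * b) * gen x + (u * c) * (gen h - of_nat n) + u * poly_in (gen y) p \<in> S"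
    using a by (intro S_add[OF S_add[OF S_add[OF S_I[OF I(3)] S_x] S_h]])
  thus ?thesis by (simp add: a distrib_left mult.assoc)
qed

lemma S_mult_y: "a \<in> S \<Longrightarrow> gen y * a \<in> S"
  using S_left_mult[of "gen y"] S_y'[of 1 "Suc _"] by (simp add: ring_mapD[OF ring_map_scal])

lemma hy_power: "gen h * gen y ^ k - gen y ^ k * (gen h - of_nat (2 * k)) \<in> I"
proof (induction k)
  case (Suc k)
  have "gen h * gen y ^ Suc k - gen y ^ Suc k * (gen h - of_nat (2 * Suc k)) =
     (gen h * gen y - gen y * gen h + 2 * gen y) * gen y ^ k +
      gen y * (gen h * gen y ^ k - gen y ^ k * (gen h - of_nat (2 * k)))"
    by (simp add: algebra_simps power_commutes mult_2 mult_2_right)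
  thus ?case using I hy Suc by metis
qed (simp add: I)

lemma of_nat_scal: "of_nat k = scal (of_nat k)"
  by (simp add: ring_mapD[OF ring_map_scal])

lemma S_mult_h: "a \<in> S \<Longrightarrow> gen h * a \<in> S"
proof (rule S_left_mult)
  fix k
  have "gen y ^ k * (gen h - of_nat (2 * k)) = gen y ^ k * (gen h - of_nat n) + scal (of_nat n - of_nat (2 * k)) * gen y ^ k"
    unfolding scal_central[of _ "gen y ^ k"] by (simp add: ring_mapD[OF ring_map_scal] algebra_simps)
  hence "gen y ^ k * (gen h - of_nat (2 * k)) \<in> S" by (simp add: S_add S_h S_y')
  thus "gen h * gen y ^ k \<in> S" using S_cong[OF hy_power] by blast
qed

lemma S_mult_x: "a \<in> S \<Longrightarrow> gen x * a \<in> S"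
proof (rule S_left_mult)
  fix k show "gen x * gen y ^ k \<in> S"
  proof (induction k)
    case 0 show ?case using S_x[of 1] by simp
  next
    case (Suc k)
    have "gen x * gen y ^ Suc k - (gen y * (gen x * gen y ^ k) + gen h * gen y ^ k) =
        (gen x * gen y - gen y * gen x - gen h) * gen y ^ k"
      by (simp add: algebra_simps)
    hence "gen x * gen y ^ Suc k - (gen y * (gen x * gen y ^ k) + gen h * gen y ^ k) \<in> I"
      using I xy by metis
    moreover have "gen y * (gen x * gen y ^ k) + gen h * gen y ^ k \<in> S"
      using S_add S_mult_y[OF Suc] S_mult_h[of "gen y ^ k"] S_y'[of 1 k] by (simp add: ring_mapD[OF ring_map_scal])
    ultimately show ?case by (rule S_cong)
  qed
qed

text \<open>For a further generator that commutes with \<open>y\<close>, it suffices to know its effect on $m_0$.\<close>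

lemma S_mult_central:
  assumes "gen z * gen y - gen y * gen z \<in> I" "gen z \<in> S" "a \<in> S"
  shows "gen z * a \<in> S"
proof (rule S_left_mult[OF _ assms(3)])
  fix k
  have yk: "gen y ^ k * a \<in> S" if "a \<in> S" for a
    using that by (induction k) (auto simp: mult.assoc S_mult_y)
  have "gen z * gen y ^ k - gen y ^ k * gen z \<in> I"
  proof (induction k)
    case (Suc k)
    have "gen z * gen y ^ Suc k - gen y ^ Suc k * gen z =
      (gen z * gen y - gen y * gen z) * gen y ^ k + gen y * (gen z * gen y ^ k - gen y ^ k * gen z)"
      by (simp add: algebra_simps)
    thus ?case using I assms(1) Suc by metis
  qed (simp add: I)
  thus "gen z * gen y ^ k \<in> S" using yk[OF assms(2)] by (rule S_cong)
qed

lemma S_UNIV: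
  assumes "\<And>z. z \<in> {x, y, h} \<or> gen z * gen y - gen y * gen z \<in> I \<and> gen z \<in> S"
  shows "a \<in> S"
proof (induction a rule: free_alg_induct)
  case (scal c)
  show ?case using S_y'[of c 0] by simp
next
  case (mult z q)
  thus ?case using assms[of z] S_mult_x S_mult_y S_mult_h S_mult_central by blast
next
  case (gen z)
  have "1 \<in> S" using S_y'[of 1 0] by (simp add: ring_mapD[OF ring_map_scal])
  thus ?case using assms[of z] S_mult_x[of 1] S_mult_y[of 1] S_mult_h[of 1] by auto
qed (rule S_add)

end

definition T0 :: "gen3 free_alg set" where "T0 = range (poly_in (gen Xm))"
definition T1 :: "gen3 free_alg fps set" where "T1 = range (fps_map (poly_in (gen Xm)))"
definition T2 :: "gen4 free_alg fps fps set" where "T2 = range (fps_map2 (poly_in (gen (G Xm))))"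

lemma ideal_nth0:
  fixes I :: "'a::ring_1 fps set"
  assumes "ideal I type_ring"
  shows "ideal ((\<lambda>r. r $ 0) ` I) type_ring"
proof (rule type_ring_idealI)
  note I = type_ring_idealD[OF assms]
  show "0 \<in> (\<lambda>r. r $ 0) ` I" using I(1) by (auto intro!: image_eqI[of _ _ 0])
  fix a b assume "a \<in> (\<lambda>r. r $ 0) ` I"
  then obtain r where r: "r \<in> I" "a = r $ 0" by auto
  have "b * a = (fps_const b * r) $ 0" "a * b = (r * fps_const b) $ 0"
    using r(2) by simp_all
  thus "b * a \<in> (\<lambda>r. r $ 0) ` I" "a * b \<in> (\<lambda>r. r $ 0) ` I"
    using I(3)[OF r(1), of "fps_const b"] I(4)[OF r(1), of "fps_const b"] by blast+
  assume "b \<in> (\<lambda>r. r $ 0) ` I"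
  then obtain s where s: "s \<in> I" "b = s $ 0" by auto
  show "a + b \<in> (\<lambda>r. r $ 0) ` I"
    using r s I(2)[of r s] by (auto intro!: image_eqI[of _ _ "r + s"])
qed

lemma ideal_U: "ideal U_ideal type_ring"
  unfolding U_ideal_def by (rule genideal_type_ring)

lemma decomp0: "\<exists>i\<in>U_ideal. \<exists>b c. \<exists>t\<in>T0. a = i + b * gen Xp + c * (gen Hg - of_nat n) + t"
proof -
  let ?R = "{commutator (gen Hg) (gen Xp) - 2 * gen Xp, commutator (gen Hg) (gen Xm) + 2 * gen Xm,
      commutator (gen Xp) (gen Xm) - gen Hg} :: gen3 free_alg set"
  have R: "?R \<subseteq> U_ideal" unfolding U_ideal_def by (rule genideal_type_ring)
  interpret lowering_spans U_ideal Xp Xm Hg n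
    using ideal_U R by (intro lowering_spans.intro) (auto simp: commutator_def)
  have "a \<in> S"
  proof (rule S_UNIV)
    fix z :: gen3 show "z \<in> {Xp, Xm, Hg} \<or> gen z * gen Xm - gen Xm * gen z \<in> U_ideal \<and> gen z \<in> S"
      by (cases z) auto
  qed
  thus ?thesis unfolding S_def T0_def by blast
qed

lemma sum_X_power_nth:
  "m < N \<Longrightarrow> (\<Sum>i<N. fps_X ^ i * r i) $ m = (\<Sum>i\<le>m. (r i :: 'a::ring_1 fps) $ (m - i))"
proof -
  assume m: "m < N"
  have "(\<Sum>i<N. fps_X ^ i * r i) $ m = (\<Sum>i<N. if m < i then 0 else (r i) $ (m - i))"
    by (simp add: fps_sum_nth fps_X_power_mult_nth)
  also have "\<dots> = (\<Sum>i\<le>m. r i $ (m - i))"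
    using m by (intro sum.mono_neutral_cong_right) auto
  finally show ?thesis .
qed

lemma ideal_sum: "ideal (I :: 'a::ring_1 set) type_ring \<Longrightarrow> (\<And>i. i \<in> A \<Longrightarrow> f i \<in> I) \<Longrightarrow> sum f A \<in> I"
  by (induction A rule: infinite_finite_induct) (auto simp: type_ring_idealD)

lemma collapse_in_closure:
  fixes I :: "'a::ring_1 fps set"
  assumes "ideal I type_ring" "\<And>i. r i \<in> I"
  shows "fps_collapse (Abs_fps r) \<in> adic_closure I"
  unfolding adic_closure_def
proof safe
  fix N
  have "(\<Sum>i<N. fps_X ^ i * r i) \<in> I"
    using assms by (intro ideal_sum type_ring_idealD(3))
  thus "\<exists>s\<in>I. \<forall>i<N. (fps_collapse (Abs_fps r)) $ i = s $ i"
    by (intro bexI[of _ "\<Sum>i<N. fps_X ^ i * r i"]) (auto simp: sum_X_power_nth fps_collapse_def)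
qed

lemma collapse_in_closure2:
  fixes I :: "'a::ring_1 fps fps set"
  assumes "ideal I type_ring" "\<And>i. r i \<in> I"
  shows "fps_collapse (Abs_fps r) \<in> adic_closure2 I"
  unfolding adic_closure2_def
proof safe
  fix N
  have "(\<Sum>i<N. fps_X ^ i * r i) \<in> I"
    using assms by (intro ideal_sum type_ring_idealD(3))
  thus "\<exists>s\<in>I. \<forall>i j. i + j < N \<longrightarrow> (fps_collapse (Abs_fps r)) $ j $ i = s $ j $ i"
    by (intro bexI[of _ "\<Sum>i<N. fps_X ^ i * r i"]) (auto simp: sum_X_power_nth fps_collapse_def)
qed

text \<open>The sum $\sum_i h^i r_i$ in the inner variable.\<close>

lemma inner_collapse_in_closure2:
  fixes I :: "'a::ring_1 fps fps set"
  assumes "ideal I type_ring" "\<And>i. r i \<in> I"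
  shows "Abs_fps (\<lambda>j. fps_collapse (Abs_fps (\<lambda>i. r i $ j))) \<in> adic_closure2 I"
  unfolding adic_closure2_def
proof safe
  fix N
  have "(\<Sum>i<N. fps_const (fps_X ^ i) * r i) \<in> I"
    using assms by (intro ideal_sum type_ring_idealD(3))
  moreover have "(\<Sum>i<N. fps_const (fps_X ^ i) * r i) $ j $ m =
      (\<Sum>i<N. fps_X ^ i * r i $ j) $ m" for j m
    by (simp add: fps_sum_nth)
  ultimately show "\<exists>s\<in>I. \<forall>i j. i + j < N \<longrightarrow>
      (Abs_fps (\<lambda>j. fps_collapse (Abs_fps (\<lambda>i. r i $ j)))) $ j $ i = s $ j $ i"
    by (intro bexI[of _ "\<Sum>i<N. fps_const (fps_X ^ i) * r i"]) (auto simp: sum_X_power_nth fps_collapse_def)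
qed

lemma decomp1: "\<exists>i\<in>Uh_ideal. \<exists>b c. \<exists>t\<in>T1. a = i + b * fps_const (gen Xp) + c * (fps_const (gen Hg) - of_nat n) + t"
proof -
  define J where "J = Idl\<^bsub>type_ring\<^esub> Uh_rels"
  have J: "ideal J type_ring" "Uh_ideal = adic_closure J"
    "commutator (fps_const (gen Hg)) (fps_const (gen Xm)) + 2 * fps_const (gen Xm) \<in> J"
    "commutator (fps_const (gen Xp)) (fps_const (gen Xm)) - fps_map eval_H sinh_quot \<in> J"
    using genideal_type_ring(1,2)[of Uh_rels] by (auto simp: J_def Uh_ideal_eq Uh_rels_def)
  define J0 where "J0 = (\<lambda>r. r $ 0) ` J"
  have "eval_H [:0, 1:] = gen Hg" by (simp add: eval_H_def ring_mapD[OF ring_map_scal])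
  hence "gen Hg * gen Xm - gen Xm * gen Hg + 2 * gen Xm \<in> J0" "gen Xp * gen Xm - gen Xm * gen Xp - gen Hg \<in> J0"
    unfolding J0_def
    by (intro image_eqI[OF _ J(3)] image_eqI[OF _ J(4)], simp add: commutator_def sinh_quot_0)+
  then interpret lowering_spans J0 Xp Xm Hg n
    using ideal_nth0[OF J(1)] by (intro lowering_spans.intro) (auto simp: J0_def)
  let ?T = "{b * gen Xp + c * (gen Hg - of_nat n) + poly_in (gen Xm) p | b c p. True}"
  have "\<exists>r\<in>J. \<exists>t\<in>?T. a = r $ 0 + t" for a
  proof -
    have "a \<in> S"
    proof (rule S_UNIV)
      fix z :: gen3 show "z \<in> {Xp, Xm, Hg} \<or> gen z * gen Xm - gen Xm * gen z \<in> J0 \<and> gen z \<in> S"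
        by (cases z) auto
    qed
    then obtain r b c p where "r \<in> J" "a = r $ 0 + (b * gen Xp + c * (gen Hg - of_nat n) + poly_in (gen Xm) p)"
      unfolding S_def unfolding J0_def by (auto simp: add.assoc)
    thus ?thesis by blast
  qed
  from successive_approximation[OF this, of a] obtain r t where
    rt: "\<And>i. r i \<in> J" "\<And>i. t $ i \<in> ?T" "a = fps_collapse (Abs_fps r) + t" by blast
  from rt(2) have "\<forall>i. \<exists>b c p. t $ i = b * gen Xp + c * (gen Hg - of_nat n) + poly_in (gen Xm) p" by blast
  then obtain b c p where bcp: "\<And>i. t $ i = b i * gen Xp + c i * (gen Hg - of_nat n) + poly_in (gen Xm) (p i)"
    by metis
  have H: "fps_const (gen Hg) - of_nat n = fps_const (gen Hg - of_nat n :: gen3 free_alg)"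
    by (simp flip: fps_of_nat)
  have "a = fps_collapse (Abs_fps r) + Abs_fps b * fps_const (gen Xp) + Abs_fps c * (fps_const (gen Hg) - of_nat n)
      + fps_map (poly_in (gen Xm)) (Abs_fps p)"
    unfolding H by (simp add: rt(3) fps_eq_iff bcp)
  moreover have "fps_collapse (Abs_fps r) \<in> Uh_ideal"
    unfolding J(2) by (rule collapse_in_closure[OF J(1) rt(1)])
  ultimately show ?thesis unfolding T1_def by blast
qed

text \<open>The approximation is first carried out along $h$ modulo $h'$, and then along $h'$. In the
  first step the corrections are lifted to elements of the ideal, so that their sum is the
  reduction of an element of its closure.\<close>

lemma decomp2: "\<exists>i\<in>Uhh_ideal g. \<exists>b c. \<exists>t\<in>T2.
  a = i + b * const2 (gen (G Xp)) + c * (const2 (gen (G Hg)) - of_nat n) + t"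
proof -
  define J where "J = Idl\<^bsub>type_ring\<^esub> (Uhh_rels g)"
  have J: "ideal J type_ring" "Uhh_ideal g = adic_closure2 J"
    "commutator (const2 (gen Cg)) (const2 (gen (G Xm))) \<in> J"
    "commutator (const2 (gen (G Hg))) (const2 (gen (G Xm))) + 2 * const2 (gen (G Xm)) \<in> J"
    "const2 (gen (G Xp)) * const2 (gen (G Xm)) - XX_rhs g 1 \<in> J"
    "const2 (gen (G Xm)) * const2 (gen (G Xp)) - XX_rhs g (- 1) \<in> J"
    using genideal_type_ring(1,2)[of "Uhh_rels g"] by (auto simp: J_def Uhh_ideal_eq Uhh_rels_def Let_def)
  \<comment> \<open>Reductions of the ideal modulo $h'$ and modulo $(h,h')$.\<close>
  define J' where "J' = (\<lambda>r. r $ 0) ` J"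
  define J0 where "J0 = (\<lambda>r. r $ 0) ` J'"
  have J0: "r $ 0 $ 0 \<in> J0" if "r \<in> J" for r using that by (auto simp: J0_def J'_def)
  have ideals: "ideal J' type_ring" "ideal J0 type_ring"
    unfolding J0_def J'_def by (intro ideal_nth0 J(1))+
  note I0 = type_ring_idealD[OF ideals(2)]
  let ?h = "gen (G Hg) :: gen4 free_alg" and ?x = "gen (G Xp) :: gen4 free_alg" and ?y = "gen (G Xm) :: gen4 free_alg"
  have CY: "gen Cg * ?y - ?y * gen Cg \<in> J0" using J0[OF J(3)] by (simp add: commutator_def)
  have HY: "?h * ?y - ?y * ?h + 2 * ?y \<in> J0" using J0[OF J(4)] by (simp add: commutator_def)
  have s1: "scal 1 = (1 :: gen4 free_alg)" "scal (- 1) = (- 1 :: gen4 free_alg)"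
    by (simp_all add: ring_mapD[OF ring_map_scal])
  have "?x * ?y - scal (1/4) * (gen Cg - (?h - 1) * (?h - 1)) \<in> J0"
    using J0[OF J(5)] XX_rhs_00[of 1 g] by (simp add: s1)
  moreover have XY': "?y * ?x - scal (1/4) * (gen Cg - (?h + 1) * (?h + 1)) \<in> J0"
    using J0[OF J(6)] XX_rhs_00[of "- 1" g] by (simp add: s1)
  ultimately have "(?x * ?y - scal (1/4) * (gen Cg - (?h - 1) * (?h - 1))) -
      (?y * ?x - scal (1/4) * (gen Cg - (?h + 1) * (?h + 1))) \<in> J0" by (rule I0)
  also have "(?x * ?y - scal (1/4) * (gen Cg - (?h - 1) * (?h - 1))) -
      (?y * ?x - scal (1/4) * (gen Cg - (?h + 1) * (?h + 1))) =
      ?x * ?y - ?y * ?x - (scal (1/4) * ?h + scal (1/4) * ?h + scal (1/4) * ?h + scal (1/4) * ?h)"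
    by (simp add: algebra_simps)
  also have "scal (1/4) * ?h + scal (1/4) * ?h + scal (1/4) * ?h + scal (1/4) * ?h =
      scal (1/4 + 1/4 + 1/4 + 1/4) * ?h"
    by (simp only: ring_mapD[OF ring_map_scal] distrib_right)
  also have "\<dots> = ?h" by (simp add: s1)
  finally have XY: "?x * ?y - ?y * ?x - ?h \<in> J0" .
  interpret lowering_spans J0 "G Xp" "G Xm" "G Hg" n
    using ideals(2) HY XY by (rule lowering_spans.intro)
  \<comment> \<open>$C = 4X^-X^+ + (H+1)^2$ acts on $m_0$ by $(n+1)^2$: $(H+1)^2 - (n+1)^2$ is a left multiple of $H-n$.\<close>
  have CS: "gen Cg \<in> S"
  proof -
    let ?m = "of_nat n :: gen4 free_alg"
    have "- (scal 4 * (?y * ?x - scal (1/4) * (gen Cg - (?h + 1) * (?h + 1)))) \<in> J0"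
      by (intro I0 XY')
    also have "- (scal 4 * (?y * ?x - scal (1/4) * (gen Cg - (?h + 1) * (?h + 1)))) =
        scal (4 * (1/4)) * (gen Cg - (?h + 1) * (?h + 1)) - scal 4 * (?y * ?x)"
      unfolding ring_mapD(2)[OF ring_map_scal] by (simp add: algebra_simps)
    also have "\<dots> = gen Cg - ((scal 4 * ?y) * ?x + (?h + 1) * (?h + 1))"
      by (simp add: s1 algebra_simps)
    also have "(?h + 1) * (?h + 1) = (?h + ?m + 2) * (?h - ?m) + (?m + 1) * (?m + 1)"
    proof -
      have "?h * ?m = ?m * ?h" unfolding of_nat_scal by (rule scal_central[symmetric])
      thus ?thesis by (simp add: algebra_simps mult_2 mult_2_right)
    qed
    also have "(?m + 1) * (?m + 1) = scal ((of_nat n + 1) * (of_nat n + 1)) * ?y ^ 0"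
      by (simp add: ring_mapD[OF ring_map_scal])
    finally show ?thesis
      by (rule S_cong) (intro S_add S_x S_h S_y')
  qed
  let ?T = "{b * ?x + c * (?h - of_nat n) + poly_in ?y p | b c p. True}"
  have "\<exists>r\<in>J'. \<exists>t\<in>?T. a = r $ 0 + t" for a
  proof -
    have "a \<in> S"
    proof (rule S_UNIV)
      fix z :: gen4 show "z \<in> {G Xp, G Xm, G Hg} \<or> gen z * ?y - ?y * gen z \<in> J0 \<and> gen z \<in> S"
      proof (cases z)
        case (G v) thus ?thesis by (cases v) auto
      qed (use CY CS in auto)
    qed
    then obtain r b c p where "r \<in> J'" "a = r $ 0 + (b * ?x + c * (?h - of_nat n) + poly_in ?y p)"
      unfolding S_def unfolding J0_def by (auto simp: add.assoc)
    thus ?thesis by blast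
  qed
  note approx1 = successive_approximation[OF this]
  let ?T' = "{t. \<forall>i. t $ i \<in> ?T}"
  have "\<exists>r\<in>Uhh_ideal g. \<exists>t\<in>?T'. a = r $ 0 + t" for a
  proof -
    obtain r t where rt: "\<And>i. r i \<in> J'" "\<And>i. t $ i \<in> ?T" "a = fps_collapse (Abs_fps r) + t"
      using approx1[of a] by blast
    have "\<forall>i. \<exists>R\<in>J. r i = R $ 0" using rt(1) unfolding J'_def by blast
    then obtain R where R: "\<And>i. R i \<in> J" "\<And>i. r i = R i $ 0" by metis
    let ?R = "Abs_fps (\<lambda>j. fps_collapse (Abs_fps (\<lambda>i. R i $ j)))"
    have "?R \<in> Uhh_ideal g" unfolding J(2) by (rule inner_collapse_in_closure2[OF J(1) R(1)])
    moreover have "(\<lambda>i. R i $ 0) = r" using R(2) by auto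
    hence "?R $ 0 = fps_collapse (Abs_fps r)" by simp
    ultimately show ?thesis using rt(2,3) by (intro bexI[of _ ?R] bexI[of _ t]) auto
  qed
  from successive_approximation[OF this, of a] obtain r t where
    rt: "\<And>i. r i \<in> Uhh_ideal g" "\<And>i. t $ i \<in> ?T'" "a = fps_collapse (Abs_fps r) + t" by blast
  have "fps_collapse (Abs_fps r) \<in> adic_closure2 (Uhh_ideal g)"
    using ideal_adic_closure2[OF J(1)] rt(1) unfolding J(2) by (rule collapse_in_closure2)
  hence i: "fps_collapse (Abs_fps r) \<in> Uhh_ideal g" unfolding J(2) adic_closure2_idem .
  from rt(2) have "\<forall>j i. \<exists>b c p. t $ j $ i = b * ?x + c * (?h - of_nat n) + poly_in ?y p" by blast
  then obtain b c p where bcp: "\<And>j i. t $ j $ i = b j i * ?x + c j i * (?h - of_nat n) + poly_in ?y (p j i)"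
    by metis
  have H: "const2 ?h - of_nat n = const2 (?h - of_nat n)"
    by (simp flip: fps_of_nat)
  have "a = fps_collapse (Abs_fps r) + Abs_fps (\<lambda>j. Abs_fps (b j)) * const2 ?x +
      Abs_fps (\<lambda>j. Abs_fps (c j)) * (const2 ?h - of_nat n)
      + fps_map2 (poly_in ?y) (Abs_fps (\<lambda>j. Abs_fps (p j)))"
    unfolding H by (simp add: rt(3) fps_eq_iff bcp)
  thus ?thesis using i unfolding T2_def by blast
qed

section \<open>Coordinates on the three quotients\<close>

text \<open>The sequence of $m_0$, and the entries of $a m_0$.\<close>

definition hw :: "nat \<Rightarrow> complex" where "hw = (\<lambda>j. if j = 0 then 1 else 0)"

abbreviation "ev u k \<equiv> \<lambda>A. app A u k"

definition co0 :: "nat \<Rightarrow> gen3 free_alg \<Rightarrow> nat \<Rightarrow> complex" where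
  "co0 n a k = app (rep0 n a) hw k"
definition co1 :: "nat \<Rightarrow> gen3 free_alg fps \<Rightarrow> nat \<Rightarrow> complex fps" where
  "co1 n a k = fps_map (ev hw k) (rep1 n a)"
definition co2 :: "nat \<Rightarrow> nat \<Rightarrow> gen4 free_alg fps fps \<Rightarrow> nat \<Rightarrow> complex fps fps" where
  "co2 g n a k = fps_map2 (ev hw k) (rep2 g n a)"

text \<open>Operators that preserve the sequences vanishing on $\{0,\dots,n\}$, so that they act on the quotient.\<close>

definition pres :: "nat \<Rightarrow> oper \<Rightarrow> bool" where
  "pres n A \<longleftrightarrow> (\<forall>u. (\<forall>k\<le>n. u k = 0) \<longrightarrow> (\<forall>k\<le>n. app A u k = 0))"

lemma pres_simps: "pres n 0" "pres n A \<Longrightarrow> pres n B \<Longrightarrow> pres n (A + B)" "pres n A \<Longrightarrow> pres n B \<Longrightarrow> pres n (A * B)"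
  "pres n (diag d)" "pres n shift" "a (Suc n) = 0 \<Longrightarrow> pres n (lower a)"
proof -
  show "pres n (lower a)" if "a (Suc n) = 0"
    unfolding pres_def
  proof safe
    fix u :: "nat \<Rightarrow> complex" and k assume "\<forall>k\<le>n. u k = 0" "k \<le> n"
    thus "app (lower a) u k = 0" using that by (cases "k = n") auto
  qed
qed (auto simp: pres_def)

lemma pres_sum: "(\<And>i. i \<in> S \<Longrightarrow> pres n (A i)) \<Longrightarrow> pres n (sum A S)"
  by (induction S rule: infinite_finite_induct) (auto simp: pres_simps)

definition pres1 :: "nat \<Rightarrow> oper fps \<Rightarrow> bool" where "pres1 n A \<longleftrightarrow> (\<forall>i. pres n (A $ i))"
definition pres2 :: "nat \<Rightarrow> oper fps fps \<Rightarrow> bool" where "pres2 n A \<longleftrightarrow> (\<forall>i. pres1 n (A $ i))"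

lemma pres1_simps: "pres1 n 0" "pres1 n A \<Longrightarrow> pres1 n B \<Longrightarrow> pres1 n (A + B)" "pres1 n A \<Longrightarrow> pres1 n B \<Longrightarrow> pres1 n (A * B)"
  "pres n C \<Longrightarrow> pres1 n (fps_const C)" "c (Suc n) = 0 \<Longrightarrow> pres1 n (lower1 c)"
  by (auto simp: pres1_def fps_mult_nth intro!: pres_simps pres_sum)

lemma pres1_sum: "(\<And>i. i \<in> S \<Longrightarrow> pres1 n (A i)) \<Longrightarrow> pres1 n (sum A S)"
  by (induction S rule: infinite_finite_induct) (auto simp: pres1_simps)

lemma pres2_simps: "pres2 n A \<Longrightarrow> pres2 n B \<Longrightarrow> pres2 n (A + B)" "pres2 n A \<Longrightarrow> pres2 n B \<Longrightarrow> pres2 n (A * B)"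
  "pres1 n C \<Longrightarrow> pres2 n (fps_const C)" "c (Suc n) = 0 \<Longrightarrow> pres2 n (lower2 c)"
  by (auto simp: pres2_def fps_mult_nth intro!: pres1_simps pres1_sum)

lemma pres_rep: "pres n (rep0 n a)" "pres1 n (rep1 n b)" "pres2 n (rep2 g n c)"
proof -
  show "pres n (rep0 n a)"
    unfolding rep0_def
  proof (induction a rule: free_alg_induct)
    case (gen x) show ?case by (cases x) (auto simp: F0.F_gen pres_simps xp_Suc_n)
  next
    case (mult x q) thus ?case by (cases x) (auto simp: ring_mapD[OF F0.F_ring_map] F0.F_gen pres_simps xp_Suc_n)
  qed (auto simp: F0.F_scal ring_mapD[OF F0.F_ring_map] pres_simps)
  have 1: "pres1 n (free_map (\<lambda>c. fps_const (opc c)) (gen_op1 n) a)" for a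
  proof (induction a rule: free_alg_induct)
    case (gen x) show ?case by (cases x) (auto simp: F1.F_gen pres1_simps pres_simps xp_Suc_n)
  next
    case (mult x q) thus ?case
      by (cases x) (auto simp: ring_mapD[OF F1.F_ring_map] F1.F_gen xp_Suc_n intro!: pres1_simps pres_simps)
  qed (auto simp: F1.F_scal ring_mapD[OF F1.F_ring_map] pres1_simps pres_simps)
  thus "pres1 n (rep1 n b)"
    unfolding pres1_def rep1_def fps_extend_nth by (intro allI pres_sum) blast
  have 2: "pres2 n (gen_op2 g n x)" for x
  proof (cases x)
    case (G y) thus ?thesis by (cases y) (auto simp: xp_Suc_n intro!: pres2_simps pres1_simps pres_simps)
  qed (auto intro!: pres2_simps pres1_simps pres_simps)
  have "pres2 n (free_map (\<lambda>c. const2 (opc c)) (gen_op2 g n) a)" for a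
    by (induction a rule: free_alg_induct)
       (auto simp: F2.F_scal F2.F_gen ring_mapD[OF F2.F_ring_map] 2 intro!: pres2_simps pres1_simps pres_simps)
  thus "pres2 n (rep2 g n c)"
    unfolding pres2_def pres1_def rep2_def fps_extend2_nth by (intro allI pres_sum) blast
qed

lemma pres_cong:
  assumes "pres n B" "\<And>k. k \<le> n \<Longrightarrow> u k = v k" "k \<le> n"
  shows "app B u k = app B v k"
proof -
  have "app B (\<lambda>j. u j - v j) k = 0" using assms unfolding pres_def by simp
  thus ?thesis by (simp add: app_diff)
qed

text \<open>The first $n+1$ coordinates of $BAm_0$ depend on those of $Am_0$ only. With $A'=0$ this says that
  the elements whose first coordinates vanish form a left ideal.\<close>

lemma pres1_cong:
  assumes "pres1 n B" "\<And>k. k \<le> n \<Longrightarrow> fps_map (ev u k) A = fps_map (ev u k) A'" "k \<le> n"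
  shows "fps_map (ev u k) (B * A) = fps_map (ev u k) (B * A')"
proof (rule fps_ext)
  fix m
  have eq: "app (A $ i) u k = app (A' $ i) u k" if "k \<le> n" for i k
    using arg_cong[OF assms(2)[OF that], of "\<lambda>f. f $ i"] by simp
  have "app (B $ i) (app (A $ j) u) k = app (B $ i) (app (A' $ j) u) k" for i j
    using assms(1) unfolding pres1_def by (intro pres_cong[of n] eq assms(3)) auto
  thus "(fps_map (ev u k) (B * A)) $ m = (fps_map (ev u k) (B * A')) $ m"
    by (simp add: fps_mult_nth app_sum)
qed

lemma pres2_cong:
  assumes "pres2 n B" "\<And>k. k \<le> n \<Longrightarrow> fps_map2 (ev u k) A = fps_map2 (ev u k) A'" "k \<le> n"
  shows "fps_map2 (ev u k) (B * A) = fps_map2 (ev u k) (B * A')"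
proof (rule fps_ext)
  fix m
  have eq: "fps_map (ev u k) (A $ i) = fps_map (ev u k) (A' $ i)" if "k \<le> n" for i k
    using arg_cong[OF assms(2)[OF that], of "\<lambda>f. f $ i"] by simp
  have "fps_map (ev u k) (B $ i * A $ j) = fps_map (ev u k) (B $ i * A' $ j)" for i j
    using assms(1) unfolding pres2_def by (intro pres1_cong[of n] eq assms(3)) auto
  hence "(fps_map (ev u k) (B $ i * A $ j)) $ l = (fps_map (ev u k) (B $ i * A' $ j)) $ l" for i j l
    by simp
  thus "(fps_map2 (ev u k) (B * A)) $ m = (fps_map2 (ev u k) (B * A')) $ m"
    by (simp add: fps_mult_nth[of B] fps_eq_iff fps_sum_nth app_sum)
qed

lemma fps_map_scale: "fps_map (ev u k) (fps_map opc r * B) = r * fps_map (ev u k) B"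
  by (simp add: fps_eq_iff fps_mult_nth app_sum)

lemma fps_map2_scale: "fps_map2 (ev u k) (fps_map2 opc r * B) = r * fps_map2 (ev u k) B"
  by (simp add: fps_eq_iff fps_mult_nth app_sum fps_sum_nth)

lemma shift_power_hw: "app (shift ^ j) hw = (\<lambda>i. if i = j then 1 else 0)"
  by (induction j) (auto simp: hw_def fun_eq_iff)

text \<open>The operator of the polynomial $\sum_j p_j (X^-)^j$.\<close>

definition Lop :: "(nat \<Rightarrow>\<^sub>0 complex) \<Rightarrow> oper" where
  "Lop p = (\<Sum>j\<in>Poly_Mapping.keys p. opc (Poly_Mapping.lookup p j) * shift ^ j)"

lemma app_Lop: "app (Lop p) hw k = Poly_Mapping.lookup p k"
proof -
  have "app (Lop p) hw k = (\<Sum>j\<in>Poly_Mapping.keys p. if k = j then Poly_Mapping.lookup p k else 0)"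
    unfolding Lop_def app_sum by (intro sum.cong) (auto simp: shift_power_hw)
  thus ?thesis by (simp add: in_keys_iff)
qed

lemma Lop_0: "Lop 0 = 0" by (simp add: Lop_def)

lemma rep_lin_ext_Xm:
  "rep0 n (poly_in (gen Xm) p) = Lop p"
  "rep1 n (fps_map (poly_in (gen Xm)) P) = fps_map Lop P"
  "rep2 g n (fps_map2 (poly_in (gen (G Xm))) R) = fps_map2 Lop R"
proof -
  show "rep0 n (poly_in (gen Xm) p) = Lop p"
    by (simp add: rep0_def lin_ext_def Lop_def ring_mapD[OF F0.F_ring_map] F0.F_scal F0.F_gen)
  have "free_map (\<lambda>c. fps_const (opc c)) (gen_op1 n) (poly_in (gen Xm) p) = fps_const (Lop p)" for p
    by (simp only: lin_ext_def Lop_def ring_mapD[OF F1.F_ring_map] F1.F_scal F1.F_gen gen_op1.simps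
        ring_mapD[OF ring_map_fps_const])
  thus "rep1 n (fps_map (poly_in (gen Xm)) P) = fps_map Lop P"
    unfolding rep1_def by (rule fps_extend_map)
  have "free_map (\<lambda>c. const2 (opc c)) (gen_op2 g n) (poly_in (gen (G Xm)) p) = const2 (Lop p)" for p
    by (simp only: lin_ext_def Lop_def ring_mapD[OF F2.F_ring_map] F2.F_scal F2.F_gen gen_op2.simps
        ring_mapD[OF ring_map_const2])
  thus "rep2 g n (fps_map2 (poly_in (gen (G Xm))) R) = fps_map2 Lop R"
    unfolding rep2_def by (rule fps_extend2_map) (rule Lop_0)
qed

lemma co_lin_ext_Xm:
  "co0 n (poly_in (gen Xm) p) k = Poly_Mapping.lookup p k"
  "co1 n (fps_map (poly_in (gen Xm)) P) k = fps_map (\<lambda>p. Poly_Mapping.lookup p k) P"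
  "co2 g n (fps_map2 (poly_in (gen (G Xm))) R) k = fps_map2 (\<lambda>p. Poly_Mapping.lookup p k) R"
  by (simp_all add: co0_def co1_def co2_def rep_lin_ext_Xm app_Lop fps_eq_iff)

lemma of_nat_opc: "of_nat n = opc (of_nat n)"
  by (simp add: ring_mapD[OF ring_map_opc])

lemma app_X_hw: "app (lower a) hw k = 0" "app (diag (wtH n) - of_nat n) hw k = 0"
  by (simp_all add: hw_def of_nat_opc wtH_def)

interpretation V0: verma_quotient U_ideal "gen Xp" "gen Hg" "gen Xm" n T0 "co0 n" scal for n
proof (rule verma_quotient.intro)
  note R = ring_mapD[OF ring_map_rep(1)]
  fix k a b r j
  assume k: "k \<le> n"
  show "co0 n (a + b) k = co0 n a k + co0 n b k" by (simp add: co0_def R)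
  show "co0 n (b * a) k = 0" if "\<And>k. k \<le> n \<Longrightarrow> co0 n a k = 0"
    using pres_cong[OF pres_rep(1), of n "app (rep0 n a) hw" "\<lambda>_. 0" k b] that k app_smult[of _ 0 "\<lambda>_. 0"]
    by (simp add: co0_def R)
  show "co0 n a k = 0" if "a \<in> U_ideal" using that by (simp add: co0_def rep0_kills)
  show "co0 n (gen Xp) k = 0" by (simp add: co0_def rep_gen app_X_hw del: app_ops)
  show "co0 n (gen Hg - of_nat n) k = 0" by (simp only: co0_def rep_gen R gen_op0.simps app_X_hw)
  show "co0 n (gen Xm ^ j) k = (if j = k then 1 else 0)"
    by (simp add: co0_def R rep_gen shift_power_hw)
  show "co0 n (scal r * a) k = r * co0 n a k" by (simp add: co0_def R rep_scal)
qed (auto simp: ideal_U decomp0 scal_central)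

interpretation V1: verma_quotient Uh_ideal "fps_const (gen Xp)" "fps_const (gen Hg)" "fps_const (gen Xm)" n T1 "co1 n"
  "fps_map scal" for n
proof (rule verma_quotient.intro)
  note R = ring_mapD[OF ring_map_rep(2)]
  show "ideal Uh_ideal type_ring" unfolding Uh_ideal_eq by (intro ideal_adic_closure genideal_type_ring)
  show "\<exists>i\<in>Uh_ideal. \<exists>b c. \<exists>t\<in>T1. a = i + b * fps_const (gen Xp) + c * (fps_const (gen Hg) - of_nat n) + t" for a
    by (rule decomp1)
  show "fps_map scal r * a = a * fps_map scal r" for r a
    by (rule fps_central) (simp add: scal_central)
  fix k a b r j
  assume k: "k \<le> n"
  show "co1 n (a + b) k = co1 n a k + co1 n b k" by (simp add: co1_def R fps_eq_iff)
  show "co1 n (b * a) k = 0" if "\<And>k. k \<le> n \<Longrightarrow> co1 n a k = 0"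
    using pres1_cong[OF pres_rep(2), of n hw "rep1 n a" 0 k b] that k
    by (simp add: co1_def R) (simp add: fps_eq_iff)
  show "co1 n a k = 0" if "a \<in> Uh_ideal" using that by (simp add: co1_def rep1_kills fps_eq_iff)
  show "co1 n (fps_const (gen Xp)) k = 0" by (simp add: co1_def rep_gen app_X_hw fps_eq_iff del: app_ops)
  have H: "fps_const (diag (wtH n)) - of_nat n = fps_const (diag (wtH n) - of_nat n)" by (simp flip: fps_of_nat)
  show "co1 n (fps_const (gen Hg) - of_nat n) k = 0"
    by (simp only: co1_def rep_gen R gen_op1.simps H) (simp add: fps_eq_iff hw_def of_nat_opc wtH_def)
  show "co1 n (fps_const (gen Xm) ^ j) k = (if j = k then 1 else 0)"
    by (simp only: co1_def R rep_gen gen_op1.simps) (simp add: fps_const_power shift_power_hw fps_eq_iff)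
  show "co1 n (fps_map scal r * a) k = r * co1 n a k" by (simp add: co1_def R rep_scal fps_map_scale)
qed

interpretation V2: verma_quotient "Uhh_ideal g" "const2 (gen (G Xp))" "const2 (gen (G Hg))" "const2 (gen (G Xm))" n T2
  "co2 g n" "fps_map2 scal" for g n
proof (rule verma_quotient.intro)
  note R = ring_mapD[OF ring_map_rep(3)]
  show "ideal (Uhh_ideal g) type_ring" unfolding Uhh_ideal_eq by (intro ideal_adic_closure2 genideal_type_ring)
  show "\<exists>i\<in>Uhh_ideal g. \<exists>b c. \<exists>t\<in>T2. a = i + b * const2 (gen (G Xp)) + c * (const2 (gen (G Hg)) - of_nat n) + t" for a
    by (rule decomp2)
  show "fps_map2 scal r * a = a * fps_map2 scal r" for r a
  proof (rule fps_central)
    fix i x show "fps_map2 scal r $ i * x = x * fps_map2 scal r $ i"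
      unfolding fps_map_nth by (rule fps_central) (simp add: scal_central)
  qed
  fix k a b r j
  assume k: "k \<le> n"
  show "co2 g n (a + b) k = co2 g n a k + co2 g n b k" by (simp add: co2_def R fps_eq_iff)
  show "co2 g n (b * a) k = 0" if "\<And>k. k \<le> n \<Longrightarrow> co2 g n a k = 0"
    using pres2_cong[OF pres_rep(3), of n hw "rep2 g n a" 0 k g b] that k
    by (simp add: co2_def R) (simp add: fps_eq_iff)
  show "co2 g n a k = 0" if "a \<in> Uhh_ideal g" using that by (simp add: co2_def rep2_kills fps_eq_iff)
  show "co2 g n (const2 (gen (G Xp))) k = 0" by (simp add: co2_def rep_gen app_X_hw fps_eq_iff del: app_ops)
  have H: "const2 (diag (wtH n)) - of_nat n = const2 (diag (wtH n) - of_nat n)" by (simp flip: fps_of_nat)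
  show "co2 g n (const2 (gen (G Hg)) - of_nat n) k = 0"
    by (simp only: co2_def rep_gen R gen_op2.simps H) (simp add: fps_eq_iff hw_def of_nat_opc wtH_def)
  show "co2 g n (const2 (gen (G Xm)) ^ j) k = (if j = k then 1 else 0)"
    by (simp only: co2_def R rep_gen gen_op2.simps) (simp add: fps_const_power shift_power_hw fps_eq_iff)
  show "co2 g n (fps_map2 scal r * a) k = r * co2 g n a k" by (simp add: co2_def R rep_scal fps_map2_scale)
qed

lemma keys_subset_iff:
  fixes p :: "nat \<Rightarrow>\<^sub>0 complex"
  shows "Poly_Mapping.keys p \<subseteq> {n + 1..} \<longleftrightarrow> (\<forall>k\<le>n. Poly_Mapping.lookup p k = 0)"
proof -
  have "Poly_Mapping.keys p \<subseteq> {n + 1..} \<longleftrightarrow> (\<forall>k. \<not> n + 1 \<le> k \<longrightarrow> k \<notin> Poly_Mapping.keys p)" by auto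
  moreover have "\<not> n + 1 \<le> (k :: nat) \<longleftrightarrow> k \<le> n" for k by auto
  ultimately show ?thesis by (simp only: in_keys_iff not_not)
qed

lemma V0_eq: "V0.A = Usl" "V0.q = U_class" "V0.M n = Verma n" "V0.mc n = M_class n" "V0.N n = M_sub n" "V0.W n = Lrep n"
proof -
  show *: "V0.A = Usl" "V0.q = U_class" "V0.M n = Verma n" "V0.mc n = M_class n"
    by (auto simp: V0.A_def V0.q_def V0.M_def V0.mc_def Usl_def U_class_def fun_eq_iff Verma_def M_class_def)
  show "V0.N n = M_sub n"
    unfolding V0.N_def M_sub_def unfolding * keys_subset_iff T0_def by (auto simp: co_lin_ext_Xm)
  thus "V0.W n = Lrep n" by (simp add: V0.W_def Lrep_def *)
qed

lemma V1_eq: "V1.A = Uh" "V1.q = Uh_class" "V1.M n = Verma_h n" "V1.mc n = Mh_class n" "V1.N n = Mh_sub n" "V1.W n = Lrep_h n"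
proof -
  show *: "V1.A = Uh" "V1.q = Uh_class" "V1.M n = Verma_h n" "V1.mc n = Mh_class n"
    by (auto simp: V1.A_def V1.q_def V1.M_def V1.mc_def Uh_def Uh_class_def fun_eq_iff Verma_h_def Mh_class_def)
  have "(\<forall>k\<le>n. co1 n (fps_map (poly_in (gen Xm)) p) k = 0) \<longleftrightarrow> (\<forall>i. \<forall>k\<le>n. Poly_Mapping.lookup (p $ i) k = 0)" for p
    unfolding co_lin_ext_Xm fps_eq_iff by auto
  thus "V1.N n = Mh_sub n"
    unfolding V1.N_def Mh_sub_def unfolding * keys_subset_iff T1_def by auto
  thus "V1.W n = Lrep_h n" by (simp add: V1.W_def Lrep_h_def *)
qed

lemma V2_eq: "V2.A g = Uhh g" "V2.q g = Uhh_class g" "V2.M g n = Verma_hh n g" "V2.mc g n = Mhh_class n g"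
  "V2.N g n = Mhh_sub n g" "V2.W g n = Lrep_hh n g"
proof -
  show *: "V2.A g = Uhh g" "V2.q g = Uhh_class g" "V2.M g n = Verma_hh n g" "V2.mc g n = Mhh_class n g"
    by (auto simp: V2.A_def V2.q_def V2.M_def V2.mc_def Uhh_def Uhh_class_def fun_eq_iff Verma_hh_def Mhh_class_def Uhh_gen_def)
  have "(\<forall>k\<le>n. co2 g n (fps_map2 (poly_in (gen (G Xm))) p) k = 0) \<longleftrightarrow>
      (\<forall>i j. \<forall>k\<le>n. Poly_Mapping.lookup (p $ j $ i) k = 0)" for p
    unfolding co_lin_ext_Xm fps_eq_iff by auto
  thus "V2.N g n = Mhh_sub n g"
    unfolding V2.N_def Mhh_sub_def unfolding * keys_subset_iff T2_def by auto
  thus "V2.W g n = Lrep_hh n g" by (simp add: V2.W_def Lrep_hh_def *)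
qed

section \<open>The finite quotients\<close>

definition coordL :: "nat \<Rightarrow> _ \<Rightarrow> nat \<Rightarrow> complex" where "coordL n = V0.cw n"
definition coordLh :: "nat \<Rightarrow> _ \<Rightarrow> nat \<Rightarrow> complex fps" where "coordLh n = V1.cw n"
definition coordLhh :: "nat \<Rightarrow> nat \<Rightarrow> _ \<Rightarrow> nat \<Rightarrow> complex fps fps" where "coordLhh g n = V2.cw g n"

lemma coord_module_L: "coord_module n (over_C (Lrep n)) (coordL n)"
proof -
  have "U_scal = (\<lambda>r. V0.q (scal r))" by (simp add: fun_eq_iff U_scal_def V0_eq)
  thus ?thesis using V0.coord_module_W[of n] by (simp only: V0_eq coordL_def)
qed

lemma coord_module_Lh: "coord_module n (over_Ch (Lrep_h n)) (coordLh n)"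
proof -
  have "Uh_scal = (\<lambda>r. V1.q (fps_map scal r))" by (simp add: fun_eq_iff Uh_scal_def V1_eq)
  thus ?thesis using V1.coord_module_W[of n] by (simp only: V1_eq coordLh_def)
qed

lemma Uhh_scal_eq: "Uhh_scal g = (\<lambda>r. V2.q g (fps_map2 scal r))"
  by (simp add: fun_eq_iff Uhh_scal_def V2_eq)

lemma coord_module_Lhh: "coord_module n (over_Chh g (Lrep_hh n g)) (coordLhh g n)"
  using V2.coord_module_W[of n g] unfolding Uhh_scal_eq by (simp only: V2_eq coordLhh_def)

interpretation L0: coord_module n "over_C (Lrep n)" "coordL n" for n by (rule coord_module_L)
interpretation L1: coord_module n "over_Ch (Lrep_h n)" "coordLh n" for n by (rule coord_module_Lh)
interpretation L2: coord_module n "over_Chh g (Lrep_hh n g)" "coordLhh g n" for g n by (rule coord_module_Lhh)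

lemma restrict_scalars_simps: "carrier (restrict_scalars \<eta> M) = carrier M" "zero (restrict_scalars \<eta> M) = zero M"
  "add (restrict_scalars \<eta> M) = add M" "c \<odot>\<^bsub>restrict_scalars \<eta> M\<^esub> x = \<eta> c \<odot>\<^bsub>M\<^esub> x"
  by (simp_all add: restrict_scalars_def)

lemma vec_eq: "L_vec n j = V0.cls n (gen Xm ^ j)" "Lh_vec n j = V1.cls n (fps_const (gen Xm) ^ j)"
  "Lhh_vec n g j = V2.cls g n (const2 (gen (G Xm)) ^ j)"
  unfolding L_vec_def Lh_vec_def Lhh_vec_def Uhh_gen_def
  using V0.cls_Y[of n j] V1.cls_Y[of n j] V2.cls_Y[of g n j] by (simp_all only: V0_eq V1_eq V2_eq)

lemma carriers: "carrier (Lrep n) = range (V0.cls n)" "carrier (Lrep_h n) = range (V1.cls n)"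
  "carrier (Lrep_hh n g) = range (V2.cls g n)"
  using V0.carrier_W V1.carrier_W V2.carrier_W by (simp_all only: V0_eq V1_eq V2_eq)

lemma vec_carrier: "L_vec n j \<in> carrier (Lrep n)" "Lh_vec n j \<in> carrier (Lrep_h n)" "Lhh_vec n g j \<in> carrier (Lrep_hh n g)"
  by (auto simp: vec_eq carriers)

lemma coord_vec: "k \<le> n \<Longrightarrow> coordL n (L_vec n j) k = (if j = k then 1 else 0)"
  "k \<le> n \<Longrightarrow> coordLh n (Lh_vec n j) k = (if j = k then 1 else 0)"
  "k \<le> n \<Longrightarrow> coordLhh g n (Lhh_vec n g j) k = (if j = k then 1 else 0)"
  by (simp_all add: vec_eq coordL_def coordLh_def coordLhh_def V0.cw_cls V1.cw_cls V2.cw_cls V0.co_Y V1.co_Y V2.co_Y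
      del: fps_const_power)

lemma coord_cls: "k \<le> n \<Longrightarrow> coordL n (V0.cls n a) k = co0 n a k" "k \<le> n \<Longrightarrow> coordLh n (V1.cls n b) k = co1 n b k"
  "k \<le> n \<Longrightarrow> coordLhh g n (V2.cls g n d) k = co2 g n d k"
  by (simp_all add: coordL_def coordLh_def coordLhh_def V0.cw_cls V1.cw_cls V2.cw_cls)

lemma cls_smult: "U_class a \<odot>\<^bsub>Lrep n\<^esub> V0.cls n b = V0.cls n (a * b)"
  "Uh_class a' \<odot>\<^bsub>Lrep_h n\<^esub> V1.cls n b' = V1.cls n (a' * b')"
  "Uhh_class g a'' \<odot>\<^bsub>Lrep_hh n g\<^esub> V2.cls g n b'' = V2.cls g n (a'' * b'')"
  using V0.cls_smult[of n a b] V1.cls_smult[of n a' b'] V2.cls_smult[of g n a'' b'']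
  by (simp_all only: V0_eq V1_eq V2_eq)

lemma left_modules: "left_module Usl (Lrep n)" "left_module Uh (Lrep_h n)" "left_module (Uhh g) (Lrep_hh n g)"
  using V0.W_left_module[of n] V1.W_left_module[of n] V2.W_left_module[of g n] by (simp_all only: V0_eq V1_eq V2_eq)

subsection \<open>Identification of the underlying modules\<close>

text \<open>The maps that preserve coordinates, where the coordinates of a series of vectors are the series of
  their coordinates.\<close>

definition chi :: "nat \<Rightarrow> (nat \<Rightarrow> _) \<Rightarrow> _" where "chi n f = L1.mk n (series_co (coordL n) f)"
definition psi :: "nat \<Rightarrow> nat \<Rightarrow> (nat \<Rightarrow> _) \<Rightarrow> _" where "psi g n f = L2.mk n g (series_co (coordLh n) f)"
definition phi :: "nat \<Rightarrow> nat \<Rightarrow> (nat \<Rightarrow> nat \<Rightarrow> _) \<Rightarrow> _" where "phi g n f = psi g n (\<lambda>j. chi n (f j))"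

lemma chi: "chi n f \<in> carrier (Lrep_h n)" "k \<le> n \<Longrightarrow> coordLh n (chi n f) k = series_co (coordL n) f k"
  using L1.mk[where n = n] by (simp_all add: chi_def restrict_scalars_simps)

lemma psi: "psi g n f \<in> carrier (Lrep_hh n g)" "k \<le> n \<Longrightarrow> coordLhh g n (psi g n f) k = series_co (coordLh n) f k"
  using L2.mk[where n = n and g = g] by (simp_all add: psi_def restrict_scalars_simps)

lemma phi: "phi g n f \<in> carrier (Lrep_hh n g)" "k \<le> n \<Longrightarrow> coordLhh g n (phi g n f) k = series_co (series_co (coordL n)) f k"
  by (simp_all add: phi_def psi chi fps_eq_iff)

lemma chi_iso: "chi n \<in> module_iso (series_module (over_C (Lrep n))) (over_Ch (Lrep_h n))"
  by (rule coord_module_isoI[OF coord_module_series[OF coord_module_L] coord_module_Lh]) (auto simp: chi restrict_scalars_simps)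

lemma psi_iso: "psi g n \<in> module_iso (series_module (over_Ch (Lrep_h n))) (over_Chh g (Lrep_hh n g))"
  by (rule coord_module_isoI[OF coord_module_series[OF coord_module_Lh] coord_module_Lhh]) (auto simp: psi restrict_scalars_simps)

lemma phi_iso: "phi g n \<in> module_iso (series_module (series_module (over_C (Lrep n)))) (over_Chh g (Lrep_hh n g))"
  by (rule coord_module_isoI[OF coord_module_series[OF coord_module_series[OF coord_module_L]] coord_module_Lhh])
     (auto simp: phi restrict_scalars_simps)

lemma const_series_co: "coord_module n V co \<Longrightarrow> k \<le> n \<Longrightarrow> series_co co (const_series V v) k = fps_const (co v k)"
  by (simp add: fps_eq_iff const_series_def coord_module.co_zero)

lemma chi_vec: "chi n (const_series (over_C (Lrep n)) (L_vec n j)) = Lh_vec n j"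
  by (rule L1.co_inj[where n = n])
     (simp_all add: chi vec_carrier restrict_scalars_simps const_series_co[OF coord_module_L] coord_vec)

lemma psi_vec: "psi g n (const_series (over_Ch (Lrep_h n)) (Lh_vec n j)) = Lhh_vec n g j"
  by (rule L2.co_inj[where g = g and n = n])
     (simp_all add: psi vec_carrier restrict_scalars_simps const_series_co[OF coord_module_Lh] coord_vec)

lemma phi_vec: "phi g n (const_series (series_module (over_C (Lrep n))) (const_series (over_C (Lrep n)) (L_vec n j)))
              = Lhh_vec n g j"
  by (rule L2.co_inj[where g = g and n = n])
     (simp_all add: phi vec_carrier restrict_scalars_simps const_series_co[OF coord_module_L]
       const_series_co[OF coord_module_series[OF coord_module_L]] coord_vec)

subsection \<open>Representations and deformations\<close>

lemma representation_hh_L: "representation_hh g (over_C (Lrep n)) (Lrep_hh n g) (phi g n)"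
  unfolding representation_hh_def
proof (intro conjI ballI)
  fix x assume "x \<in> carrier (Uhh g)"
  thus "(\<lambda>w. x \<odot>\<^bsub>Lrep_hh n g\<^esub> w) \<in> LinearCombinations.module_hom type_ring (over_Chh g (Lrep_hh n g)) (over_Chh g (Lrep_hh n g))"
    using V2.action_linear[of x g n] unfolding Uhh_scal_eq by (simp only: V2_eq)
qed (intro coord_module_dim(1)[OF coord_module_L] left_modules phi_iso)+

lemma representation_h_L: "representation_h (over_C (Lrep n)) (Lrep_h n) (chi n)"
  unfolding representation_h_def
proof (intro conjI ballI)
  have e: "Uh_scal = (\<lambda>r. V1.q (fps_map scal r))" by (simp add: fun_eq_iff Uh_scal_def V1_eq)
  fix x assume "x \<in> carrier Uh"
  thus "(\<lambda>w. x \<odot>\<^bsub>Lrep_h n\<^esub> w) \<in> LinearCombinations.module_hom type_ring (over_Ch (Lrep_h n)) (over_Ch (Lrep_h n))"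
    using V1.action_linear[of x n] unfolding e by (simp only: V1_eq)
qed (intro coord_module_dim(1)[OF coord_module_L] left_modules chi_iso)+

text \<open>Reduction modulo $h'$ of the product of $b$ with a vector, when $b$ and the vector reduce to $b'$ and to the
  class of $a'$.\<close>

lemma co2_mult_nth0:
  assumes "rep2 g n b $ 0 = rep1 n b'"
    and "\<And>k. k \<le> n \<Longrightarrow> (co2 g n a k) $ 0 = co1 n a' k" and "k \<le> n"
  shows "(co2 g n (b * a) k) $ 0 = co1 n (b' * a') k"
proof -
  have "(co2 g n (b * a) k) $ 0 = fps_map (ev hw k) (rep1 n b' * rep2 g n a $ 0)"
    by (simp add: co2_def ring_mapD[OF ring_map_rep(3)] assms(1))
  also have "\<dots> = fps_map (ev hw k) (rep1 n b' * rep1 n a')"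
    using assms(2) by (intro pres1_cong[of n] pres_rep assms(3)) (simp add: co2_def co1_def)
  finally show ?thesis by (simp add: co1_def ring_mapD[OF ring_map_rep(2)])
qed

lemma co1_mult_nth0:
  assumes "rep1 n b $ 0 = rep0 n b'"
    and "\<And>k. k \<le> n \<Longrightarrow> (co1 n a k) $ 0 = co0 n a' k" and "k \<le> n"
  shows "(co1 n (b * a) k) $ 0 = co0 n (b' * a') k"
proof -
  have "(co1 n (b * a) k) $ 0 = app (rep0 n b') (app (rep1 n a $ 0) hw) k"
    by (simp add: co1_def ring_mapD[OF ring_map_rep(2)] assms(1))
  also have "\<dots> = app (rep0 n b') (app (rep0 n a') hw) k"
    using assms(2) by (intro pres_cong[of n] pres_rep assms(3)) (simp add: co1_def co0_def)
  finally show ?thesis by (simp add: co0_def ring_mapD[OF ring_map_rep(1)])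
qed

lemma deformation_h'_L:
  "deformation_along_h' g (over_C (Lrep n)) (Lrep_h n) (Lrep_hh n g) (chi n) (psi g n)"
  unfolding deformation_along_h'_def
proof (intro conjI allI ballI impI)
  show "representation_h (over_C (Lrep n)) (Lrep_h n) (chi n)" by (rule representation_h_L)
  show "representation_hh g (over_C (Lrep n)) (Lrep_hh n g) (\<lambda>f. psi g n (\<lambda>j. chi n (f j)))"
    using representation_hh_L[of g n] by (simp add: phi_def[abs_def])
  show "psi g n \<in> module_iso (series_module (over_Ch (Lrep_h n))) (over_Chh g (Lrep_hh n g))" by (rule psi_iso)
  fix p f f'
  assume f: "f \<in> carrier (series_module (over_Ch (Lrep_h n)))" and f': "f' \<in> carrier (series_module (over_Ch (Lrep_h n)))"
    and eq: "psi g n f' = Uhh_pbw g p \<odot>\<^bsub>Lrep_hh n g\<^esub> psi g n f"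
  let ?p2 = "fps_map2 (lin_ext pbw4) p" and ?p1 = "fps_map (lin_ext pbw3) (p $ 0)"
  have "f 0 \<in> carrier (Lrep_h n)" "f' 0 \<in> carrier (Lrep_h n)"
    using f f' by (auto simp: series_module_def restrict_scalars_simps)
  then obtain b b' where b: "f 0 = V1.cls n b" "f' 0 = V1.cls n b'" unfolding carriers by blast
  obtain a where a: "psi g n f = V2.cls g n a" using psi(1)[of g n f] unfolding carriers by blast
  have "psi g n f' = V2.cls g n (?p2 * a)" unfolding eq a Uhh_pbw_def by (rule cls_smult)
  hence "(co2 g n (?p2 * a) k) $ 0 = co1 n b' k" if "k \<le> n" for k
    using that psi(2)[of k n g f'] by (simp add: b coord_cls)
  moreover have "co2 g n a k $ 0 = co1 n b k" if "k \<le> n" for k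
    using that psi(2)[of k n g f] by (simp add: a b coord_cls)
  ultimately have "co1 n b' k = co1 n (?p1 * b) k" if "k \<le> n" for k
    using that co2_mult_nth0[OF rep2_pbw_nth0, of n g a b k p] by simp
  hence "V1.cls n b' = V1.cls n (?p1 * b)" by (simp add: V1.cls_eq_iff)
  thus "f' 0 = Uh_pbw (p $ 0) \<odot>\<^bsub>Lrep_h n\<^esub> f 0" by (simp only: b Uh_pbw_def cls_smult)
qed

text \<open>Reduction modulo $(h,h')$ is reduction modulo $h'$ followed by reduction modulo $h$, so the first step
  is the deformation along $h'$.\<close>

lemma deformation_hh_L: "deformation_along_hh g (Lrep n) (Lrep_hh n g) (phi g n)"
  unfolding deformation_along_hh_def
proof (intro conjI allI ballI impI)
  show "left_module Usl (Lrep n)" by (rule left_modules)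
  show "representation_hh g (over_C (Lrep n)) (Lrep_hh n g) (phi g n)" by (rule representation_hh_L)
  fix p f f'
  assume f: "f \<in> carrier (series_module (series_module (over_C (Lrep n))))"
    and f': "f' \<in> carrier (series_module (series_module (over_C (Lrep n))))"
    and eq: "phi g n f' = Uhh_pbw g p \<odot>\<^bsub>Lrep_hh n g\<^esub> phi g n f"
  let ?p1 = "fps_map (lin_ext pbw3) (p $ 0)" and ?p0 = "lin_ext pbw3 (p $ 0 $ 0)"
  have "f 0 0 \<in> carrier (Lrep n)" "f' 0 0 \<in> carrier (Lrep n)"
    using f f' by (auto simp: series_module_def restrict_scalars_simps)
  then obtain b b' where b: "f 0 0 = V0.cls n b" "f' 0 0 = V0.cls n b'" unfolding carriers by blast
  have ser: "(\<lambda>j. chi n (F j)) \<in> carrier (series_module (over_Ch (Lrep_h n)))" for F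
    by (auto simp: series_module_def restrict_scalars_simps chi)
  have "chi n (f' 0) = Uh_pbw (p $ 0) \<odot>\<^bsub>Lrep_h n\<^esub> chi n (f 0)"
    using deformation_h'_L[of g n] ser[of f] ser[of f'] eq
    unfolding deformation_along_h'_def phi_def by blast
  moreover obtain a where a: "chi n (f 0) = V1.cls n a" using chi(1)[of n "f 0"] unfolding carriers by blast
  ultimately have "chi n (f' 0) = V1.cls n (?p1 * a)" by (simp only: Uh_pbw_def cls_smult)
  hence "(co1 n (?p1 * a) k) $ 0 = co0 n b' k" if "k \<le> n" for k
    using that chi(2)[of k n "f' 0"] by (simp add: b coord_cls)
  moreover have "co1 n a k $ 0 = co0 n b k" if "k \<le> n" for k
    using that chi(2)[of k n "f 0"] by (simp add: a b coord_cls)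
  ultimately have "co0 n b' k = co0 n (?p0 * b) k" if "k \<le> n" for k
    using that co1_mult_nth0[OF rep1_pbw_nth0, of n a b k "p $ 0"] by simp
  hence "V0.cls n b' = V0.cls n (?p0 * b)" by (simp add: V0.cls_eq_iff)
  thus "f' 0 0 = U_pbw (p $ 0 $ 0) \<odot>\<^bsub>Lrep n\<^esub> f 0 0" by (simp only: b U_pbw_def cls_smult)
qed

subsection \<open>Irreducibility\<close>

lemma lower_power: "app (lower a ^ p) u k = (\<Prod>i = Suc k..k + p. a i) * u (k + p)"
proof (induction p arbitrary: k)
  case (Suc p)
  have "(\<Prod>i = Suc k..k + Suc p. a i) = a (Suc k) * (\<Prod>i = Suc (Suc k)..Suc k + p. a i)"
    by (subst prod.atLeast_Suc_atMost) auto
  thus ?case by (simp add: Suc)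
qed simp

text \<open>If $p$ is the largest index with a nonzero coordinate, then $(X^+)^p$ sends the vector to a multiple
  of $m_0$. The multiple is nonzero because $j(n-j+1) \neq 0$ for $1 \<le> j \<le> n$.\<close>

lemma irreducible_L: "irreducible_module Usl (Lrep n)"
  unfolding irreducible_module_def
proof (intro conjI allI impI)
  show LM: "left_module Usl (Lrep n)" by (rule left_modules)
  have z: "\<zero>\<^bsub>Lrep n\<^esub> = V0.cls n 0"
  proof -
    interpret left_module Usl "Lrep n" by (rule LM)
    have "V0.cls n 0 \<in> carrier (Lrep n)" by (auto simp: carriers)
    moreover have "V0.cls n 0 \<oplus>\<^bsub>Lrep n\<^esub> V0.cls n 0 = V0.cls n 0" using V0.cls_add[of n 0 0] by (simp add: V0_eq)
    ultimately show ?thesis by simp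
  qed
  show "carrier (Lrep n) \<noteq> {\<zero>\<^bsub>Lrep n\<^esub>}"
  proof
    assume "carrier (Lrep n) = {\<zero>\<^bsub>Lrep n\<^esub>}"
    hence "L_vec n 0 = V0.cls n 0" using vec_carrier(1)[of n 0] z by auto
    thus False using coord_vec(1)[of 0 n 0] V0.co_0[of 0 n] by (simp add: coord_cls)
  qed
  fix N assume N: "Module.submodule N Usl (Lrep n)"
  have N_closed: "V0.cls n (a * b) \<in> N" if "V0.cls n b \<in> N" for a b
    using Module.submodule.smult_closed[OF N, of "U_class a" "V0.cls n b"] that V0.q_simps(1)[of a]
    by (simp add: cls_smult V0_eq)
  have N_sub: "N \<subseteq> carrier (Lrep n)" "\<zero>\<^bsub>Lrep n\<^esub> \<in> N"
    using Module.submodule.axioms(1)[OF N] subgroup.subset subgroup.one_closed by fastforce+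
  show "N = {\<zero>\<^bsub>Lrep n\<^esub>} \<or> N = carrier (Lrep n)"
  proof (cases "N = {\<zero>\<^bsub>Lrep n\<^esub>}")
    case False
    then obtain x where "x \<in> N" "x \<noteq> \<zero>\<^bsub>Lrep n\<^esub>" using N_sub by blast
    then obtain a where a: "V0.cls n a \<in> N" "V0.cls n a \<noteq> V0.cls n 0" using N_sub(1) z unfolding carriers by blast
    define u where "u = app (rep0 n a) hw"
    have u: "co0 n a k = u k" for k by (simp add: u_def co0_def)
    have "\<exists>k. k \<le> n \<and> u k \<noteq> 0" using a(2) V0.co_0[of _ n] by (auto simp: V0.cls_eq_iff u)
    define p where "p = Max {k. k \<le> n \<and> u k \<noteq> 0}"
    have fin: "finite {k. k \<le> n \<and> u k \<noteq> 0}" by simp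
    hence p: "p \<le> n" "u p \<noteq> 0"
      using Max_in[OF fin] \<open>\<exists>k. k \<le> n \<and> u k \<noteq> 0\<close> unfolding p_def by blast+
    have max: "u k = 0" if "p < k" "k \<le> n" for k
      using Max_ge[OF fin, of k] that unfolding p_def by fastforce
    define D where "D = (\<Prod>i = Suc 0..p. xp0 n i)"
    have "xp0 n i \<noteq> 0" if "i \<in> {Suc 0..p}" for i
    proof -
      have "of_nat (n - i) = (of_nat n - of_nat i :: complex)" using that p(1) by (simp add: of_nat_diff)
      hence "xp0 n i = of_nat (i * (n - i + 1))" by (simp only: xp0_def of_nat_mult of_nat_add of_nat_1)
      moreover have "i * (n - i + 1) \<noteq> 0" using that by auto
      ultimately show ?thesis by (simp only: of_nat_eq_0_iff not_False_eq_True)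
    qed
    hence D: "D \<noteq> 0" by (simp add: D_def)
    let ?e = "scal (1 / (D * u p)) * gen Xp ^ p"
    have "co0 n (?e * a) k = co0 n 1 k" if "k \<le> n" for k
    proof -
      have "co0 n (?e * a) k = 1 / (D * u p) * ((\<Prod>i = Suc k..k + p. xp0 n i) * u (k + p))"
        by (simp add: co0_def ring_mapD[OF ring_map_rep(1)] rep_gen rep_scal lower_power u_def)
      also have "\<dots> = (if k = 0 then 1 else 0)"
      proof (cases "k = 0")
        case True
        thus ?thesis using D p by (simp add: D_def)
      next
        case False
        have "(\<Prod>i = Suc k..k + p. xp0 n i) * u (k + p) = 0"
        proof (cases "k + p \<le> n")
          case True
          thus ?thesis using max[of "k + p"] False by simp
        next
          case False
          \<comment> \<open>The vector is pushed through $m_{n+1}$, where the coefficient of $X^+$ vanishes.\<close>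
          hence "Suc n \<in> {Suc k..k + p}" using that by auto
          thus ?thesis using xp_Suc_n(1)[of n] by (auto simp: prod_zero_iff)
        qed
        thus ?thesis using False by simp
      qed
      also have "\<dots> = co0 n 1 k" using V0.co_Y[OF that, of 0] by auto
      finally show ?thesis .
    qed
    hence "V0.cls n 1 = V0.cls n (?e * a)" by (simp add: V0.cls_eq_iff)
    hence "V0.cls n 1 \<in> N" using N_closed[OF a(1)] by simp
    hence "V0.cls n b \<in> N" for b using N_closed[of 1 b] by simp
    thus ?thesis using N_sub by (auto simp: carriers)
  qed simp
qed

subsection \<open>The action on the basis\<close>

abbreviation "gen_act n g y x \<equiv> Uhh_gen g y \<odot>\<^bsub>Lrep_hh n g\<^esub> x"
abbreviation "scal_act n g r x \<equiv> Uhh_scal g r \<odot>\<^bsub>Lrep_hh n g\<^esub> x"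
abbreviation "zeroL n g \<equiv> \<zero>\<^bsub>Lrep_hh n g\<^esub>"

lemma coordLhh_smult: "x \<in> carrier (Lrep_hh n g) \<Longrightarrow> k \<le> n \<Longrightarrow> coordLhh g n (scal_act n g r x) k = r * coordLhh g n x k"
  using L2.co_smult[where g = g and n = n and x = x and k = k and c = r] by (simp add: restrict_scalars_simps)

lemma Lhh_smult_carrier: "x \<in> carrier (Lrep_hh n g) \<Longrightarrow> scal_act n g r x \<in> carrier (Lrep_hh n g)"
  using L2.smult_carrier[where g = g and n = n and x = x and c = r] by (simp add: restrict_scalars_simps)

lemma Lhh_gen_carrier: "x \<in> carrier (Lrep_hh n g) \<Longrightarrow> gen_act n g y x \<in> carrier (Lrep_hh n g)"
  unfolding carriers Uhh_gen_def by (auto simp: cls_smult)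

lemma Lhh_eqI:
  assumes "x \<in> carrier (Lrep_hh n g)" "y \<in> carrier (Lrep_hh n g)" "\<And>k. k \<le> n \<Longrightarrow> coordLhh g n x k = coordLhh g n y k"
  shows "x = y"
  using L2.co_inj[where g = g and n = n and x = x and y = y] assms by (simp add: restrict_scalars_simps)

lemma coordLhh_zero: "k \<le> n \<Longrightarrow> coordLhh g n (zeroL n g) k = 0"
  using L2.co_zero[where g = g and n = n and k = k] by (simp add: restrict_scalars_simps)

lemma Lhh_zero_carrier: "(zeroL n g) \<in> carrier (Lrep_hh n g)"
  using L2.zero_closed[where g = g and n = n] by (simp add: restrict_scalars_simps)

lemma coordLhh_finsum:
  assumes "finite S" "\<And>i. i \<in> S \<Longrightarrow> f i \<in> carrier (Lrep_hh n g)" "k \<le> n"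
  shows "coordLhh g n (\<Oplus>\<^bsub>Lrep_hh n g\<^esub>i\<in>S. f i) k = (\<Sum>i\<in>S. coordLhh g n (f i) k)"
  using L2.co_finsum[where g = g and n = n and S = S and f = f and k = k] assms by (simp add: restrict_scalars_simps finsum_restrict_scalars)

lemma Lhh_finsum_carrier:
  assumes "\<And>i. i \<in> S \<Longrightarrow> f i \<in> carrier (Lrep_hh n g)"
  shows "(\<Oplus>\<^bsub>Lrep_hh n g\<^esub>i\<in>S. f i) \<in> carrier (Lrep_hh n g)"
proof -
  interpret left_module "Uhh g" "Lrep_hh n g" by (rule left_modules)
  show ?thesis using assms by (intro finsum_closed) auto
qed

lemma coordLhh_H:
  assumes "x \<in> carrier (Lrep_hh n g)" "k \<le> n"
  shows "coordLhh g n (gen_act n g (G Hg) x) k = of_int (int n - 2 * int k) * coordLhh g n x k"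
proof -
  obtain a where a: "x = V2.cls g n a" using assms(1) by (auto simp: carriers)
  have *: "of_int (int n - 2 * int k) = const2 (wtH n k)"
    by (simp add: wtH_def ring_mapD[OF ring_map_const2])
  show ?thesis using assms(2) unfolding *
    by (simp add: a Uhh_gen_def cls_smult coord_cls co2_def ring_mapD[OF ring_map_rep(3)] rep_gen fps_eq_iff)
qed

lemma coordLhh_gen_vec:
  assumes "k \<le> n"
  shows "coordLhh g n (gen_act n g y (Lhh_vec n g j)) k =
    fps_map2 (ev (\<lambda>i. if i = j then 1 else 0) k) (gen_op2 g n y)"
proof -
  have "coordLhh g n (gen_act n g y (Lhh_vec n g j)) k =
      fps_map2 (ev hw k) (gen_op2 g n y * const2 (shift ^ j))"
    using assms by (simp add: vec_eq Uhh_gen_def cls_smult coord_cls co2_def ring_mapD[OF ring_map_rep(3)] rep_gen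
        ring_mapD(7)[OF ring_map_const2] del: fps_const_power fps_const_mult)
  thus ?thesis by (simp add: fps_eq_iff shift_power_hw)
qed

lemma of_int_fps2_eq_iff: "(of_int a :: complex fps fps) = of_int b \<longleftrightarrow> a = b"
proof
  assume "(of_int a :: complex fps fps) = of_int b"
  hence "const2 (of_int a :: complex) = const2 (of_int b)" by (simp only: ring_mapD(9)[OF ring_map_const2])
  from arg_cong[OF this, of "\<lambda>f. f $ 0 $ 0"] show "a = b"
    by (simp only: fps_nth_fps_const if_True of_int_eq_iff simp_thms)
qed simp

text \<open>$H$ has the pairwise distinct eigenvalues $n-2k$ on the $m_k$, so an eigenvector for $m$ has no component at
  $m_k$ unless $m = n-2k$.\<close>

lemma weight_space_iff:
  "x \<in> weight_space g (Lrep_hh n g) m \<longleftrightarrow>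
    x \<in> carrier (Lrep_hh n g) \<and> (\<forall>k\<le>n. m \<noteq> int n - 2 * int k \<longrightarrow> coordLhh g n x k = 0)"
proof (cases "x \<in> carrier (Lrep_hh n g)")
  case True
  have "gen_act n g (G Hg) x = scal_act n g (of_int m) x \<longleftrightarrow>
     (\<forall>k\<le>n. of_int (int n - 2 * int k) * coordLhh g n x k = of_int m * coordLhh g n x k)" (is "?l = ?r \<longleftrightarrow> _")
  proof
    assume "?l = ?r"
    hence eq: "coordLhh g n ?l k = coordLhh g n ?r k" for k by simp
    show "\<forall>k\<le>n. of_int (int n - 2 * int k) * coordLhh g n x k = of_int m * coordLhh g n x k"
    proof (intro allI impI)
      fix k assume "k \<le> n"
      thus "of_int (int n - 2 * int k) * coordLhh g n x k = of_int m * coordLhh g n x k"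
        using eq[of k] True by (simp only: coordLhh_H coordLhh_smult)
    qed
  next
    assume "\<forall>k\<le>n. of_int (int n - 2 * int k) * coordLhh g n x k = of_int m * coordLhh g n x k"
    thus "?l = ?r" using True by (intro Lhh_eqI[where g = g and n = n] Lhh_gen_carrier Lhh_smult_carrier) (simp_all only: coordLhh_H coordLhh_smult)
  qed
  hence "?l = ?r \<longleftrightarrow> (\<forall>k\<le>n. m \<noteq> int n - 2 * int k \<longrightarrow> coordLhh g n x k = 0)"
    by (simp only: mult_cancel_right of_int_fps2_eq_iff) metis
  thus ?thesis using True unfolding weight_space_def by blast
qed (simp add: weight_space_def)

lemma weight_L: "weight_representation g (Lrep_hh n g)"
  unfolding weight_representation_def is_direct_sum_def
proof (intro conjI allI ballI)
  let ?W = "weight_space g (Lrep_hh n g)" and ?L = "Lrep_hh n g"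
  show "?W m \<subseteq> carrier ?L" for m by (auto simp: weight_space_def)
  fix x assume x: "x \<in> carrier ?L"
  have single: "coordLhh g n (\<Oplus>\<^bsub>?L\<^esub> m\<in>{m. f m \<noteq> \<zero>\<^bsub>?L\<^esub>}. f m) k = coordLhh g n (f (int n - 2 * int k)) k"
    if f: "\<forall>m. f m \<in> ?W m" "finite {m. f m \<noteq> \<zero>\<^bsub>?L\<^esub>}" and k: "k \<le> n" for f k
  proof -
    have fc: "f m \<in> carrier ?L" for m using f(1) by (simp add: weight_space_iff)
    have "coordLhh g n (\<Oplus>\<^bsub>?L\<^esub> m\<in>{m. f m \<noteq> \<zero>\<^bsub>?L\<^esub>}. f m) k = (\<Sum>m\<in>{m. f m \<noteq> \<zero>\<^bsub>?L\<^esub>}. coordLhh g n (f m) k)"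
      using f(2) k fc by (intro coordLhh_finsum) auto
    also have "\<dots> = (\<Sum>m\<in>{m. f m \<noteq> \<zero>\<^bsub>?L\<^esub>}. if m = int n - 2 * int k then coordLhh g n (f (int n - 2 * int k)) k else 0)"
      using f(1) k by (intro sum.cong) (auto simp: weight_space_iff)
    also have "\<dots> = coordLhh g n (f (int n - 2 * int k)) k" using f(2) k by (auto simp: coordLhh_zero)
    finally show ?thesis .
  qed
  \<comment> \<open>The weight components of $x$.\<close>
  define F where "F m = L2.mk n g (\<lambda>k. if m = int n - 2 * int k then coordLhh g n x k else 0)" for m
  have F: "F m \<in> carrier ?L" "k \<le> n \<Longrightarrow> coordLhh g n (F m) k = (if m = int n - 2 * int k then coordLhh g n x k else 0)" for m k
    using L2.mk[where g = g and n = n] by (simp_all add: F_def restrict_scalars_simps)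
  show "\<exists>!f. (\<forall>m. f m \<in> ?W m) \<and> finite {m. f m \<noteq> \<zero>\<^bsub>?L\<^esub>} \<and> x = (\<Oplus>\<^bsub>?L\<^esub> m\<in>{m. f m \<noteq> \<zero>\<^bsub>?L\<^esub>}. f m)"
  proof (rule ex1I[of _ F], intro conjI allI)
    show W: "F m \<in> ?W m" for m by (simp add: weight_space_iff F)
    have "F m = \<zero>\<^bsub>?L\<^esub>" if "m \<notin> (\<lambda>k. int n - 2 * int k) ` {..n}" for m
      using that by (intro Lhh_eqI[where g = g and n = n]) (auto simp: F Lhh_zero_carrier coordLhh_zero)
    hence "{m. F m \<noteq> \<zero>\<^bsub>?L\<^esub>} \<subseteq> (\<lambda>k. int n - 2 * int k) ` {..n}" by blast
    thus fin: "finite {m. F m \<noteq> \<zero>\<^bsub>?L\<^esub>}" by (rule finite_subset) simp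
    show "x = (\<Oplus>\<^bsub>?L\<^esub> m\<in>{m. F m \<noteq> \<zero>\<^bsub>?L\<^esub>}. F m)"
      using x W fin by (intro Lhh_eqI[OF x] Lhh_finsum_carrier) (auto simp: F single)
  next
    fix f assume f: "(\<forall>m. f m \<in> ?W m) \<and> finite {m. f m \<noteq> \<zero>\<^bsub>?L\<^esub>} \<and> x = (\<Oplus>\<^bsub>?L\<^esub> m\<in>{m. f m \<noteq> \<zero>\<^bsub>?L\<^esub>}. f m)"
    show "f = F"
    proof
      fix m
      show "f m = F m"
      proof (rule Lhh_eqI)
        fix k assume k: "k \<le> n"
        have "coordLhh g n x k = coordLhh g n (f (int n - 2 * int k)) k" using single[of f k] f k by metis
        thus "coordLhh g n (f m) k = coordLhh g n (F m) k" using f k by (auto simp: F weight_space_iff)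
      qed (use f F in \<open>auto simp: weight_space_iff\<close>)
    qed
  qed
qed

lemma xp2_qint: "xp2 g n j = qint g (int j) * qint g (int n - int j + 1)"
  by (simp add: xp2_def qint_def)

lemma basis_L:
  assumes m: "\<And>j. m j = (if 0 \<le> j \<and> j \<le> int n then Lhh_vec n g (nat j) else (zeroL n g))"
  shows "m j \<in> carrier (Lrep_hh n g)"
    and "k \<le> n \<Longrightarrow> coordLhh g n (m j) k = (if j = int k then 1 else 0)"
    and "x \<in> carrier (Lrep_hh n g) \<Longrightarrow> \<exists>!c. c \<in> {0..int n} \<rightarrow>\<^sub>E UNIV \<and>
             x = (\<Oplus>\<^bsub>Lrep_hh n g\<^esub> j\<in>{0..int n}. scal_act n g (c j) (m j))"
proof -
  let ?sum = "\<lambda>c. \<Oplus>\<^bsub>Lrep_hh n g\<^esub> j\<in>{0..int n}. scal_act n g (c j) (m j)"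
  let ?c = "restrict (\<lambda>j. coordLhh g n x (nat j)) {0..int n}"
  show mc: "m j \<in> carrier (Lrep_hh n g)" for j by (simp add: m vec_carrier Lhh_zero_carrier)
  show cm: "coordLhh g n (m j) k = (if j = int k then 1 else 0)" if "k \<le> n" for j k
    using that by (auto simp: m coord_vec coordLhh_zero)
  assume x: "x \<in> carrier (Lrep_hh n g)"
  have sum: "coordLhh g n (?sum c) k = c (int k)"
    if "k \<le> n" for c k
  proof -
    have "coordLhh g n (?sum c) k =
        (\<Sum>j\<in>{0..int n}. coordLhh g n (scal_act n g (c j) (m j)) k)"
      using that mc by (intro coordLhh_finsum) (auto intro: Lhh_smult_carrier)
    also have "\<dots> = (\<Sum>j\<in>{0..int n}. if j = int k then c (int k) else 0)"
      using that mc by (intro sum.cong) (auto simp: coordLhh_smult cm)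
    finally show ?thesis using that by simp
  qed
  show "\<exists>!c. c \<in> {0..int n} \<rightarrow>\<^sub>E UNIV \<and>
             x = ?sum c"
  proof (rule ex1I[of _ "?c"], intro conjI)
    show "x = ?sum ?c"
    proof (rule Lhh_eqI[OF x Lhh_finsum_carrier])
      fix k assume "k \<le> n"
      thus "coordLhh g n x k = coordLhh g n (?sum ?c) k"
        by (subst sum) simp_all
    qed (intro Lhh_smult_carrier mc)
  next
    fix c assume c: "c \<in> {0..int n} \<rightarrow>\<^sub>E UNIV \<and> x = ?sum c"
    show "c = ?c"
    proof
      fix j show "c j = ?c j"
      proof (cases "j \<in> {0..int n}")
        case True
        have "coordLhh g n x (nat j) = c (int (nat j))" using c sum[of "nat j" c] True by auto
        thus ?thesis using True by simp
      next
        case False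
        have "c \<in> extensional {0..int n}" using c by (simp add: PiE_def)
        hence "c j = undefined" using False by (rule extensional_arb)
        thus ?thesis by (simp only: restrict_apply False if_False)
      qed
    qed
  qed simp
qed

lemma action_L:
  assumes m: "\<And>j. m j = (if 0 \<le> j \<and> j \<le> int n then Lhh_vec n g (nat j) else (zeroL n g))"
    and j: "j \<in> {0..int n}"
  defines "act \<equiv> \<lambda>y v. gen_act n g y v" and "sc \<equiv> \<lambda>c v. scal_act n g c v"
  shows "act (G Hg) (m j) = sc (of_int (int n - 2 * j)) (m j)"
    and "act Cg (m j) = sc (of_int ((int n + 1)\<^sup>2)) (m j)"
    and "act (G Xm) (m j) = m (j + 1)"
    and "act (G Xp) (m j) = sc (qint g j * qint g (int n - j + 1)) (m (j - 1))"
proof -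
  note basis = basis_L(1,2)[OF m]
  obtain i where i: "j = int i" "i \<le> n" using j by (cases j) auto
  have mj: "m j = Lhh_vec n g i" using i by (simp add: m)
  have car: "act y (m j) \<in> carrier (Lrep_hh n g)" "sc c (m j') \<in> carrier (Lrep_hh n g)" for y c j'
    unfolding act_def sc_def by (intro Lhh_gen_carrier Lhh_smult_carrier basis)+
  have c_act: "coordLhh g n (act y (m j)) k = fps_map2 (ev (\<lambda>l. if l = i then 1 else 0) k) (gen_op2 g n y)" if "k \<le> n" for y k
    unfolding act_def mj by (rule coordLhh_gen_vec[OF that])
  have c_sc: "coordLhh g n (sc c (m j')) k = c * (if j' = int k then 1 else 0)" if "k \<le> n" for c k j'
    unfolding sc_def using that basis by (simp add: coordLhh_smult)
  show "act (G Hg) (m j) = sc (of_int (int n - 2 * j)) (m j)"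
  proof (rule Lhh_eqI[OF car])
    fix k assume k: "k \<le> n"
    have *: "of_int (int n - 2 * j) = const2 (wtH n i)" by (simp add: i wtH_def ring_mapD[OF ring_map_const2])
    show "coordLhh g n (act (G Hg) (m j)) k = coordLhh g n (sc (of_int (int n - 2 * j)) (m j)) k"
      unfolding c_act[OF k] c_sc[OF k] * by (simp add: i fps_eq_iff)
  qed
  show "act Cg (m j) = sc (of_int ((int n + 1)\<^sup>2)) (m j)"
  proof (rule Lhh_eqI[OF car])
    fix k assume k: "k \<le> n"
    have "of_int ((int n + 1)\<^sup>2) = const2 (of_int ((int n + 1)\<^sup>2) :: complex)"
      by (rule ring_mapD(9)[OF ring_map_const2, symmetric])
    also have "of_int ((int n + 1)\<^sup>2) = ((of_nat n + 1)\<^sup>2 :: complex)" by simp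
    finally have *: "of_int ((int n + 1)\<^sup>2) = const2 ((of_nat n + 1)\<^sup>2 :: complex)" .
    show "coordLhh g n (act Cg (m j)) k = coordLhh g n (sc (of_int ((int n + 1)\<^sup>2)) (m j)) k"
      unfolding c_act[OF k] c_sc[OF k] * by (simp add: i fps_eq_iff)
  qed
  show "act (G Xm) (m j) = m (j + 1)"
  proof (rule Lhh_eqI[OF car(1) basis(1)])
    fix k assume k: "k \<le> n"
    show "coordLhh g n (act (G Xm) (m j)) k = coordLhh g n (m (j + 1)) k"
      unfolding c_act[OF k] basis(2)[OF k] by (auto simp: i fps_eq_iff)
  qed
  show "act (G Xp) (m j) = sc (qint g j * qint g (int n - j + 1)) (m (j - 1))"
  proof (rule Lhh_eqI[OF car])
    fix k assume k: "k \<le> n"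
    have *: "qint g j * qint g (int n - j + 1) = xp2 g n i" by (simp add: xp2_qint i)
    show "coordLhh g n (act (G Xp) (m j)) k = coordLhh g n (sc (qint g j * qint g (int n - j + 1)) (m (j - 1))) k"
      unfolding c_act[OF k] c_sc[OF k] * by (auto simp: i fps_eq_iff)
  qed
qed

theorem proposition5p3:
  fixes n g :: nat
  assumes "g \<ge> 1"
  shows "\<exists>\<phi> \<chi> \<psi>.
    (\<forall>j\<le>n. \<phi> (const_series (series_module (over_C (Lrep n))) (const_series (over_C (Lrep n)) (L_vec n j)))
              = Lhh_vec n g j
         \<and> \<chi> (const_series (over_C (Lrep n)) (L_vec n j)) = Lh_vec n j
         \<and> \<psi> (const_series (over_Ch (Lrep_h n)) (Lh_vec n j)) = Lhh_vec n g j)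
    \<comment> \<open>1\<close>
    \<and> representation_hh g (over_C (Lrep n)) (Lrep_hh n g) \<phi>
    \<and> vectorspace.fin_dim type_ring (over_C (Lrep n))
    \<and> vectorspace.dim type_ring (over_C (Lrep n)) = n + 1
    \<comment> \<open>2\<close>
    \<and> irreducible_module Usl (Lrep n)
    \<and> deformation_along_hh g (Lrep n) (Lrep_hh n g) \<phi>
    \<comment> \<open>3\<close>
    \<and> deformation_along_h' g (over_C (Lrep n)) (Lrep_h n) (Lrep_hh n g) \<chi> \<psi>
    \<comment> \<open>4\<close>
    \<and> weight_representation g (Lrep_hh n g)
    \<comment> \<open>5\<close>
    \<and> (let m = (\<lambda>j::int. if 0 \<le> j \<and> j \<le> int n then Lhh_vec n g (nat j) else \<zero>\<^bsub>Lrep_hh n g\<^esub>);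
           act = (\<lambda>y v. Uhh_gen g y \<odot>\<^bsub>Lrep_hh n g\<^esub> v);
           sc = (\<lambda>c v. Uhh_scal g c \<odot>\<^bsub>Lrep_hh n g\<^esub> v)
       in (\<forall>j\<in>{0..int n}. m j \<in> carrier (Lrep_hh n g))
        \<and> (\<forall>x\<in>carrier (Lrep_hh n g). \<exists>!c. c \<in> {0..int n} \<rightarrow>\<^sub>E UNIV \<and>
             x = (\<Oplus>\<^bsub>Lrep_hh n g\<^esub> j\<in>{0..int n}. sc (c j) (m j)))
        \<and> (\<forall>j\<in>{0..int n}.
             act (G Hg) (m j) = sc (of_int (int n - 2 * j)) (m j)
           \<and> act Cg (m j) = sc (of_int ((int n + 1)\<^sup>2)) (m j)
           \<and> act (G Xm) (m j) = m (j + 1)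
           \<and> act (G Xp) (m j) = sc (qint g j * qint g (int n - j + 1)) (m (j - 1))))"
proof -
  define m where "m = (\<lambda>j::int. if 0 \<le> j \<and> j \<le> int n then Lhh_vec n g (nat j) else \<zero>\<^bsub>Lrep_hh n g\<^esub>)"
  have m: "m j = (if 0 \<le> j \<and> j \<le> int n then Lhh_vec n g (nat j) else \<zero>\<^bsub>Lrep_hh n g\<^esub>)" for j
    by (simp add: m_def)
  show ?thesis
    unfolding Let_def m_def[symmetric]
    by (intro exI[of _ "phi g n"] exI[of _ "chi n"] exI[of _ "psi g n"] conjI allI impI ballI
        phi_vec chi_vec psi_vec representation_hh_L coord_module_dim(2,3)[OF coord_module_L] irreducible_L
        deformation_hh_L deformation_h'_L weight_L basis_L[OF m] action_L[OF m])
qed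

end
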